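(* Let $\Omega=(a,b)$ be a bounded interval, let $\lambda>0$, and assume that $K:[0,\infty)\to[0,\infty)$ satisfies (K1), (K2) and (K3). Assume that $g\in L^\infty(a,b)$. Then there exists a piecewise constant minimizer of $TV_{Kg}$ over $BV(a,b)$ with finitely many jumps. Furthermore, let $M>0$ be a number such that $$M\ge\operatorname{ess\,sup}_{[a,b]}g-\operatorname{ess\,inf}_{[a,b]}g,$$ and let $U$ be a piecewise constant minimizer of $TV_{Kg}$ with finitely many jumps. Then $\operatorname{ess\,inf}g\le U\le\operatorname{ess\,sup}g$ on $[a,b]$, and the number $m$ of jumps of $U$ satisfies $$m\le\left[\frac{(b-a)\lambda}{A_M}\right]+1,\qquad A_M:=\min\left\{\frac{c_M}{M},\,C_M\right\},$$ where $C_M$ is the constant in (K2), $c_M$ is the constant in (K3w), and $[r]$ denotes the integer part of $r\ge0$.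
   Context: Conditions on $K$: (K1) $K$ is lower semicontinuous and non-decreasing with $K(0)=0$. (K2) For any $M>0$ there exists a constant $C_M>0$ such that $K(\rho_1)+K(\rho_2)\ge K(\rho_1+\rho_2)+C_M\rho_1\rho_2$ for all $\rho_1,\rho_2\ge0$ with $\rho_1+\rho_2\le M$. (K3) $\lim_{\rho\to0}K(\rho)/\rho=1$. Conditions (K1) and (K3) imply (K3w): for any $M>0$ there exists $c_M>0$ such that $K(\rho)\ge c_M\rho$ for $\rho\in[0,M]$. For $u\in BV(\Omega)$, $\Omega=(a,b)$, with distributional derivative $Du$, jump set $J_u$ and one-sided limits $u^\pm$ at points of $J_u$, set $$TV_K(u)=\int_{\Omega\setminus J_u}|Du|+\sum_{x\in J_u}K(|u^+(x)-u^-(x)|),\qquad TV_{Kg}(u)=TV_K(u)+\frac{\lambda}{2}\int_\Omega|u-g|^2\,dx.$$ Functions are identified when equal almost everywhere; pointwise properties refer to a suitable representative. *)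

theory Defs
  imports "HOL-Analysis.Analysis" "HOL-Probability.Essential_Supremum"
begin

section \<open>Functions of bounded variation on an open interval\<close>

definition smooth :: "(real \<Rightarrow> real) \<Rightarrow> bool" where
  "smooth \<phi> \<longleftrightarrow> (\<forall>n x. ((deriv ^^ n) \<phi>) differentiable (at x))"

definition test_function :: "real \<Rightarrow> real \<Rightarrow> (real \<Rightarrow> real) \<Rightarrow> bool" where
  "test_function a b \<phi> \<longleftrightarrow>
     smooth \<phi> \<and> compact (closure {x. \<phi> x \<noteq> 0}) \<and> closure {x. \<phi> x \<noteq> 0} \<subseteq> {a<..<b}"

text \<open>
  The distributional derivative of \<open>u\<close> on \<open>(a,b)\<close> is a finite signed Borel measure \<open>Du\<close>. Signed
  measures are represented by their Jordan decomposition \<open>Du = P - N\<close>, with \<open>P\<close> and \<open>N\<close> finite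
  and mutually singular; then \<open>|Du| = P + N\<close>.
\<close>
definition distributional_derivative ::
  "real \<Rightarrow> real \<Rightarrow> (real \<Rightarrow> real) \<Rightarrow> real measure \<times> real measure \<Rightarrow> bool" where
  "distributional_derivative a b u = (\<lambda>(P, N).
     finite_measure P \<and> sets P = sets (restrict_space borel {a<..<b}) \<and>
     finite_measure N \<and> sets N = sets (restrict_space borel {a<..<b}) \<and>
     (\<exists>A \<in> sets (restrict_space borel {a<..<b}).
        emeasure P ({a<..<b} - A) = 0 \<and> emeasure N A = 0) \<and>
     (\<forall>\<phi>. test_function a b \<phi> \<longrightarrow>
        (LINT x|lebesgue_on {a<..<b}. u x * deriv \<phi> x) =
          - ((LINT x|P. \<phi> x) - (LINT x|N. \<phi> x))))"

text \<open>Elements of \<open>BV\<close> are functions; all notions below depend on them only up to a.e. equality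
  on \<open>(a,b)\<close>, and values outside \<open>(a,b)\<close> are irrelevant.\<close>
definition BV :: "real \<Rightarrow> real \<Rightarrow> (real \<Rightarrow> real) set" where
  "BV a b = {u. integrable (lebesgue_on {a<..<b}) u \<and>
                (\<exists>PN. distributional_derivative a b u PN)}"

text \<open>\<open>|Du|(B)\<close> for Borel \<open>B \<subseteq> (a,b)\<close>; the pair chosen is unique.\<close>
definition abs_deriv :: "real \<Rightarrow> real \<Rightarrow> (real \<Rightarrow> real) \<Rightarrow> real set \<Rightarrow> ennreal" where
  "abs_deriv a b u B =
     (let (P, N) = (SOME PN. distributional_derivative a b u PN)
      in emeasure P B + emeasure N B)"

text \<open>The one-sided limits are those of a suitable representative of \<open>u\<close>.\<close>
definition has_left_limit :: "real \<Rightarrow> real \<Rightarrow> (real \<Rightarrow> real) \<Rightarrow> real \<Rightarrow> real \<Rightarrow> bool" where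
  "has_left_limit a b u x l \<longleftrightarrow>
     (\<exists>v. (AE y in lebesgue_on {a<..<b}. v y = u y) \<and> (v \<longlongrightarrow> l) (at_left x))"

definition has_right_limit :: "real \<Rightarrow> real \<Rightarrow> (real \<Rightarrow> real) \<Rightarrow> real \<Rightarrow> real \<Rightarrow> bool" where
  "has_right_limit a b u x l \<longleftrightarrow>
     (\<exists>v. (AE y in lebesgue_on {a<..<b}. v y = u y) \<and> (v \<longlongrightarrow> l) (at_right x))"

definition left_limit :: "real \<Rightarrow> real \<Rightarrow> (real \<Rightarrow> real) \<Rightarrow> real \<Rightarrow> real" where
  "left_limit a b u x = (THE l. has_left_limit a b u x l)"

definition right_limit :: "real \<Rightarrow> real \<Rightarrow> (real \<Rightarrow> real) \<Rightarrow> real \<Rightarrow> real" where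
  "right_limit a b u x = (THE l. has_right_limit a b u x l)"

definition jump_set :: "real \<Rightarrow> real \<Rightarrow> (real \<Rightarrow> real) \<Rightarrow> real set" where
  "jump_set a b u =
     {x \<in> {a<..<b}. \<exists>l r. has_left_limit a b u x l \<and> has_right_limit a b u x r \<and> l \<noteq> r}"

section \<open>The functionals\<close>

definition TV :: "real \<Rightarrow> real \<Rightarrow> (real \<Rightarrow> real) \<Rightarrow> (real \<Rightarrow> real) \<Rightarrow> ennreal" where
  "TV a b K u =
     abs_deriv a b u ({a<..<b} - jump_set a b u) +
     (\<Sum>\<^sub>\<infinity>x\<in>jump_set a b u. ennreal (K \<bar>right_limit a b u x - left_limit a b u x\<bar>))"

definition TVg ::
  "real \<Rightarrow> real \<Rightarrow> real \<Rightarrow> (real \<Rightarrow> real) \<Rightarrow> (real \<Rightarrow> real) \<Rightarrow> (real \<Rightarrow> real) \<Rightarrow> ennreal" where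
  "TVg a b lam K g u =
     TV a b K u +
     ennreal (lam / 2) * (\<integral>\<^sup>+x. ennreal (\<bar>u x - g x\<bar>\<^sup>2) \<partial>lebesgue_on {a<..<b})"

definition TVg_minimizer ::
  "real \<Rightarrow> real \<Rightarrow> real \<Rightarrow> (real \<Rightarrow> real) \<Rightarrow> (real \<Rightarrow> real) \<Rightarrow> (real \<Rightarrow> real) \<Rightarrow> bool" where
  "TVg_minimizer a b lam K g u \<longleftrightarrow>
     u \<in> BV a b \<and> (\<forall>v \<in> BV a b. TVg a b lam K g u \<le> TVg a b lam K g v)"

section \<open>Conditions on the jump density\<close>

text \<open>\<open>K\<close> maps \<open>[0,\<infinity>)\<close> to \<open>[0,\<infinity>)\<close>; its values at negative arguments are irrelevant.\<close>

definition K1 :: "(real \<Rightarrow> real) \<Rightarrow> bool" where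
  "K1 K \<longleftrightarrow>
     (\<forall>x\<ge>0. \<forall>y<K x. \<forall>\<^sub>F z in at x within {0..}. y < K z) \<and>
     mono_on {0..} K \<and> K 0 = 0"

definition K2_const :: "(real \<Rightarrow> real) \<Rightarrow> real \<Rightarrow> real \<Rightarrow> bool" where
  "K2_const K M C \<longleftrightarrow> C > 0 \<and>
     (\<forall>\<rho>1\<ge>0. \<forall>\<rho>2\<ge>0. \<rho>1 + \<rho>2 \<le> M \<longrightarrow> K \<rho>1 + K \<rho>2 \<ge> K (\<rho>1 + \<rho>2) + C * \<rho>1 * \<rho>2)"

definition K2 :: "(real \<Rightarrow> real) \<Rightarrow> bool" where
  "K2 K \<longleftrightarrow> (\<forall>M>0. \<exists>C. K2_const K M C)"

definition K3 :: "(real \<Rightarrow> real) \<Rightarrow> bool" where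
  "K3 K \<longleftrightarrow> ((\<lambda>\<rho>. K \<rho> / \<rho>) \<longlongrightarrow> 1) (at_right 0)"

definition K3w_const :: "(real \<Rightarrow> real) \<Rightarrow> real \<Rightarrow> real \<Rightarrow> bool" where
  "K3w_const K M c \<longleftrightarrow> c > 0 \<and> (\<forall>\<rho>\<in>{0..M}. K \<rho> \<ge> c * \<rho>)"

section \<open>Essentially bounded and piecewise constant functions\<close>

definition L_infinity :: "real \<Rightarrow> real \<Rightarrow> (real \<Rightarrow> real) set" where
  "L_infinity a b = {g. g \<in> borel_measurable (lebesgue_on {a<..<b}) \<and>
                        (\<exists>B. AE x in lebesgue_on {a<..<b}. \<bar>g x\<bar> \<le> B)}"

definition ess_sup_on :: "real \<Rightarrow> real \<Rightarrow> (real \<Rightarrow> real) \<Rightarrow> ereal" where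
  "ess_sup_on a b g = esssup (lebesgue_on {a<..<b}) (\<lambda>x. ereal (g x))"

definition ess_inf_on :: "real \<Rightarrow> real \<Rightarrow> (real \<Rightarrow> real) \<Rightarrow> ereal" where
  "ess_inf_on a b g = - esssup (lebesgue_on {a<..<b}) (\<lambda>x. - ereal (g x))"

text \<open>\<open>V\<close> is a representative of \<open>u\<close> on \<open>[a,b]\<close> that is constant on each of the finitely many
  components of \<open>[a,b] - S\<close>; its values at the points of \<open>S\<close> are arbitrary.\<close>
definition step_representative :: "real \<Rightarrow> real \<Rightarrow> (real \<Rightarrow> real) \<Rightarrow> (real \<Rightarrow> real) \<Rightarrow> bool" where
  "step_representative a b u V \<longleftrightarrow>
     (AE x in lebesgue_on {a<..<b}. V x = u x) \<and>
     (\<exists>S. finite S \<and> S \<subseteq> {a<..<b} \<and>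
        (\<forall>x y. a \<le> x \<and> x \<le> y \<and> y \<le> b \<and> {x..y} \<inter> S = {} \<longrightarrow> V x = V y))"

text \<open>This includes that there are only finitely many jumps.\<close>
definition piecewise_constant :: "real \<Rightarrow> real \<Rightarrow> (real \<Rightarrow> real) \<Rightarrow> bool" where
  "piecewise_constant a b u \<longleftrightarrow> (\<exists>V. step_representative a b u V)"

end

theory Submission
  imports Defs "HOL-Probability.Distribution_Functions"
begin

text \<open>
  Every \<open>u \<in> BV(a,b)\<close> coincides a.e. with \<open>k + Du((a,x])\<close> (du Bois-Reymond). Evaluating this
  representative on finer and finer finite sets that exhaust the jump set and a dense set yields step
  functions whose energies converge to at most the energy of \<open>u\<close>, since \<open>K\<close> is subadditive and
  \<open>K \<rho> \<le> \<rho>\<close>. So it is enough to minimize over step functions. With at most \<open>n\<close> jumps a minimizer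
  exists by compactness. Clipping at the essential bounds of \<open>g\<close> does not increase the energy, and
  merging the two jumps that bound a facet shorter than \<open>A\<^sub>M / \<lambda>\<close> strictly decreases it; so the number
  of jumps of these minimizers is bounded independently of \<open>n\<close>, and the one for that bound beats all
  step functions.
\<close>

section \<open>Smooth test functions\<close>

text \<open>\<open>BV\<close> is defined by testing, so before any comparison of energies the pair
  of measures has to be shown unique and \<open>u\<close> has to be recovered from it; this is what
  the bumps are for. Clipping must precede merging: the constants of (K2) and (K3w) hold only up to
  \<open>M\<close>, and the clipped range keeps every jump, and the sum of two adjacent ones, below
  \<open>M\<close>. The two entries of the minimum in the jump bound come from two kinds of facets.
  Two jumps of equal sign gain by (K2) at least \<open>C\<close> times their product when merged.
  For opposite signs, letting the larger jump absorb the smaller one, \<open>r\<close>, gains at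
  least \<open>cM * \<bar>r\<bar>\<close> and costs at most \<open>lam * M * \<bar>r\<bar>\<close>
  times the facet length, whence \<open>cM / M\<close>. The summand 1 arises because
  \<open>m\<close> jumps enclose \<open>m - 1\<close> facets. Merging and clipping never add a jump
  position. Hence both arguments already work for minimizers among step functions with at most
  \<open>n\<close> jumps, before a global minimizer is known to exist. The obstacle to compactness
  is that jumps may collide or run into an endpoint; such limits only save energy.\<close>

lemma smooth_coinduct:
  assumes "f \<in> F"
    and "\<And>f x. f \<in> F \<Longrightarrow> f differentiable (at x)"
    and "\<And>f. f \<in> F \<Longrightarrow> deriv f \<in> F"
  shows "smooth f"
proof -
  have "(deriv ^^ n) f \<in> F" for n
    by (induction n) (use assms in auto)
  then show ?thesis
    unfolding smooth_def using assms(2) by blast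
qed

lemma smooth_antiderivative:
  assumes "\<And>x. (F has_real_derivative f x) (at x)" "smooth f"
  shows "smooth F"
  unfolding smooth_def
proof (intro allI)
  fix n x
  have d: "deriv F = f"
    using assms(1) by (auto intro: DERIV_imp_deriv)
  show "(deriv ^^ n) F differentiable at x"
  proof (cases n)
    case 0
    then show ?thesis using assms(1) by (auto simp: real_differentiable_def)
  next
    case (Suc m)
    then have "(deriv ^^ n) F = (deriv ^^ m) f"
      by (simp add: funpow_swap1 d)
    then show ?thesis using assms(2) by (simp add: smooth_def)
  qed
qed

lemma smooth_has_derivative: "smooth f \<Longrightarrow> (f has_real_derivative deriv f x) (at x)"
  unfolding smooth_def DERIV_deriv_iff_real_differentiable
  by (drule spec[of _ 0]) simp

lemma smooth_deriv: "smooth f \<Longrightarrow> smooth (deriv f)"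
  unfolding smooth_def
proof (intro allI)
  fix n x assume "\<forall>n x. (deriv ^^ n) f differentiable at x"
  then have "(deriv ^^ Suc n) f differentiable at x" by blast
  then show "(deriv ^^ n) (deriv f) differentiable at x"
    by (simp only: funpow_Suc_right o_apply)
qed

lemma smooth_continuous: "smooth f \<Longrightarrow> continuous_on A f"
  by (intro continuous_at_imp_continuous_on ballI DERIV_isCont[OF smooth_has_derivative])

text \<open>Differentiating \<open>exp (- (1 / x))\<close> produces negative powers of
  \<open>x\<close>. With all these powers in the family, derivatives stay in its linear span, and a
  single limit at 0 serves every order.\<close>

definition flat_exp :: "nat \<Rightarrow> real \<Rightarrow> real" where
  "flat_exp k x = (if x > 0 then exp (- (1 / x)) / x ^ k else 0)"

lemma flat_exp_tendsto_0: "(flat_exp k \<longlongrightarrow> 0) (at_right 0)"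
proof -
  have "((\<lambda>x::real. inverse x ^ k / exp (inverse x)) \<longlongrightarrow> 0) (at_right 0)"
    using filterlim_compose[OF tendsto_power_div_exp_0 filterlim_inverse_at_top_right] by simp
  moreover have "\<forall>\<^sub>F x in at_right 0. inverse x ^ k / exp (inverse x) = flat_exp k x"
    unfolding eventually_at_right_field
    by (intro exI[of _ 1]) (auto simp: flat_exp_def exp_minus divide_simps)
  ultimately show ?thesis by (rule Lim_transform_eventually)
qed

lemma flat_exp_has_derivative:
  "(flat_exp k has_real_derivative flat_exp (k + 2) x - k * flat_exp (k + 1) x) (at x)"
proof -
  consider "x > 0" | "x < 0" | "x = 0" by linarith
  then show ?thesis
  proof cases
    case 1
    have inv: "((\<lambda>x. inverse x) has_real_derivative - (inverse x ^ 2)) (at x)"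
      using DERIV_inverse[of x] 1 by (simp add: numeral_2_eq_2)
    have pow: "((\<lambda>x. inverse x ^ k) has_real_derivative
        of_nat k * - (inverse x ^ 2) * inverse x ^ (k - Suc 0)) (at x)"
      using DERIV_power[OF inv, of k] by (simp add: algebra_simps)
    have "((\<lambda>x. exp (- inverse x) * inverse x ^ k) has_real_derivative
        (exp (- inverse x) * - (- (inverse x ^ 2))) * inverse x ^ k
        + (of_nat k * - (inverse x ^ 2) * inverse x ^ (k - Suc 0)) * exp (- inverse x)) (at x)"
      by (intro DERIV_mult DERIV_fun_exp DERIV_minus inv pow)
    also have "(exp (- inverse x) * - (- (inverse x ^ 2))) * inverse x ^ k
        + (of_nat k * - (inverse x ^ 2) * inverse x ^ (k - Suc 0)) * exp (- inverse x)
      = flat_exp (k + 2) x - k * flat_exp (k + 1) x"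
      using 1 by (cases k)
        (simp_all add: flat_exp_def divide_inverse power_inverse power2_eq_square)
    finally have "((\<lambda>x. exp (- (1 / x)) / x ^ k) has_real_derivative
        flat_exp (k + 2) x - k * flat_exp (k + 1) x) (at x)"
      by (simp add: divide_inverse power_inverse)
    then show ?thesis
      by (rule has_field_derivative_transform_within_open[where S = "{0<..}"])
        (use 1 in \<open>auto simp: flat_exp_def\<close>)
  next
    case 2
    have "((\<lambda>x. 0) has_real_derivative 0) (at x)" by simp
    then have "(flat_exp k has_real_derivative 0) (at x)"
      by (rule has_field_derivative_transform_within_open[where S = "{..<0}"])
        (use 2 in \<open>auto simp: flat_exp_def\<close>)
    with 2 show ?thesis by (simp add: flat_exp_def)
  next
    case 3
    have "((\<lambda>y. (flat_exp k y - flat_exp k 0) / (y - 0)) \<longlongrightarrow> 0) (at_left 0)"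
      by (rule Lim_transform_eventually[OF tendsto_const])
        (auto simp: eventually_at_left_field flat_exp_def intro!: exI[of _ "-1"])
    \<comment> \<open>For positive arguments this difference quotient is
      \<open>flat_exp (Suc k)\<close>, so the limit at 0 for the next exponent gives the
      derivative.\<close>
    moreover have "((\<lambda>y. (flat_exp k y - flat_exp k 0) / (y - 0)) \<longlongrightarrow> 0) (at_right 0)"
      by (rule Lim_transform_eventually[OF flat_exp_tendsto_0[of "Suc k"]])
        (auto simp: eventually_at_right_field flat_exp_def intro!: exI[of _ 1])
    ultimately have "(flat_exp k has_real_derivative 0) (at 0)"
      unfolding has_field_derivative_iff by (simp add: filterlim_at_split)
    with 3 show ?thesis by (simp add: flat_exp_def)
  qed
qed

text \<open>Smoothness asks for all iterated derivatives at once. A set of differentiable functions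
  that is closed under \<open>deriv\<close> settles all orders by \<open>smooth_coinduct\<close>.
  Affine arguments allow bumps on any interval; sums and products keep bumps and their linear
  combinations inside.\<close>

inductive_set flat_algebra :: "(real \<Rightarrow> real) set" where
  base: "(\<lambda>x. flat_exp k (\<alpha> * x + \<beta>)) \<in> flat_algebra"
| const: "(\<lambda>x. c) \<in> flat_algebra"
| add: "f \<in> flat_algebra \<Longrightarrow> h \<in> flat_algebra \<Longrightarrow> (\<lambda>x. f x + h x) \<in> flat_algebra"
| mult: "f \<in> flat_algebra \<Longrightarrow> h \<in> flat_algebra \<Longrightarrow> (\<lambda>x. f x * h x) \<in> flat_algebra"

lemma flat_algebra_has_derivative:
  "f \<in> flat_algebra \<Longrightarrow> \<exists>f'\<in>flat_algebra. \<forall>x. (f has_real_derivative f' x) (at x)"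
proof (induction rule: flat_algebra.induct)
  case (base k \<alpha> \<beta>)
  let ?f' = "\<lambda>x. \<alpha> * (flat_exp (k + 2) (\<alpha> * x + \<beta>) + (- real k) * flat_exp (k + 1) (\<alpha> * x + \<beta>))"
  have "?f' \<in> flat_algebra"
    by (intro flat_algebra.intros)
  moreover have "((\<lambda>x. flat_exp k (\<alpha> * x + \<beta>)) has_real_derivative ?f' x) (at x)" for x
  proof -
    have "((\<lambda>x. \<alpha> * x + \<beta>) has_real_derivative \<alpha>) (at x)"
      by (auto intro!: derivative_eq_intros)
    from DERIV_chain2[OF flat_exp_has_derivative this] show ?thesis
      by (simp add: algebra_simps)
  qed
  ultimately show ?case by (intro bexI[of _ ?f'] allI)
next
  case (const c)
  show ?case by (intro bexI[of _ "\<lambda>x. 0"]) (auto intro: flat_algebra.intros)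
next
  case (add f h)
  then obtain f' h' where "f' \<in> flat_algebra" "h' \<in> flat_algebra"
    "\<forall>x. (f has_real_derivative f' x) (at x)" "\<forall>x. (h has_real_derivative h' x) (at x)" by blast
  then show ?case
    by (intro bexI[of _ "\<lambda>x. f' x + h' x"]) (auto intro: flat_algebra.intros DERIV_add)
next
  case (mult f h)
  then obtain f' h' where "f' \<in> flat_algebra" "h' \<in> flat_algebra"
    "\<forall>x. (f has_real_derivative f' x) (at x)" "\<forall>x. (h has_real_derivative h' x) (at x)" by blast
  with mult.hyps show ?case
    by (intro bexI[of _ "\<lambda>x. f' x * h x + h' x * f x"]) (auto intro: flat_algebra.intros DERIV_mult)
qed

lemma flat_algebra_smooth:
  assumes "f \<in> flat_algebra"
  shows "smooth f"
proof (rule smooth_coinduct[of _ flat_algebra])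
  fix f :: "real \<Rightarrow> real" and x assume "f \<in> flat_algebra"
  then obtain f' where f': "f' \<in> flat_algebra" "\<forall>x. (f has_real_derivative f' x) (at x)"
    using flat_algebra_has_derivative by blast
  then show "f differentiable at x" by (auto simp: real_differentiable_def)
  from f' have "deriv f = f'" by (auto intro: DERIV_imp_deriv)
  with f' show "deriv f \<in> flat_algebra" by simp
qed (use assms in auto)

text \<open>The factor \<open>Suc n\<close> steepens both flanks without enlarging the support, so
  that the bumps tend to the indicator of the open interval, with 1 as common bound.\<close>

definition bump :: "real \<Rightarrow> real \<Rightarrow> nat \<Rightarrow> real \<Rightarrow> real" where
  "bump c d n x = flat_exp 0 (real (Suc n) * (x - c)) * flat_exp 0 (real (Suc n) * (d - x))"

lemma bump_in_flat_algebra: "bump c d n \<in> flat_algebra"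
proof -
  have "bump c d n = (\<lambda>x. flat_exp 0 (real (Suc n) * x + (- real (Suc n) * c)) * flat_exp 0 ((- real (Suc n)) * x + real (Suc n) * d))"
    by (auto simp: bump_def algebra_simps)
  also have "\<dots> \<in> flat_algebra"
    by (intro flat_algebra.mult flat_algebra.base)
  finally show ?thesis .
qed

lemma bump_smooth: "smooth (bump c d n)"
  by (intro flat_algebra_smooth bump_in_flat_algebra)

lemma bump_pos_iff: "bump c d n x > 0 \<longleftrightarrow> c < x \<and> x < d"
  by (auto simp: bump_def flat_exp_def zero_less_mult_iff)

lemma bump_nonneg: "bump c d n x \<ge> 0"
  by (auto simp: bump_def flat_exp_def)

lemma bump_eq_0: "\<not> (c < x \<and> x < d) \<Longrightarrow> bump c d n x = 0"
  using bump_pos_iff bump_nonneg by (metis order_less_le)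

lemma bump_le_1: "bump c d n x \<le> 1"
proof -
  have "flat_exp 0 y \<le> 1" "flat_exp 0 y \<ge> 0" for y
    by (auto simp: flat_exp_def)
  then show ?thesis
    unfolding bump_def by (simp add: mult_le_one)
qed

lemma bump_tendsto: "(\<lambda>n. bump c d n x) \<longlonglongrightarrow> indicator {c<..<d} x"
proof -
  have *: "(\<lambda>n. flat_exp 0 (real (Suc n) * y)) \<longlonglongrightarrow> 1" if "y > 0" for y :: real
  proof -
    have "(\<lambda>n. inverse (real (Suc n)) / y) \<longlonglongrightarrow> 0 / y"
      using that by (intro tendsto_divide LIMSEQ_inverse_real_of_nat tendsto_const) auto
    then have "(\<lambda>n. exp (- (inverse (real (Suc n)) / y))) \<longlonglongrightarrow> exp (- (0 / y))"
      by (intro tendsto_exp tendsto_minus)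
    moreover have "exp (- (inverse (real (Suc n)) / y)) = flat_exp 0 (real (Suc n) * y)" for n
      using that by (simp add: flat_exp_def divide_inverse)
    ultimately show ?thesis by simp
  qed
  show ?thesis
  proof (cases "c < x \<and> x < d")
    case True
    then have "(\<lambda>n. bump c d n x) \<longlonglongrightarrow> 1 * 1"
      unfolding bump_def by (intro tendsto_mult *) auto
    with True show ?thesis by simp
  next
    case False
    then show ?thesis by (simp add: bump_eq_0)
  qed
qed

section \<open>Supports of test functions\<close>

lemma test_functionI:
  assumes "smooth \<phi>" "a < c" "d < b" "\<And>x. \<not> (c \<le> x \<and> x \<le> d) \<Longrightarrow> \<phi> x = 0"
  shows "test_function a b \<phi>"
proof -
  have "{x. \<phi> x \<noteq> 0} \<subseteq> {c..d}" using assms(4) by force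
  then have *: "closure {x. \<phi> x \<noteq> 0} \<subseteq> {c..d}"
    by (simp add: closure_minimal)
  moreover from * have "compact (closure {x. \<phi> x \<noteq> 0})"
    by (meson bounded_closed_interval bounded_subset closed_closure compact_eq_bounded_closed)
  moreover have "{c..d} \<subseteq> {a<..<b}" using assms(2,3) by auto
  ultimately show ?thesis
    using assms(1) unfolding test_function_def by blast
qed

lemma test_functionE:
  assumes "test_function a b \<phi>"
  obtains c d where "a < c" "c < d" "d < b" "\<And>x. \<not> (c \<le> x \<and> x \<le> d) \<Longrightarrow> \<phi> x = 0" | "\<phi> = (\<lambda>x. 0)"
proof (cases "{x. \<phi> x \<noteq> 0} = {}")
  case True
  then have "\<phi> x = 0" for x by blast
  then have "\<phi> = (\<lambda>x. 0)" by (intro ext)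
  then show ?thesis by (rule that(2))
next
  case False
  define C where "C = closure {x. \<phi> x \<noteq> 0}"
  have C: "compact C" "C \<subseteq> {a<..<b}" "C \<noteq> {}"
    using assms False by (simp_all add: C_def test_function_def)
  obtain c where c: "c \<in> C" "\<And>x. x \<in> C \<Longrightarrow> c \<le> x"
    using compact_attains_inf[OF C(1,3)] by blast
  obtain d where d: "d \<in> C" "\<And>x. x \<in> C \<Longrightarrow> x \<le> d"
    using compact_attains_sup[OF C(1,3)] by blast
  have "d < b" using d(1) C(2) by auto
  \<comment> \<open>Moving the right end outwards gives \<open>c < d'\<close> without an argument
    that the support is more than one point.\<close>
  then obtain d' where d': "d < d'" "d' < b" using dense by blast
  have "\<phi> x = 0" if "\<not> (c \<le> x \<and> x \<le> d')" for x
  proof (rule ccontr)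
    assume "\<phi> x \<noteq> 0"
    then have "x \<in> C" unfolding C_def by (intro subsetD[OF closure_subset]) simp
    then have "c \<le> x" "x \<le> d" using c(2) d(2) by auto
    with d'(1) that show False by simp
  qed
  moreover have "c < d'" using c(2)[OF d(1)] d'(1) by simp
  moreover have "a < c" using c(1) C(2) by auto
  ultimately show ?thesis
    using d'(2) by (intro that(1)[of c d'])
qed

lemma bump_test_function: "a < c \<Longrightarrow> d < b \<Longrightarrow> test_function a b (bump c d n)"
  by (rule test_functionI[of _ _ c d]) (auto simp: bump_smooth intro!: bump_eq_0)

lemma deriv_eq_0_outside:
  fixes \<phi> :: "real \<Rightarrow> real"
  assumes "\<And>x. \<not> (c \<le> x \<and> x \<le> d) \<Longrightarrow> \<phi> x = 0" "\<not> (c \<le> x \<and> x \<le> d)"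
  shows "deriv \<phi> x = 0"
proof -
  have "((\<lambda>x. 0) has_real_derivative 0) (at x)" by simp
  then have "(\<phi> has_real_derivative 0) (at x)"
    by (rule has_field_derivative_transform_within_open[where S = "- {c..d}"])
      (use assms in \<open>auto simp: open_Compl\<close>)
  then show ?thesis by (rule DERIV_imp_deriv)
qed

lemma test_function_deriv_outside:
  assumes "test_function a b \<phi>" "x \<notin> {a<..<b}"
  shows "deriv \<phi> x = 0"
  using assms(1)
proof (rule test_functionE)
  fix c d assume cd: "a < c" "c < d" "d < b" "\<And>x. \<not> (c \<le> x \<and> x \<le> d) \<Longrightarrow> \<phi> x = 0"
  with assms(2) show ?thesis
    by (intro deriv_eq_0_outside[of c d]) auto
qed simp

section \<open>Functions of bounded variation as cumulative distribution functions\<close>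

text \<open>Equality of the signed measures \<open>M1 - M4\<close> and \<open>M3 - M2\<close> is
  written with sums, so that only positive measures occur. Test functions see only intervals with
  closure in \<open>(a,b)\<close>. As nothing is charged outside, continuity from below extends the
  hypothesis to all open intervals, which form a generator stable under intersections.\<close>

lemma finite_borel_measures_eqI:
  assumes M: "finite_borel_measure M1" "finite_borel_measure M2" "finite_borel_measure M3"
    "finite_borel_measure M4"
  assumes null: "measure M1 (- {a<..<b}) = 0" "measure M2 (- {a<..<b}) = 0"
    "measure M3 (- {a<..<b}) = 0" "measure M4 (- {a<..<b}) = 0"
  assumes eq: "\<And>c d. a < c \<Longrightarrow> c < d \<Longrightarrow> d < b \<Longrightarrow>
    measure M1 {c<..<d} + measure M2 {c<..<d} = measure M3 {c<..<d} + measure M4 {c<..<d}"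
  assumes A: "A \<in> sets borel"
  shows "measure M1 A + measure M2 A = measure M3 A + measure M4 A"
proof -
  have lim: "(\<lambda>n. measure M {max c a + inverse (Suc n)<..<min d b - inverse (Suc n)})
      \<longlonglongrightarrow> measure M {c<..<d}"
    if "finite_borel_measure M" "measure M (- {a<..<b}) = 0" for M c d
  proof -
    interpret finite_borel_measure M by fact
    let ?A = "\<lambda>n. {max c a + inverse (Suc n)<..<min d b - inverse (Suc n)}"
    have "incseq ?A"
    proof (rule incseq_SucI)
      fix n
      have "inverse (Suc (Suc n)) \<le> inverse (real (Suc n))"
        by (rule le_imp_inverse_le) auto
      then show "?A n \<le> ?A (Suc n)"
        by (intro subsetI) (unfold greaterThanLessThan_iff, linarith)
    qed
    then have "(\<lambda>n. measure M (?A n)) \<longlonglongrightarrow> measure M (\<Union>n. ?A n)"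
      by (intro finite_Lim_measure_incseq) auto
    also have "(\<Union>n. ?A n) = {max c a<..<min d b}"
    proof (intro equalityI subsetI)
      fix x assume x: "x \<in> {max c a<..<min d b}"
      then obtain n where n: "inverse (real (Suc n)) < min (x - max c a) (min d b - x)"
        using reals_Archimedean[of "min (x - max c a) (min d b - x)"] by auto
      then have "x \<in> ?A n" by auto
      then show "x \<in> (\<Union>n. ?A n)" by blast
    next
      fix x assume "x \<in> (\<Union>n. ?A n)"
      then obtain n where "x \<in> ?A n" by blast
      moreover have "inverse (real (Suc n)) > 0" by simp
      ultimately show "x \<in> {max c a<..<min d b}"
        unfolding greaterThanLessThan_iff by linarith
    qed
    also have "measure M {max c a<..<min d b} = measure M {c<..<d}"
    proof (rule measure_eq_AE)
      have "AE x in M. x \<notin> - {a<..<b}"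
        using that(2) by (intro AE_not_in) (auto simp: null_sets_def emeasure_eq_measure)
      then show "AE x in M. x \<in> {max c a<..<min d b} \<longleftrightarrow> x \<in> {c<..<d}"
        by eventually_elim auto
    qed auto
    finally show ?thesis .
  qed
  have interval: "measure M1 {c<..<d} + measure M2 {c<..<d} = measure M3 {c<..<d} + measure M4 {c<..<d}" for c d
  proof -
    let ?A = "\<lambda>n. {max c a + inverse (Suc n)<..<min d b - inverse (Suc n)}"
    have "measure M1 (?A n) + measure M2 (?A n) = measure M3 (?A n) + measure M4 (?A n)" for n
    proof (cases "max c a + inverse (Suc n) < min d b - inverse (Suc n)")
      case True
      have "inverse (real (Suc n)) > 0" by simp
      with True show ?thesis
        by (intro eq) linarith+
    next
      case False
      then have "?A n = {}" by auto
      then show ?thesis by (simp only: measure_empty)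
    qed
    moreover have "(\<lambda>n. measure M1 (?A n) + measure M2 (?A n)) \<longlonglongrightarrow> measure M1 {c<..<d} + measure M2 {c<..<d}"
      by (intro tendsto_add lim M null)
    moreover have "(\<lambda>n. measure M3 (?A n) + measure M4 (?A n)) \<longlonglongrightarrow> measure M3 {c<..<d} + measure M4 {c<..<d}"
      by (intro tendsto_add lim M null)
    ultimately show ?thesis
      using LIMSEQ_unique by (metis (no_types, lifting) ext)
  qed
  \<comment> \<open>Equal total masses are what the complement case of the induction over the
    generated sigma-algebra requires.\<close>
  have total: "measure M1 UNIV + measure M2 UNIV = measure M3 UNIV + measure M4 UNIV"
  proof -
    have "measure M UNIV = measure M {a<..<b}" if "finite_borel_measure M" "measure M (- {a<..<b}) = 0" for M
    proof -
      interpret finite_borel_measure M by fact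
      have "measure M ({a<..<b} \<union> - {a<..<b}) = measure M {a<..<b} + measure M (- {a<..<b})"
        by (rule finite_measure_Union) auto
      with that(2) show ?thesis by simp
    qed
    with M null interval[of a b] show ?thesis by simp
  qed
  have borel: "sets borel = sigma_sets UNIV (range (\<lambda>(c, d). {c<..<d::real}))"
    by (subst borel_eq_box) (simp add: sets_measure_of box_real[abs_def] box_eq_empty case_prod_beta)
  have stable: "Int_stable (range (\<lambda>(c, d). {c<..<d::real}))"
  proof (rule Int_stableI, safe)
    fix c d c' d' :: real
    have "{c<..<d} \<inter> {c'<..<d'} = {max c c'<..<min d d'}" by auto
    then show "{c<..<d} \<inter> {c'<..<d'} \<in> range (\<lambda>(c, d). {c<..<d})" by auto
  qed
  have "range (\<lambda>(c, d). {c<..<d::real}) \<subseteq> Pow UNIV" by simp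
  from stable this A[unfolded borel] show ?thesis
  proof (induction A rule: sigma_sets_induct_disjoint)
    case (basic A)
    then show ?case using interval by auto
  next
    case empty
    show ?case by simp
  next
    case (compl A)
    have "measure M (UNIV - A) = measure M UNIV - measure M A" if "finite_borel_measure M" for M
    proof -
      interpret finite_borel_measure M by fact
      show ?thesis using finite_measure_compl[of A] compl(1) by (auto simp: borel[symmetric] borel_UNIV)
    qed
    with M total compl(2) show ?case by simp
  next
    case (union A)
    have s: "(\<lambda>i. measure M (A i)) sums measure M (\<Union>i. A i)" if "finite_borel_measure M" for M
    proof -
      interpret finite_borel_measure M by fact
      show ?thesis using union(1,2) by (intro finite_measure_UNION) (auto simp: borel[symmetric])
    qed
    show ?case
      using sums_unique2[OF sums_add[OF s[OF M(1)] s[OF M(2)], unfolded union(3)] sums_add[OF s[OF M(3)] s[OF M(4)]]] .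
  qed
qed

section \<open>Integration by parts and the lemma of du Bois-Reymond\<close>

lemma integral_lebesgue_on_borel:
  fixes f :: "real \<Rightarrow> real"
  assumes "f \<in> borel_measurable borel" "S \<in> sets borel"
  shows "(LINT x|lebesgue_on S. f x) = (LINT x|lborel. indicator S x * f x)"
  using assms by (simp add: integral_restrict_space integral_completion)

lemma compactly_supported_integrable:
  fixes f :: "real \<Rightarrow> real"
  assumes "continuous_on UNIV f" "\<And>x. \<not> (c \<le> x \<and> x \<le> d) \<Longrightarrow> f x = 0"
  shows "integrable lborel f"
proof -
  have "integrable lborel (\<lambda>x. indicator {c..d} x *\<^sub>R f x)"
    using assms(1) by (intro borel_integrable_compact) (auto intro: continuous_on_subset)
  also have "(\<lambda>x. indicator {c..d} x *\<^sub>R f x) = f"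
    using assms(2) by (intro ext) (simp add: indicator_def, blast)
  finally show ?thesis .
qed

text \<open>Integration by parts through Fubini for the kernel
  \<open>indicator {..x} y * deriv \<phi> x\<close>: integrating in \<open>y\<close> produces the
  distribution function, integrating in \<open>x\<close> over the half-line from \<open>y\<close>
  produces \<open>- \<phi> y\<close>, since \<open>\<phi>\<close> vanishes far to the right.\<close>

lemma (in finite_borel_measure) integral_cdf_times_deriv:
  assumes \<phi>: "smooth \<phi>" "\<And>x. \<not> (c \<le> x \<and> x \<le> d) \<Longrightarrow> \<phi> x = 0"
  shows "(LINT x|lborel. cdf M x * deriv \<phi> x) = - (LINT x|M. \<phi> x)"
    and "integrable lborel (\<lambda>x. cdf M x * deriv \<phi> x)"
proof -
  interpret L: pair_sigma_finite lborel M ..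
  have cont: "continuous_on UNIV (deriv \<phi>)"
    using \<phi>(1) by (intro smooth_continuous smooth_deriv)
  have [measurable]: "deriv \<phi> \<in> borel_measurable borel"
    using cont by (rule borel_measurable_continuous_onI)
  have d0: "deriv \<phi> x = 0" if "\<not> (c \<le> x \<and> x \<le> d)" for x
    by (rule deriv_eq_0_outside[OF \<phi>(2) that])
  have int: "integrable lborel (deriv \<phi>)"
    using compactly_supported_integrable[OF cont d0] .
  let ?f = "\<lambda>x y. indicator {..x} y * deriv \<phi> x"
  have meas: "(\<lambda>(x, y). ?f x y) \<in> borel_measurable (lborel \<Otimes>\<^sub>M M)"
  proof -
    have "(\<lambda>p. (if snd p \<le> fst p then 1 else 0) * deriv \<phi> (fst p)) \<in> borel_measurable (borel \<Otimes>\<^sub>M borel)"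
      by measurable
    also have "borel_measurable (borel \<Otimes>\<^sub>M borel) = borel_measurable (lborel \<Otimes>\<^sub>M M)"
      by (intro measurable_cong_sets sets_pair_measure_cong) (auto simp: M_is_borel)
    finally show ?thesis by (simp add: indicator_def case_prod_beta of_bool_def)
  qed
  have y: "(LINT y|M. ?f x y) = cdf M x * deriv \<phi> x" for x
    by (simp add: cdf_def borel_UNIV)
  have x: "(LINT x|lborel. ?f x y) = - \<phi> y" for y
  proof -
    \<comment> \<open>An upper limit that is not below \<open>y\<close> and lies beyond the support,
      so that \<open>\<phi>\<close> vanishes there.\<close>
    define e where "e = max y (d + 1)"
    have "(LINT x|lborel. ?f x y) = (LINT x|lborel. deriv \<phi> x * indicator {y..e} x)"
      by (rule Bochner_Integration.integral_cong) (auto simp: indicator_def e_def intro!: d0)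
    also have "\<dots> = \<phi> e - \<phi> y"
      using cont by (intro integral_FTC_Icc_real smooth_has_derivative \<phi>)
        (auto simp: e_def continuous_on_eq_continuous_at)
    also have "\<phi> e = 0" by (rule \<phi>(2)) (auto simp: e_def)
    finally show ?thesis by simp
  qed
  have integrable: "integrable (lborel \<Otimes>\<^sub>M M) (\<lambda>(x, y). ?f x y)"
  proof (rule L.Fubini_integrable[OF meas, unfolded prod.case])
    have "(LINT y|M. norm (?f x y)) = cdf M x * norm (deriv \<phi> x)" for x
      by (simp add: cdf_def abs_mult borel_UNIV)
    moreover have "integrable lborel (\<lambda>x. cdf M x * norm (deriv \<phi> x))"
    proof (rule Bochner_Integration.integrable_bound)
      show "integrable lborel (\<lambda>x. measure M (space M) * norm (deriv \<phi> x))"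
        using int by (intro integrable_mult_right integrable_norm)
      show "(\<lambda>x. cdf M x * norm (deriv \<phi> x)) \<in> borel_measurable lborel"
        using borel_measurable_mono[of "cdf M"] by (simp add: mono_def cdf_nondecreasing)
      show "AE x in lborel. norm (cdf M x * norm (deriv \<phi> x)) \<le> norm (measure M (space M) * norm (deriv \<phi> x))"
        using cdf_bounded cdf_nonneg by (auto simp: abs_mult intro!: mult_right_mono)
    qed
    ultimately show "integrable lborel (\<lambda>x. LINT y|M. norm (?f x y))" by simp
    show "AE x in lborel. integrable M (\<lambda>y. ?f x y)"
    proof (intro AE_I2 integrable_mult_left)
      fix x show "integrable M (indicator {..x} :: real \<Rightarrow> real)"
        by (rule integrable_real_indicator) (auto simp: emeasure_eq_measure)
    qed
  qed
  from L.Fubini_integral[OF integrable] show "(LINT x|lborel. cdf M x * deriv \<phi> x) = - (LINT x|M. \<phi> x)"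
    by (simp add: x y del: Bochner_Integration.integral_mult_left integral_mult_left_zero)
  from L.integrable_fst'[OF integrable] show "integrable lborel (\<lambda>x. cdf M x * deriv \<phi> x)"
    by (simp add: y del: Bochner_Integration.integral_mult_left integral_mult_left_zero)
qed

text \<open>The primitive starting at \<open>c\<close> vanishes on the left by construction and on
  the right because the total integral is 0. A vanishing mean is the only obstruction to being the
  derivative of a test function.\<close>

lemma ex_compactly_supported_antiderivative:
  fixes f :: "real \<Rightarrow> real"
  assumes f: "continuous_on UNIV f" "\<And>x. \<not> (c < x \<and> x < d) \<Longrightarrow> f x = 0"
    and int: "(LINT x|lborel. f x) = 0"
  shows "\<exists>F. (\<forall>x. (F has_real_derivative f x) (at x)) \<and> (\<forall>x. \<not> (c \<le> x \<and> x \<le> d) \<longrightarrow> F x = 0)"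
proof (intro exI conjI allI impI)
  let ?F = "\<lambda>x. LBINT y=ereal c..ereal x. f y"
  fix x
  show "(?F has_real_derivative f x) (at x)"
  proof -
    have "(?F has_vector_derivative f x) (at x within {min c x - 1..max c x + 1})"
      by (rule interval_integral_FTC2) (auto intro: continuous_on_subset[OF f(1)])
    then show ?thesis
      by (simp add: has_real_derivative_iff_has_vector_derivative at_within_Icc_at)
  qed
  assume that: "\<not> (c \<le> x \<and> x \<le> d)"
  show "?F x = 0"
  proof (cases "x < c")
    case True
    then have "?F x = - (LBINT y:{x..c}. f y)"
      by (subst interval_integral_endpoints_reverse) (simp add: interval_integral_Icc)
    also have "(LBINT y:{x..c}. f y) = (LBINT y:{x..c}. 0)"
      by (rule set_lebesgue_integral_cong) (auto intro!: f(2))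
    finally show ?thesis by simp
  next
    case False
    with that have x: "c \<le> x" "d < x" by auto
    then have "?F x = (LBINT y:{c..x}. f y)"
      by (simp add: interval_integral_Icc)
    also have "\<dots> = (LINT y|lborel. f y)"
      unfolding set_lebesgue_integral_def
    proof (rule Bochner_Integration.integral_cong[OF refl])
      fix y
      show "indicator {c..x} y *\<^sub>R f y = f y"
        using x f(2)[of y] by (cases "c < y \<and> y < d") auto
    qed
    finally show ?thesis using int by simp
  qed
qed

text \<open>The positive and the negative part of \<open>h\<close> are densities of two finite
  measures that agree on compactly contained intervals, hence on all Borel sets; densities are
  unique. The zero measure \<open>?Z\<close> fills the two remaining places of the comparison
  lemma.\<close>

lemma AE_eq_0_of_interval_integrals:
  fixes h :: "real \<Rightarrow> real"
  assumes h: "integrable lborel h" "\<And>x. x \<notin> {a<..<b} \<Longrightarrow> h x = 0"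
    and int: "\<And>c d. a < c \<Longrightarrow> c < d \<Longrightarrow> d < b \<Longrightarrow> (LINT x|lborel. h x * indicator {c<..<d} x) = 0"
  shows "AE x in lborel. h x = 0"
proof -
  have [measurable]: "h \<in> borel_measurable borel" using h(1) by auto
  have fin: "finite_borel_measure (density lborel (\<lambda>x. ennreal (f x)))"
    if "integrable lborel f" "\<And>x. f x \<ge> 0" for f :: "real \<Rightarrow> real"
  proof (intro finite_borel_measure.intro finite_borel_measure_axioms.intro finite_measureI)
    have [measurable]: "f \<in> borel_measurable borel" using that(1) by auto
    have "emeasure (density lborel (\<lambda>x. ennreal (f x))) UNIV = ennreal (LINT x|lborel. f x)"
      using that by (subst emeasure_density) (auto simp: nn_integral_eq_integral)
    then show "emeasure (density lborel (\<lambda>x. ennreal (f x))) (space (density lborel (\<lambda>x. ennreal (f x)))) \<noteq> \<infinity>"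
      by simp
  qed auto
  have m: "measure (density lborel (\<lambda>x. ennreal (f x))) A = (LINT x|lborel. f x * indicator A x)"
    if f: "integrable lborel f" "\<And>x. f x \<ge> 0" and A: "A \<in> sets borel" for f :: "real \<Rightarrow> real" and A
  proof -
    have [measurable]: "f \<in> borel_measurable borel" using f(1) by auto
    have "emeasure (density lborel (\<lambda>x. ennreal (f x))) A = (\<integral>\<^sup>+x. ennreal (f x * indicator A x) \<partial>lborel)"
      using A by (subst emeasure_density) (auto intro!: nn_integral_cong simp: indicator_def)
    also have "\<dots> = ennreal (LINT x|lborel. f x * indicator A x)"
      using f A by (intro nn_integral_eq_integral) (auto intro!: integrable_real_mult_indicator)
    finally show ?thesis
      using f by (auto simp: measure_def intro!: enn2real_ennreal integral_nonneg_AE)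
  qed
  let ?p = "\<lambda>x. max 0 (h x)" and ?n = "\<lambda>x. max 0 (- h x)"
  let ?P = "density lborel (\<lambda>x. ennreal (?p x))" and ?N = "density lborel (\<lambda>x. ennreal (?n x))"
  let ?Z = "density lborel (\<lambda>x. ennreal 0)"
  have pn: "integrable lborel ?p" "integrable lborel ?n" using h(1) by auto
  have z: "integrable lborel (\<lambda>x::real. 0::real)" by simp
  note fins = fin[OF pn(1)] fin[OF pn(2)] fin[OF z]
  have diff: "(LINT x|lborel. ?p x * indicator A x) - (LINT x|lborel. ?n x * indicator A x)
      = (LINT x|lborel. h x * indicator A x)" if "A \<in> sets borel" for A
  proof -
    have "integrable lborel (\<lambda>x. ?p x * indicator A x)" "integrable lborel (\<lambda>x. ?n x * indicator A x)"
      using that pn by (auto intro!: integrable_real_mult_indicator)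
    note Bochner_Integration.integral_diff[OF this, symmetric]
    also have "(LINT x|lborel. ?p x * indicator A x - ?n x * indicator A x)
        = (LINT x|lborel. h x * indicator A x)"
      by (rule Bochner_Integration.integral_cong[OF refl]) (auto simp: max_def indicator_def)
    finally show ?thesis .
  qed
  have eq: "measure ?P A + measure ?Z A = measure ?N A + measure ?Z A" if A: "A \<in> sets borel" for A
  proof (rule finite_borel_measures_eqI[where a = a and b = b, OF _ _ _ _ _ _ _ _ _ A])
    show "measure ?P (- {a<..<b}) = 0" "measure ?N (- {a<..<b}) = 0"
    proof -
      have "(\<lambda>x. ?p x * indicator (- {a<..<b}) x) = (\<lambda>x. 0)" "(\<lambda>x. ?n x * indicator (- {a<..<b}) x) = (\<lambda>x. 0)"
        using h(2) by (force simp: indicator_def fun_eq_iff)+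
      then show "measure ?P (- {a<..<b}) = 0" "measure ?N (- {a<..<b}) = 0"
        using pn by (simp_all add: m)
    qed
    show "measure ?Z (- {a<..<b}) = 0"  "measure ?Z (- {a<..<b}) = 0"
      using z by (subst m; auto)+
    fix c d assume "a < c" "c < d" "d < b"
    then show "measure ?P {c<..<d} + measure ?Z {c<..<d} = measure ?N {c<..<d} + measure ?Z {c<..<d}"
      using int[of c d] diff[of "{c<..<d}"] pn by (simp add: m)
  qed (use fins in simp_all)
  have "AE x in lborel. h x = 0"
  proof (rule density_unique_real)
    fix A :: "real set" assume A: "A \<in> sets lborel"
    with eq[of A] diff[of A] pn have "(LINT x|lborel. h x * indicator A x) = 0"
      by (simp add: m)
    then show "(LINT x:A|lborel. h x) = (LINT x:A|lborel. 0)"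
      by (simp add: set_lebesgue_integral_def mult.commute)
  qed (use h in auto)
  then show ?thesis .
qed

text \<open>A bump becomes the derivative of a test function once the multiple \<open>r\<close> of a
  fixed bump \<open>\<eta>\<close> is subtracted that makes its integral 0. Testing with the
  primitive shows that \<open>h\<close> and the constant \<open>k\<close>, the
  \<open>\<eta>\<close>-average of \<open>h\<close>, have the same integral against every bump;
  steepening the bumps carries this over to intervals.\<close>

lemma du_Bois_Reymond:
  fixes h :: "real \<Rightarrow> real"
  assumes "a < b" and h: "integrable lborel h" "\<And>x. x \<notin> {a<..<b} \<Longrightarrow> h x = 0"
    and int: "\<And>\<phi>. test_function a b \<phi> \<Longrightarrow> (LINT x|lborel. h x * deriv \<phi> x) = 0"
  shows "\<exists>k. AE x in lborel. x \<in> {a<..<b} \<longrightarrow> h x = k"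
proof -
  obtain c0 where c0: "a < c0" "c0 < b" using dense \<open>a < b\<close> by blast
  obtain d0 where d0: "c0 < d0" "d0 < b" using dense c0 by blast
  have [measurable]: "h \<in> borel_measurable borel" using h(1) by auto
  have bm[measurable]: "bump c d n \<in> borel_measurable borel" for c d n
    by (intro borel_measurable_continuous_onI smooth_continuous bump_smooth)
  have bi: "integrable lborel (bump c d n)" for c d n
    by (rule compactly_supported_integrable[of _ c d])
      (auto intro!: smooth_continuous bump_smooth bump_eq_0)
  have bh: "integrable lborel (\<lambda>x. h x * bump c d n x)" for c d n
    by (rule Bochner_Integration.integrable_bound[OF h(1)])
      (auto simp: abs_mult bump_nonneg bump_le_1 intro!: mult_left_le)
  define \<eta> where "\<eta> = bump c0 d0 0"
  define I where "I = (LINT x|lborel. \<eta> x)"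
  have "I \<noteq> 0"
  proof
    assume "I = 0"
    then have "AE x in lborel. \<eta> x = 0"
      using integral_nonneg_eq_0_iff_AE[OF bi[of c0 d0 0]] by (simp add: I_def \<eta>_def bump_nonneg)
    then have "AE x in lborel. x \<notin> {c0<..<d0}"
      by eventually_elim (metis \<eta>_def bump_pos_iff greaterThanLessThan_iff less_irrefl)
    then have "{c0<..<d0} \<in> null_sets lborel"
      by (subst AE_iff_null_sets) auto
    then have "emeasure lborel {c0<..<d0} = 0"
      by (rule null_setsD1)
    with d0(1) show False by simp
  qed
  define k where "k = (LINT x|lborel. h x * \<eta> x) / I"
  have *: "(LINT x|lborel. h x * bump c d n x) = k * (LINT x|lborel. bump c d n x)"
    if cd: "a < c" "c < d" "d < b" for c d n
  proof -
    define r where "r = (LINT x|lborel. bump c d n x) / I"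
    define f where "f = (\<lambda>x. bump c d n x + (- r) * \<eta> x)"
    have f: "f \<in> flat_algebra"
      unfolding f_def \<eta>_def by (intro flat_algebra.intros bump_in_flat_algebra)
    have f_int: "(LINT x|lborel. f x) = 0"
      unfolding f_def using bi \<open>I \<noteq> 0\<close>
      by (subst Bochner_Integration.integral_add) (auto simp: \<eta>_def I_def r_def)
    have f_0: "f x = 0" if "\<not> (min c c0 < x \<and> x < max d d0)" for x
    proof -
      have "\<not> (c < x \<and> x < d)" "\<not> (c0 < x \<and> x < d0)" using that by auto
      then show ?thesis by (simp add: f_def \<eta>_def bump_eq_0)
    qed
    obtain F where F: "\<And>x. (F has_real_derivative f x) (at x)"
      "\<And>x. \<not> (min c c0 \<le> x \<and> x \<le> max d d0) \<Longrightarrow> F x = 0"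
      using ex_compactly_supported_antiderivative[OF smooth_continuous[OF flat_algebra_smooth[OF f]] f_0 f_int] by blast
    have "test_function a b F"
      by (rule test_functionI[OF smooth_antiderivative[OF F(1) flat_algebra_smooth[OF f]] _ _ F(2)])
        (use cd c0 d0 in auto)
    from int[OF this] have "(LINT x|lborel. h x * f x) = 0"
      by (simp add: DERIV_imp_deriv[OF F(1)])
    also have "(LINT x|lborel. h x * f x) = (LINT x|lborel. h x * bump c d n x + (- r) * (h x * \<eta> x))"
      by (simp add: f_def algebra_simps)
    also have "\<dots> = (LINT x|lborel. h x * bump c d n x) + (- r) * (LINT x|lborel. h x * \<eta> x)"
      using bh by (subst Bochner_Integration.integral_add) (auto simp: \<eta>_def)
    finally show ?thesis using \<open>I \<noteq> 0\<close> by (simp add: k_def r_def)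
  qed
  have **: "(LINT x|lborel. h x * indicator {c<..<d} x) = k * (d - c)" if cd: "a < c" "c < d" "d < b" for c d
  proof -
    have "(\<lambda>n. LINT x|lborel. h x * bump c d n x) \<longlonglongrightarrow> (LINT x|lborel. h x * indicator {c<..<d} x)"
    proof (rule integral_dominated_convergence[where w = "\<lambda>x. norm (h x)"])
      show "AE x in lborel. (\<lambda>n. h x * bump c d n x) \<longlonglongrightarrow> h x * indicator {c<..<d} x"
        by (intro AE_I2 tendsto_intros bump_tendsto)
      show "AE x in lborel. norm (h x * bump c d n x) \<le> norm (h x)" for n
        by (auto simp: abs_mult bump_nonneg bump_le_1 intro!: mult_left_le)
    qed (use h in auto)
    moreover have "(\<lambda>n. LINT x|lborel. bump c d n x) \<longlonglongrightarrow> (LINT x|lborel. indicator {c<..<d} x)"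
    proof (rule integral_dominated_convergence[where w = "indicator {c..d}"])
      show "AE x in lborel. (\<lambda>n. bump c d n x) \<longlonglongrightarrow> indicator {c<..<d} x"
        by (intro AE_I2 bump_tendsto)
      show "AE x in lborel. norm (bump c d n x) \<le> indicator {c..d} x" for n
        using bump_le_1 bump_nonneg by (auto simp: indicator_def bump_eq_0)
    qed (use cd in auto)
    then have "(\<lambda>n. k * (LINT x|lborel. bump c d n x)) \<longlonglongrightarrow> k * (d - c)"
      using cd by (intro tendsto_mult tendsto_const) simp
    ultimately show ?thesis
      using *[OF cd] by (simp add: LIMSEQ_unique)
  qed
  have ik: "integrable lborel (\<lambda>x. k * indicator {a<..<b} x)"
    using \<open>a < b\<close> by (intro integrable_mult_right integrable_real_indicator) auto
  have "AE x in lborel. h x - k * indicator {a<..<b} x = 0"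
  proof (rule AE_eq_0_of_interval_integrals[of _ a b])
    fix c d assume cd: "a < c" "c < d" "d < b"
    have "(LINT x|lborel. (h x - k * indicator {a<..<b} x) * indicator {c<..<d} x)
      = (LINT x|lborel. h x * indicator {c<..<d} x - k * indicator {c<..<d} x)"
      using cd by (intro Bochner_Integration.integral_cong) (auto simp: indicator_def)
    also have "\<dots> = 0"
      using h(1) **[OF cd] cd by (subst Bochner_Integration.integral_diff) (auto intro: integrable_real_mult_indicator)
    finally show "(LINT x|lborel. (h x - k * indicator {a<..<b} x) * indicator {c<..<d} x) = 0" .
  qed (use h ik in auto)
  then show ?thesis
    by (intro exI[of _ k], eventually_elim) auto
qed

text \<open>\<open>P\<close> lives on the trace sigma-algebra of \<open>(a,b)\<close>, whereas
  distribution functions belong to Borel measures on the line. The push-forward under the identity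
  extends \<open>P\<close> by 0.\<close>

definition on_line :: "real measure \<Rightarrow> real measure" where
  "on_line P = distr P borel (\<lambda>x. x)"

locale interval_measure = finite_measure P for a b :: real and P :: "real measure" +
  assumes sets_eq: "sets P = sets (restrict_space borel {a<..<b})"
begin

lemma space_eq: "space P = {a<..<b}"
  using sets_eq_imp_space_eq[OF sets_eq] by (simp add: space_restrict_space)

lemma borel_measurable: "f \<in> borel_measurable borel \<Longrightarrow> f \<in> borel_measurable P"
  by (subst measurable_cong_sets[OF sets_eq refl]) (rule measurable_restrict_space1)

lemma id_measurable: "(\<lambda>x. x) \<in> P \<rightarrow>\<^sub>M borel"
  by (rule borel_measurable) simp

lemma emeasure_on_line: "A \<in> sets borel \<Longrightarrow> emeasure (on_line P) A = emeasure P (A \<inter> {a<..<b})"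
  unfolding on_line_def
  by (subst emeasure_distr[OF id_measurable]) (simp_all add: space_eq)

lemma measure_on_line: "A \<in> sets borel \<Longrightarrow> measure (on_line P) A = measure P (A \<inter> {a<..<b})"
  by (simp add: measure_def emeasure_on_line)

lemma finite_borel_measure_on_line: "finite_borel_measure (on_line P)"
proof (intro finite_borel_measure.intro finite_borel_measure_axioms.intro)
  show "finite_measure (on_line P)"
    unfolding on_line_def by (rule finite_measure_distr[OF id_measurable])
qed (simp add: on_line_def)

lemma integral_on_line:
  fixes f :: "real \<Rightarrow> real"
  assumes "f \<in> borel_measurable borel"
  shows "(LINT x|on_line P. f x) = (LINT x|P. f x)"
  unfolding on_line_def using assms by (subst integral_distr[OF id_measurable]) simp_all

lemma measure_on_line_outside: "measure (on_line P) (- {a<..<b}) = 0"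
  by (subst measure_on_line) (auto intro: borel_open)

text \<open>The passage from pairings with test functions to the mass of intervals, by dominated
  convergence.\<close>

lemma bump_integral_tendsto:
  "(\<lambda>n. LINT x|P. bump c d n x) \<longlonglongrightarrow> measure (on_line P) {c<..<d}"
proof -
  interpret L: finite_borel_measure "on_line P" by (rule finite_borel_measure_on_line)
  have bm: "bump c d n \<in> borel_measurable borel" for n
    by (intro borel_measurable_continuous_onI smooth_continuous bump_smooth)
  have "(\<lambda>n. LINT x|on_line P. bump c d n x) \<longlonglongrightarrow> (LINT x|on_line P. indicator {c<..<d} x)"
  proof (rule integral_dominated_convergence[where w = "\<lambda>x. 1"])
    show "AE x in on_line P. (\<lambda>n. bump c d n x) \<longlonglongrightarrow> indicator {c<..<d} x"
      by (intro AE_I2 bump_tendsto)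
    show "AE x in on_line P. norm (bump c d n x) \<le> 1" for n
      using bump_le_1 bump_nonneg by auto
    show "bump c d n \<in> borel_measurable (on_line P)" for n
      using bm by (simp add: on_line_def)
    show "indicator {c<..<d} \<in> borel_measurable (on_line P)"
      by (simp add: on_line_def)
  qed simp
  then show ?thesis by (simp add: integral_on_line bm L.borel_UNIV)
qed

end

section \<open>Uniqueness of the Jordan pair of a distributional derivative\<close>

locale jordan_pair =
  P: interval_measure a b P + N: interval_measure a b N for a b :: real and P N :: "real measure" +
  assumes singular: "\<exists>A \<in> sets (restrict_space borel {a<..<b}).
        emeasure P ({a<..<b} - A) = 0 \<and> emeasure N A = 0"

lemma distributional_derivative_iff:
  "distributional_derivative a b u (P, N) \<longleftrightarrow> jordan_pair a b P N \<and>
     (\<forall>\<phi>. test_function a b \<phi> \<longrightarrow>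
        (LINT x|lebesgue_on {a<..<b}. u x * deriv \<phi> x) = - ((LINT x|P. \<phi> x) - (LINT x|N. \<phi> x)))"
  by (auto simp: distributional_derivative_def jordan_pair_def jordan_pair_axioms_def
      interval_measure_def interval_measure_axioms_def)

text \<open>This makes the choice in \<open>abs_deriv\<close> harmless. Testing with bumps gives
  \<open>P + N' = P' + N\<close> on Borel sets. The sets \<open>A\<close> and \<open>B\<close> that
  carry the positive parts cut every set into four pieces, on each of which two of the four measures
  vanish: inside both sets the identity reads \<open>P = P'\<close>, outside both
  \<open>N' = N\<close>, and on each mixed piece it says that a sum of two nonnegative numbers is
  0.\<close>

lemma distributional_derivative_unique:
  assumes "distributional_derivative a b u (P, N)" "distributional_derivative a b u (P', N')"
  shows "P = P' \<and> N = N'"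
proof -
  interpret A: jordan_pair a b P N using assms by (simp add: distributional_derivative_iff)
  interpret B: jordan_pair a b P' N' using assms by (simp add: distributional_derivative_iff)
  have eq: "measure (on_line P) A + measure (on_line N') A = measure (on_line P') A + measure (on_line N) A"
    if "A \<in> sets borel" for A
  proof (rule finite_borel_measures_eqI[OF _ _ _ _ _ _ _ _ _ that])
    fix c d assume cd: "a < c" "c < d" "d < b"
    have "(LINT x|P. bump c d n x) + (LINT x|N'. bump c d n x) =
        (LINT x|P'. bump c d n x) + (LINT x|N. bump c d n x)" for n
    proof -
      have "test_function a b (bump c d n)" using cd by (simp add: bump_test_function)
      then have "- ((LINT x|P. bump c d n x) - (LINT x|N. bump c d n x)) =
          - ((LINT x|P'. bump c d n x) - (LINT x|N'. bump c d n x))"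
        using assms unfolding distributional_derivative_iff by metis
      then show ?thesis by linarith
    qed
    moreover have "(\<lambda>n. (LINT x|P. bump c d n x) + (LINT x|N'. bump c d n x)) \<longlonglongrightarrow>
        measure (on_line P) {c<..<d} + measure (on_line N') {c<..<d}"
      by (intro tendsto_add A.P.bump_integral_tendsto B.N.bump_integral_tendsto)
    moreover have "(\<lambda>n. (LINT x|P'. bump c d n x) + (LINT x|N. bump c d n x)) \<longlonglongrightarrow>
        measure (on_line P') {c<..<d} + measure (on_line N) {c<..<d}"
      by (intro tendsto_add B.P.bump_integral_tendsto A.N.bump_integral_tendsto)
    ultimately show "measure (on_line P) {c<..<d} + measure (on_line N') {c<..<d} =
        measure (on_line P') {c<..<d} + measure (on_line N) {c<..<d}"
      using LIMSEQ_unique by auto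
  qed (intro A.P.finite_borel_measure_on_line B.P.finite_borel_measure_on_line
      A.N.finite_borel_measure_on_line B.N.finite_borel_measure_on_line
      A.P.measure_on_line_outside B.P.measure_on_line_outside
      A.N.measure_on_line_outside B.N.measure_on_line_outside)+
  obtain A where A: "A \<in> sets P" "emeasure P ({a<..<b} - A) = 0" "emeasure N A = 0"
    using A.singular A.P.sets_eq by auto
  obtain B where B: "B \<in> sets P" "emeasure P' ({a<..<b} - B) = 0" "emeasure N' B = 0"
    using B.singular A.P.sets_eq by auto
  have s: "sets P' = sets P" "sets N = sets P" "sets N' = sets P"
    using A.P.sets_eq A.N.sets_eq B.P.sets_eq B.N.sets_eq by simp_all
  have eq': "measure P X + measure N' X = measure P' X + measure N X" if "X \<in> sets P" for X
  proof -
    from that obtain Y where Y: "Y \<in> sets borel" "X = Y \<inter> {a<..<b}"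
      by (auto simp: A.P.sets_eq sets_restrict_space)
    with eq[OF Y(1)] show ?thesis
      by (simp add: A.P.measure_on_line A.N.measure_on_line B.P.measure_on_line B.N.measure_on_line)
  qed
  have sub: "A \<subseteq> {a<..<b}" "B \<subseteq> {a<..<b}"
    using A(1) B(1) sets.sets_into_space A.P.space_eq by auto
  have Pn: "measure P X = 0" if "X \<in> sets P" "X \<inter> A = {}" for X
  proof -
    have "emeasure P X \<le> emeasure P ({a<..<b} - A)"
      using that A(1) sets.sets_into_space[OF that(1)] A.P.space_eq sets.top[of P]
      by (intro emeasure_mono) auto
    with A(2) show ?thesis by (simp add: measure_def)
  qed
  have Nn: "measure N X = 0" if "X \<in> sets P" "X \<subseteq> A" for X
    using emeasure_mono[of X A N] that A s by (simp add: measure_def)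
  have Pn': "measure P' X = 0" if "X \<in> sets P" "X \<inter> B = {}" for X
  proof -
    have "emeasure P' X \<le> emeasure P' ({a<..<b} - B)"
      using that B(1) sets.sets_into_space[OF that(1)] A.P.space_eq sets.top[of P]
      by (intro emeasure_mono) (auto simp: s)
    with B(2) show ?thesis by (simp add: measure_def)
  qed
  have Nn': "measure N' X = 0" if "X \<in> sets P" "X \<subseteq> B" for X
    using emeasure_mono[of X B N'] that B s by (simp add: measure_def)
  have both: "measure P X = measure P' X \<and> measure N X = measure N' X" if X: "X \<in> sets P" for X
  proof -
    have parts: "X \<inter> A \<inter> B \<in> sets P" "X \<inter> A - B \<in> sets P" "(X - A) \<inter> B \<in> sets P" "X - A - B \<in> sets P"
      using X A(1) B(1) by auto
    have split: "measure M X = measure M (X \<inter> A \<inter> B) + measure M (X \<inter> A - B) + measure M ((X - A) \<inter> B) + measure M (X - A - B)"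
      if "finite_measure M" "sets M = sets P" for M
    proof -
      interpret finite_measure M by fact
      have "measure M X = measure M (X \<inter> A) + measure M (X - A)"
        using X A(1) that(2) by (subst finite_measure_Union[symmetric]) (auto intro!: arg_cong[of _ _ "measure M"])
      moreover have "measure M (X \<inter> A) = measure M (X \<inter> A \<inter> B) + measure M (X \<inter> A - B)"
        using parts that(2) by (subst finite_measure_Union[symmetric]) (auto intro!: arg_cong[of _ _ "measure M"])
      moreover have "measure M (X - A) = measure M ((X - A) \<inter> B) + measure M (X - A - B)"
        using parts that(2) by (subst finite_measure_Union[symmetric]) (auto intro!: arg_cong[of _ _ "measure M"])
      ultimately show ?thesis by simp
    qed
    have 1: "measure N (X \<inter> A \<inter> B) = 0" "measure N' (X \<inter> A \<inter> B) = 0"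
      using parts by (auto intro: Nn Nn')
    have 2: "measure N (X \<inter> A - B) = 0" "measure P' (X \<inter> A - B) = 0"
      using parts by (auto intro: Nn Pn')
    have 3: "measure N' ((X - A) \<inter> B) = 0" "measure P ((X - A) \<inter> B) = 0"
      using parts by (auto intro!: Nn' Pn)
    have 4: "measure P (X - A - B) = 0" "measure P' (X - A - B) = 0"
      using parts by (auto intro!: Pn Pn')
    have two: "measure P (X \<inter> A - B) = 0" "measure N' (X \<inter> A - B) = 0"
      using eq'[OF parts(2)] 2 measure_nonneg[of P "X \<inter> A - B"] measure_nonneg[of N' "X \<inter> A - B"] by linarith+
    have three: "measure P' ((X - A) \<inter> B) = 0" "measure N ((X - A) \<inter> B) = 0"
      using eq'[OF parts(3)] 3 measure_nonneg[of P' "(X - A) \<inter> B"] measure_nonneg[of N "(X - A) \<inter> B"] by linarith+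
    show ?thesis
      using split[of P] split[of N] split[of P'] split[of N'] s 1 2 3 4 two three eq'[OF parts(1)] eq'[OF parts(4)]
        A.P.finite_measure_axioms A.N.finite_measure_axioms B.P.finite_measure_axioms B.N.finite_measure_axioms
      by simp
  qed
  have "P = P'"
    by (rule measure_eqI) (use s both A.P.emeasure_eq_measure B.P.emeasure_eq_measure in auto)
  moreover have "N = N'"
    by (rule measure_eqI) (use s both A.N.emeasure_eq_measure B.N.emeasure_eq_measure in auto)
  ultimately show ?thesis by simp
qed

lemma abs_deriv_eq:
  assumes "distributional_derivative a b u (P, N)"
  shows "abs_deriv a b u B = emeasure P B + emeasure N B"
proof -
  have "(SOME PN. distributional_derivative a b u PN) = (P, N)"
  proof (rule some_equality)
    fix PN assume "distributional_derivative a b u PN"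
    then show "PN = (P, N)"
      using distributional_derivative_unique[OF assms, of "fst PN" "snd PN"] by (simp add: prod_eq_iff)
  qed (rule assms)
  then show ?thesis by (simp add: abs_deriv_def)
qed

section \<open>The representative given by the derivative measure\<close>

definition pair_cdf :: "real measure \<Rightarrow> real measure \<Rightarrow> real \<Rightarrow> real" where
  "pair_cdf P N x = cdf (on_line P) x - cdf (on_line N) x"

context jordan_pair
begin

lemma pair_cdf_measurable [measurable]: "pair_cdf P N \<in> borel_measurable borel"
proof -
  interpret LP: finite_borel_measure "on_line P" by (rule P.finite_borel_measure_on_line)
  interpret LN: finite_borel_measure "on_line N" by (rule N.finite_borel_measure_on_line)
  have [measurable]: "cdf (on_line P) \<in> borel_measurable borel" "cdf (on_line N) \<in> borel_measurable borel"
    using LP.cdf_nondecreasing LN.cdf_nondecreasing by (auto intro!: borel_measurable_mono monoI)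
  show ?thesis unfolding pair_cdf_def by measurable
qed

lemma pair_cdf_bounded:
  "\<bar>pair_cdf P N x\<bar> \<le> measure (on_line P) UNIV + measure (on_line N) UNIV"
proof -
  interpret LP: finite_borel_measure "on_line P" by (rule P.finite_borel_measure_on_line)
  interpret LN: finite_borel_measure "on_line N" by (rule N.finite_borel_measure_on_line)
  show ?thesis
    using LP.cdf_nonneg[of x] LP.cdf_bounded[of x] LN.cdf_nonneg[of x] LN.cdf_bounded[of x]
    by (auto simp: pair_cdf_def LP.borel_UNIV LN.borel_UNIV)
qed

lemma integral_pair_cdf_times_deriv:
  assumes "test_function a b \<phi>"
  shows "(LINT x|lborel. pair_cdf P N x * deriv \<phi> x) = - ((LINT x|P. \<phi> x) - (LINT x|N. \<phi> x))"
    and "integrable lborel (\<lambda>x. pair_cdf P N x * deriv \<phi> x)"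
proof -
  interpret LP: finite_borel_measure "on_line P" by (rule P.finite_borel_measure_on_line)
  interpret LN: finite_borel_measure "on_line N" by (rule N.finite_borel_measure_on_line)
  have \<phi>: "smooth \<phi>" using assms by (simp add: test_function_def)
  then have bm: "\<phi> \<in> borel_measurable borel"
    by (intro borel_measurable_continuous_onI smooth_continuous)
  obtain c d where cd: "\<And>x. \<not> (c \<le> x \<and> x \<le> d) \<Longrightarrow> \<phi> x = 0"
    using assms by (rule test_functionE) auto
  note I = LP.integral_cdf_times_deriv[OF \<phi> cd] LN.integral_cdf_times_deriv[OF \<phi> cd]
  show "(LINT x|lborel. pair_cdf P N x * deriv \<phi> x) = - ((LINT x|P. \<phi> x) - (LINT x|N. \<phi> x))"
    using I bm by (simp add: pair_cdf_def left_diff_distrib P.integral_on_line N.integral_on_line)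
  show "integrable lborel (\<lambda>x. pair_cdf P N x * deriv \<phi> x)"
    using I by (simp add: pair_cdf_def left_diff_distrib)
qed

text \<open>Converse of the representation of \<open>BV\<close> functions: a singular pair can be
  prescribed as derivative. The constant \<open>k\<close> drops out because
  \<open>deriv \<phi>\<close> has integral 0. The derivatives of step functions are read off from
  here.\<close>

lemma distributional_derivative_pair_cdf:
  assumes "AE x in lebesgue_on {a<..<b}. u x = k + pair_cdf P N x"
    and [measurable]: "u \<in> borel_measurable (lebesgue_on {a<..<b})"
  shows "distributional_derivative a b u (P, N)"
  unfolding distributional_derivative_iff
proof (intro conjI allI impI)
  show "jordan_pair a b P N" by (rule jordan_pair_axioms)
  fix \<phi> assume \<phi>: "test_function a b \<phi>"
  then have sm: "smooth \<phi>" by (simp add: test_function_def)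
  have cont: "continuous_on UNIV (deriv \<phi>)"
    using sm by (intro smooth_continuous smooth_deriv)
  have [measurable]: "deriv \<phi> \<in> borel_measurable borel"
    using cont by (rule borel_measurable_continuous_onI)
  obtain c d where cd: "c \<le> d" "\<And>x. \<not> (c \<le> x \<and> x \<le> d) \<Longrightarrow> \<phi> x = 0"
  proof -
    have "\<exists>c d. c \<le> d \<and> (\<forall>x. \<not> (c \<le> x \<and> x \<le> d) \<longrightarrow> \<phi> x = 0)"
      using \<phi> by (rule test_functionE) (auto intro: less_imp_le)
    then show thesis using that by blast
  qed
  have d0: "deriv \<phi> x = 0" if "\<not> (c \<le> x \<and> x \<le> d)" for x
    by (rule deriv_eq_0_outside[OF cd(2) that])
  have dint: "integrable lborel (deriv \<phi>)"
    using compactly_supported_integrable[OF cont d0] .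
  have "(LINT x|lborel. deriv \<phi> x) = (LINT x|lborel. deriv \<phi> x * indicator {c - 1..d + 1} x)"
    by (rule Bochner_Integration.integral_cong) (auto simp: indicator_def intro!: d0)
  also have "\<dots> = \<phi> (d + 1) - \<phi> (c - 1)"
    using cont cd(1) by (intro integral_FTC_Icc_real smooth_has_derivative sm)
      (auto simp: continuous_on_eq_continuous_at)
  finally have zero: "(LINT x|lborel. deriv \<phi> x) = 0" using cd(2) by simp
  have "(LINT x|lebesgue_on {a<..<b}. u x * deriv \<phi> x)
      = (LINT x|lebesgue_on {a<..<b}. (k + pair_cdf P N x) * deriv \<phi> x)"
  proof (rule integral_cong_AE)
    have bm: "(\<lambda>x. (k + pair_cdf P N x) * deriv \<phi> x) \<in> borel_measurable borel"
      by measurable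
    then show "(\<lambda>x. (k + pair_cdf P N x) * deriv \<phi> x) \<in> borel_measurable (lebesgue_on {a<..<b})"
      by (intro measurable_restrict_space1 measurable_completion) simp
    have "deriv \<phi> \<in> borel_measurable (lebesgue_on {a<..<b})"
      by (intro measurable_restrict_space1 measurable_completion) simp
    then show "(\<lambda>x. u x * deriv \<phi> x) \<in> borel_measurable (lebesgue_on {a<..<b})"
      by (intro borel_measurable_times assms(2))
    show "AE x in lebesgue_on {a<..<b}. u x * deriv \<phi> x = (k + pair_cdf P N x) * deriv \<phi> x"
      using assms(1) by eventually_elim simp
  qed
  also have "\<dots> = (LINT x|lborel. indicator {a<..<b} x * ((k + pair_cdf P N x) * deriv \<phi> x))"
    by (rule integral_lebesgue_on_borel) auto
  also have "\<dots> = (LINT x|lborel. k * deriv \<phi> x + pair_cdf P N x * deriv \<phi> x)"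
  proof (rule Bochner_Integration.integral_cong[OF refl])
    fix x show "indicator {a<..<b} x * ((k + pair_cdf P N x) * deriv \<phi> x) =
        k * deriv \<phi> x + pair_cdf P N x * deriv \<phi> x"
      using test_function_deriv_outside[OF \<phi>, of x]
      by (cases "x \<in> {a<..<b}") (auto simp: algebra_simps)
  qed
  also have "\<dots> = - ((LINT x|P. \<phi> x) - (LINT x|N. \<phi> x))"
    using integral_pair_cdf_times_deriv[OF \<phi>] dint zero by simp
  finally show "(LINT x|lebesgue_on {a<..<b}. u x * deriv \<phi> x) = - ((LINT x|P. \<phi> x) - (LINT x|N. \<phi> x))" .
qed

end

text \<open>\<open>u\<close> and \<open>pair_cdf P N\<close> have the same derivative, so their
  difference is orthogonal to every \<open>deriv \<phi>\<close> and therefore constant. The function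
  \<open>f\<close> is a Borel substitute for \<open>u\<close>, which is only Lebesgue
  measurable.\<close>

lemma BV_representation:
  assumes "a < b" and u: "integrable (lebesgue_on {a<..<b}) u"
    and dd: "distributional_derivative a b u (P, N)"
  shows "\<exists>k. AE x in lebesgue_on {a<..<b}. u x = k + pair_cdf P N x"
proof -
  interpret jordan_pair a b P N using dd by (simp add: distributional_derivative_iff)
  have S: "{a<..<b} \<in> sets lebesgue" "{a<..<b} \<inter> space lebesgue \<in> sets lebesgue" by auto
  define v where "v x = indicator {a<..<b} x * u x" for x
  have v: "integrable lebesgue v"
    using u S by (simp add: integrable_restrict_space v_def[abs_def])
  then obtain f where f: "f \<in> borel_measurable lborel" "AE x in lborel. v x = f x"
    using completion_ex_borel_measurable_real[of v lborel] by auto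
  have fbm [measurable]: "f \<in> borel_measurable borel" using f(1) by simp
  have fL: "AE x in lebesgue. v x = f x" using f(2) by (rule AE_completion)
  have fint: "integrable lborel f"
  proof -
    have "integrable lebesgue f"
      using v fL f(1) by (subst integrable_cong_AE[where g = v]) (auto intro: measurable_completion)
    then show ?thesis using f(1) by (simp add: integrable_completion)
  qed
  define h where "h x = indicator {a<..<b} x * (f x - pair_cdf P N x)" for x
  have [measurable]: "h \<in> borel_measurable borel" unfolding h_def[abs_def] by measurable
  have "integrable lborel (\<lambda>x. indicator {a<..<b} x * pair_cdf P N x)"
  proof (rule Bochner_Integration.integrable_bound)
    show "integrable lborel (\<lambda>x. indicator {a<..<b} x * (measure (on_line P) UNIV + measure (on_line N) UNIV))"
      using \<open>a < b\<close> by (intro integrable_mult_left integrable_real_indicator) auto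
    show "AE x in lborel. norm (indicator {a<..<b} x * pair_cdf P N x) \<le>
        norm (indicator {a<..<b} x * (measure (on_line P) UNIV + measure (on_line N) UNIV))"
      using pair_cdf_bounded by (auto simp: abs_mult indicator_def intro: order_trans)
  qed measurable
  moreover have "integrable lborel (\<lambda>x. indicator {a<..<b} x * f x)"
    using fint integrable_mult_indicator[of "{a<..<b}" lborel f] by simp
  ultimately have hint: "integrable lborel h"
    unfolding h_def[abs_def] right_diff_distrib by (rule Bochner_Integration.integrable_diff[rotated])
  have test: "(LINT x|lborel. h x * deriv \<phi> x) = 0" if \<phi>: "test_function a b \<phi>" for \<phi>
  proof -
    have "smooth \<phi>" using \<phi> by (simp add: test_function_def)
    then have cont: "continuous_on UNIV (deriv \<phi>)"
      by (intro smooth_continuous smooth_deriv)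
    then have [measurable]: "deriv \<phi> \<in> borel_measurable borel"
      by (rule borel_measurable_continuous_onI)
    have out: "deriv \<phi> x = 0" if "x \<notin> {a<..<b}" for x
      using test_function_deriv_outside[OF \<phi> that] .
    have "bounded (deriv \<phi> ` {a..b})"
      using cont by (intro compact_imp_bounded compact_continuous_image) (auto intro: continuous_on_subset)
    then obtain B where B: "\<And>x. x \<in> {a..b} \<Longrightarrow> \<bar>deriv \<phi> x\<bar> \<le> B"
      unfolding bounded_iff by force
    have B': "\<bar>deriv \<phi> x\<bar> \<le> \<bar>B\<bar>" for x
      using B[of x] out[of x] by (cases "x \<in> {a<..<b}") auto
    have fd: "integrable lborel (\<lambda>x. f x * deriv \<phi> x)"
    proof (rule Bochner_Integration.integrable_bound)
      show "integrable lborel (\<lambda>x. f x * B)" using fint by simp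
      show "AE x in lborel. norm (f x * deriv \<phi> x) \<le> norm (f x * B)"
        using B' by (auto simp: abs_mult intro!: mult_left_mono)
    qed measurable
    have "(LINT x|lebesgue_on {a<..<b}. u x * deriv \<phi> x) = (LINT x|lebesgue. v x * deriv \<phi> x)"
      using S by (simp add: integral_restrict_space v_def mult.assoc)
    also have "\<dots> = (LINT x|lebesgue. f x * deriv \<phi> x)"
    proof (rule integral_cong_AE)
      have d: "deriv \<phi> \<in> borel_measurable lebesgue" by (rule measurable_completion) simp
      have "v \<in> borel_measurable lebesgue" using v by auto
      then show "(\<lambda>x. v x * deriv \<phi> x) \<in> borel_measurable lebesgue" using d by simp
      have "f \<in> borel_measurable lebesgue" by (rule measurable_completion) simp
      then show "(\<lambda>x. f x * deriv \<phi> x) \<in> borel_measurable lebesgue" using d by simp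
      show "AE x in lebesgue. v x * deriv \<phi> x = f x * deriv \<phi> x"
        using fL by eventually_elim simp
    qed
    also have "\<dots> = (LINT x|lborel. f x * deriv \<phi> x)"
      by (rule integral_completion) measurable
    finally have "(LINT x|lborel. f x * deriv \<phi> x) = (LINT x|lborel. pair_cdf P N x * deriv \<phi> x)"
      using dd \<phi> integral_pair_cdf_times_deriv[OF \<phi>] by (simp add: distributional_derivative_iff)
    then have "(LINT x|lborel. f x * deriv \<phi> x - pair_cdf P N x * deriv \<phi> x) = 0"
      using fd integral_pair_cdf_times_deriv[OF \<phi>] by simp
    also have "(LINT x|lborel. f x * deriv \<phi> x - pair_cdf P N x * deriv \<phi> x) = (LINT x|lborel. h x * deriv \<phi> x)"
    proof (rule Bochner_Integration.integral_cong[OF refl])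
      fix x show "f x * deriv \<phi> x - pair_cdf P N x * deriv \<phi> x = h x * deriv \<phi> x"
        using out[of x] by (cases "x \<in> {a<..<b}") (auto simp: h_def algebra_simps)
    qed
    finally show ?thesis .
  qed
  from du_Bois_Reymond[OF \<open>a < b\<close> hint _ test] obtain k
    where k: "AE x in lborel. x \<in> {a<..<b} \<longrightarrow> h x = k"
    by (auto simp: h_def)
  have "AE x in lebesgue. x \<in> {a<..<b} \<longrightarrow> u x = k + pair_cdf P N x"
    using AE_completion[OF k] fL by eventually_elim (auto simp: h_def v_def)
  then have "AE x in lebesgue_on {a<..<b}. u x = k + pair_cdf P N x"
    using S by (subst AE_restrict_space_iff) auto
  then show ?thesis ..
qed

section \<open>One-sided limits and the jump set\<close>

lemma AE_not_in_interval:
  fixes c d :: real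
  assumes "AE y in lebesgue_on {a<..<b}. y \<notin> {c<..<d}" "a \<le> c" "c < d" "d \<le> b"
  shows False
proof -
  have "AE y in lebesgue. y \<in> {a<..<b} \<longrightarrow> y \<notin> {c<..<d}"
    using assms(1) by (subst (asm) AE_restrict_space_iff) auto
  then have "AE y in lebesgue. y \<notin> {c<..<d}"
    by eventually_elim (use assms in auto)
  then have "{c<..<d} \<in> null_sets lebesgue"
    by (subst AE_iff_null_sets) auto
  then have "emeasure lebesgue {c<..<d} = 0"
    by (rule null_setsD1)
  with assms(3) show False by simp
qed

text \<open>One-sided limits are taken along some representative. The complement of a null set meets
  every one-sided neighbourhood, so two representatives agree frequently there, which is enough to
  make their limits equal.\<close>

lemma AE_frequently_at_left:
  fixes x :: real
  assumes "AE y in lebesgue_on {a<..<b}. Q y" "a < x" "x \<le> b"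
  shows "\<exists>\<^sub>F y in at_left x. Q y"
proof (rule ccontr)
  assume "\<not> (\<exists>\<^sub>F y in at_left x. Q y)"
  then obtain c where c: "c < x" "\<And>y. c < y \<Longrightarrow> y < x \<Longrightarrow> \<not> Q y"
    by (auto simp: not_frequently eventually_at_left_field)
  have "AE y in lebesgue_on {a<..<b}. y \<notin> {max a c<..<x}"
    using assms(1) by eventually_elim (use c in auto)
  then show False
    by (rule AE_not_in_interval) (use assms c in auto)
qed

lemma AE_frequently_at_right:
  fixes x :: real
  assumes "AE y in lebesgue_on {a<..<b}. Q y" "a \<le> x" "x < b"
  shows "\<exists>\<^sub>F y in at_right x. Q y"
proof (rule ccontr)
  assume "\<not> (\<exists>\<^sub>F y in at_right x. Q y)"
  then obtain c where c: "x < c" "\<And>y. x < y \<Longrightarrow> y < c \<Longrightarrow> \<not> Q y"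
    by (auto simp: not_frequently eventually_at_right_field)
  have "AE y in lebesgue_on {a<..<b}. y \<notin> {x<..<min b c}"
    using assms(1) by eventually_elim (use c in auto)
  then show False
    by (rule AE_not_in_interval) (use assms c in auto)
qed

lemma tendsto_unique_frequently:
  fixes f h :: "real \<Rightarrow> real"
  assumes "(f \<longlongrightarrow> l) F" "(h \<longlongrightarrow> m) F" "\<exists>\<^sub>F y in F. f y = h y"
  shows "l = m"
proof (rule ccontr)
  assume "l \<noteq> m"
  have "((\<lambda>y. f y - h y) \<longlongrightarrow> l - m) F"
    by (intro tendsto_diff assms)
  then have "\<forall>\<^sub>F y in F. f y - h y \<noteq> 0"
    using \<open>l \<noteq> m\<close> by (intro tendsto_imp_eventually_ne) auto
  then have "\<not> (\<exists>\<^sub>F y in F. f y = h y)"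
    by (auto simp: frequently_def)
  with assms(3) show False by contradiction
qed

lemma has_left_limit_unique:
  assumes "a < x" "x \<le> b" "has_left_limit a b u x l" "has_left_limit a b u x m"
  shows "l = m"
proof -
  obtain v w where v: "AE y in lebesgue_on {a<..<b}. v y = u y" "(v \<longlongrightarrow> l) (at_left x)"
    and w: "AE y in lebesgue_on {a<..<b}. w y = u y" "(w \<longlongrightarrow> m) (at_left x)"
    using assms unfolding has_left_limit_def by blast
  have "AE y in lebesgue_on {a<..<b}. v y = w y"
    using v(1) w(1) by eventually_elim simp
  then show ?thesis
    by (rule tendsto_unique_frequently[OF v(2) w(2) AE_frequently_at_left]) (use assms in auto)
qed

lemma has_right_limit_unique:
  assumes "a \<le> x" "x < b" "has_right_limit a b u x l" "has_right_limit a b u x m"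
  shows "l = m"
proof -
  obtain v w where v: "AE y in lebesgue_on {a<..<b}. v y = u y" "(v \<longlongrightarrow> l) (at_right x)"
    and w: "AE y in lebesgue_on {a<..<b}. w y = u y" "(w \<longlongrightarrow> m) (at_right x)"
    using assms unfolding has_right_limit_def by blast
  have "AE y in lebesgue_on {a<..<b}. v y = w y"
    using v(1) w(1) by eventually_elim simp
  then show ?thesis
    by (rule tendsto_unique_frequently[OF v(2) w(2) AE_frequently_at_right]) (use assms in auto)
qed

section \<open>Independence of the representative\<close>

context
  fixes a b :: real and u v :: "real \<Rightarrow> real"
  assumes eq: "AE x in lebesgue_on {a<..<b}. u x = v x"
begin

lemma has_left_limit_cong: "has_left_limit a b u = has_left_limit a b v"
proof -
  have "(AE y in lebesgue_on {a<..<b}. w y = u y) \<longleftrightarrow> (AE y in lebesgue_on {a<..<b}. w y = v y)" for w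
    by (rule eventually_subst, rule eventually_mono[OF eq]) simp
  then show ?thesis by (simp add: has_left_limit_def fun_eq_iff)
qed

lemma has_right_limit_cong: "has_right_limit a b u = has_right_limit a b v"
proof -
  have "(AE y in lebesgue_on {a<..<b}. w y = u y) \<longleftrightarrow> (AE y in lebesgue_on {a<..<b}. w y = v y)" for w
    by (rule eventually_subst, rule eventually_mono[OF eq]) simp
  then show ?thesis by (simp add: has_right_limit_def fun_eq_iff)
qed

lemma jump_set_cong: "jump_set a b u = jump_set a b v"
  by (simp add: jump_set_def has_left_limit_cong has_right_limit_cong)

lemma distributional_derivative_cong:
  assumes "u \<in> borel_measurable (lebesgue_on {a<..<b})" "v \<in> borel_measurable (lebesgue_on {a<..<b})"
  shows "distributional_derivative a b u = distributional_derivative a b v"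
proof -
  have "(LINT x|lebesgue_on {a<..<b}. u x * deriv \<phi> x) = (LINT x|lebesgue_on {a<..<b}. v x * deriv \<phi> x)"
    if "test_function a b \<phi>" for \<phi>
  proof (rule integral_cong_AE)
    have "continuous_on UNIV (deriv \<phi>)"
      using that unfolding test_function_def by (intro smooth_continuous smooth_deriv) simp
    then have "deriv \<phi> \<in> borel_measurable borel"
      by (rule borel_measurable_continuous_onI)
    then have "deriv \<phi> \<in> borel_measurable (lebesgue_on {a<..<b})"
      by (intro measurable_restrict_space1 measurable_completion) simp
    with assms show "(\<lambda>x. u x * deriv \<phi> x) \<in> borel_measurable (lebesgue_on {a<..<b})"
      "(\<lambda>x. v x * deriv \<phi> x) \<in> borel_measurable (lebesgue_on {a<..<b})"
      by (auto intro: borel_measurable_times)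
    show "AE x in lebesgue_on {a<..<b}. u x * deriv \<phi> x = v x * deriv \<phi> x"
      using eq by eventually_elim simp
  qed
  then have "distributional_derivative a b u (P, N) = distributional_derivative a b v (P, N)" for P N
    unfolding distributional_derivative_iff by (metis (no_types))
  then show ?thesis by (simp add: fun_eq_iff split_paired_all)
qed

lemma TVg_cong:
  assumes "u \<in> borel_measurable (lebesgue_on {a<..<b})" "v \<in> borel_measurable (lebesgue_on {a<..<b})"
  shows "TVg a b lam K g u = TVg a b lam K g v"
proof -
  have "abs_deriv a b u = abs_deriv a b v"
    by (simp add: abs_deriv_def fun_eq_iff distributional_derivative_cong[OF assms])
  then have "TV a b K u = TV a b K v"
    by (simp add: TV_def jump_set_cong left_limit_def right_limit_def has_left_limit_cong has_right_limit_cong)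
  moreover have "(\<integral>\<^sup>+x. ennreal (\<bar>u x - g x\<bar>\<^sup>2) \<partial>lebesgue_on {a<..<b}) =
      (\<integral>\<^sup>+x. ennreal (\<bar>v x - g x\<bar>\<^sup>2) \<partial>lebesgue_on {a<..<b})"
    by (rule nn_integral_cong_AE, rule eventually_mono[OF eq]) simp
  ultimately show ?thesis by (simp add: TVg_def)
qed

end

lemma (in finite_borel_measure) measure_atMost_split: "measure M {..x} = measure M {..<x} + measure M {x}"
proof -
  have "measure M ({..<x} \<union> {x}) = measure M {..<x} + measure M {x}"
    by (rule finite_measure_Union) auto
  also have "{..<x} \<union> {x} = {..x}" by auto
  finally show ?thesis .
qed

text \<open>\<open>Du {x}\<close>, the signed jump at \<open>x\<close>: distribution functions are
  right-continuous, and their left limits miss exactly the mass of the point.\<close>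

definition atom :: "real measure \<Rightarrow> real measure \<Rightarrow> real \<Rightarrow> real" where
  "atom P N x = measure P {x} - measure N {x}"

lemma (in jordan_pair) has_limits:
  assumes "AE x in lebesgue_on {a<..<b}. u x = k + pair_cdf P N x" "x \<in> {a<..<b}"
  shows "has_right_limit a b u x (k + pair_cdf P N x)"
    and "has_left_limit a b u x (k + pair_cdf P N x - atom P N x)"
proof -
  interpret LP: finite_borel_measure "on_line P" by (rule P.finite_borel_measure_on_line)
  interpret LN: finite_borel_measure "on_line N" by (rule N.finite_borel_measure_on_line)
  have ae: "AE x in lebesgue_on {a<..<b}. k + pair_cdf P N x = u x"
    using assms(1) by eventually_elim simp
  have "((\<lambda>x. k + pair_cdf P N x) \<longlongrightarrow> k + pair_cdf P N x) (at_right x)"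
    using LP.cdf_is_right_cont[of x] LN.cdf_is_right_cont[of x]
    unfolding pair_cdf_def continuous_within by (intro tendsto_add tendsto_const tendsto_diff)
  with ae show "has_right_limit a b u x (k + pair_cdf P N x)"
    unfolding has_right_limit_def by (intro exI conjI)
  have at: "atom P N x = measure (on_line P) {x} - measure (on_line N) {x}"
    using assms(2) by (simp add: atom_def P.measure_on_line N.measure_on_line)
  have "((\<lambda>x. k + pair_cdf P N x) \<longlongrightarrow> k + (measure (on_line P) {..<x} - measure (on_line N) {..<x})) (at_left x)"
    unfolding pair_cdf_def by (intro tendsto_add tendsto_const tendsto_diff LP.cdf_at_left LN.cdf_at_left)
  also have "k + (measure (on_line P) {..<x} - measure (on_line N) {..<x}) = k + pair_cdf P N x - atom P N x"
    using LP.measure_atMost_split[of x] LN.measure_atMost_split[of x]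
    by (simp add: at pair_cdf_def cdf_def)
  finally show "has_left_limit a b u x (k + pair_cdf P N x - atom P N x)"
    unfolding has_left_limit_def using ae by (intro exI conjI)
qed

lemma (in jordan_pair)
  assumes "AE x in lebesgue_on {a<..<b}. u x = k + pair_cdf P N x"
  shows jump_set_eq: "jump_set a b u = {x \<in> {a<..<b}. atom P N x \<noteq> 0}"
    and jump_eq: "x \<in> {a<..<b} \<Longrightarrow> right_limit a b u x - left_limit a b u x = atom P N x"
proof -
  note lim = has_limits[OF assms]
  show "jump_set a b u = {x \<in> {a<..<b}. atom P N x \<noteq> 0}"
  proof (intro equalityI subsetI)
    fix x assume "x \<in> jump_set a b u"
    then obtain l r where lr: "x \<in> {a<..<b}" "has_left_limit a b u x l" "has_right_limit a b u x r" "l \<noteq> r"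
      by (auto simp: jump_set_def)
    have "l = k + pair_cdf P N x - atom P N x"
      using lr(1) by (intro has_left_limit_unique[OF _ _ lr(2) lim(2)[OF lr(1)]]) auto
    moreover have "r = k + pair_cdf P N x"
      using lr(1) by (intro has_right_limit_unique[OF _ _ lr(3) lim(1)[OF lr(1)]]) auto
    ultimately show "x \<in> {x \<in> {a<..<b}. atom P N x \<noteq> 0}"
      using lr by auto
  next
    fix x assume x: "x \<in> {x \<in> {a<..<b}. atom P N x \<noteq> 0}"
    then have "k + pair_cdf P N x - atom P N x \<noteq> k + pair_cdf P N x" by simp
    moreover have "x \<in> {a<..<b}" using x by simp
    ultimately show "x \<in> jump_set a b u"
      unfolding jump_set_def
      by (intro CollectI conjI exI[of _ "k + pair_cdf P N x - atom P N x"] exI[of _ "k + pair_cdf P N x"] lim)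
  qed
  assume x: "x \<in> {a<..<b}"
  have "right_limit a b u x = k + pair_cdf P N x"
    unfolding right_limit_def
  proof (rule the_equality)
    show "has_right_limit a b u x (k + pair_cdf P N x)" using lim(1)[OF x] .
    fix r assume "has_right_limit a b u x r"
    then show "r = k + pair_cdf P N x"
      using x by (intro has_right_limit_unique[OF _ _ _ lim(1)[OF x]]) auto
  qed
  moreover have "left_limit a b u x = k + pair_cdf P N x - atom P N x"
    unfolding left_limit_def
  proof (rule the_equality)
    show "has_left_limit a b u x (k + pair_cdf P N x - atom P N x)" using lim(2)[OF x] .
    fix r assume "has_left_limit a b u x r"
    then show "r = k + pair_cdf P N x - atom P N x"
      using x by (intro has_left_limit_unique[OF _ _ _ lim(2)[OF x]]) auto
  qed
  ultimately show "right_limit a b u x - left_limit a b u x = atom P N x" by simp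
qed

lemma (in jordan_pair) TV_eq:
  assumes "AE x in lebesgue_on {a<..<b}. u x = k + pair_cdf P N x"
    and "u \<in> borel_measurable (lebesgue_on {a<..<b})"
  defines "D \<equiv> {x \<in> {a<..<b}. atom P N x \<noteq> 0}"
  shows "TV a b K u = emeasure P ({a<..<b} - D) + emeasure N ({a<..<b} - D) +
    (\<Sum>\<^sub>\<infinity>x\<in>D. ennreal (K \<bar>atom P N x\<bar>))"
proof -
  have "(\<Sum>\<^sub>\<infinity>x\<in>D. ennreal (K \<bar>right_limit a b u x - left_limit a b u x\<bar>)) =
      (\<Sum>\<^sub>\<infinity>x\<in>D. ennreal (K \<bar>atom P N x\<bar>))"
    using jump_eq[OF assms(1)] by (intro infsum_cong) (auto simp: D_def)
  then show ?thesis
    unfolding TV_def jump_set_eq[OF assms(1)]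
      abs_deriv_eq[OF distributional_derivative_pair_cdf[OF assms(1,2)]] D_def[symmetric]
    by simp
qed

section \<open>Step functions\<close>

text \<open>Right-continuous, with starting value \<open>c\<close> and height \<open>J s\<close> at
  position \<open>s\<close>. Zero heights are allowed, so that positions can stay fixed while
  heights change.\<close>

definition stp :: "real \<Rightarrow> real set \<Rightarrow> (real \<Rightarrow> real) \<Rightarrow> real \<Rightarrow> real" where
  "stp c S J x = c + (\<Sum>s\<in>S. if s \<le> x then J s else 0)"

text \<open>With the positive and the negative part of \<open>J\<close> as weights, two such
  measures form the Jordan pair of a step function.\<close>

definition atomic_measure :: "real \<Rightarrow> real \<Rightarrow> real set \<Rightarrow> (real \<Rightarrow> real) \<Rightarrow> real measure" where
  "atomic_measure a b S w =
     distr (point_measure S (\<lambda>s. ennreal (w s))) (restrict_space borel {a<..<b}) (\<lambda>x. x)"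

lemma emeasure_atomic_measure:
  assumes "finite S" "S \<subseteq> {a<..<b}" "A \<in> sets (restrict_space borel {a<..<b})"
  shows "emeasure (atomic_measure a b S w) A = (\<Sum>s\<in>S \<inter> A. ennreal (w s))"
proof -
  have "(\<lambda>x. x) \<in> point_measure S (\<lambda>s. ennreal (w s)) \<rightarrow>\<^sub>M restrict_space borel {a<..<b}"
    using assms(2) by (auto simp: measurable_point_measure_eq1 space_restrict_space)
  then have "emeasure (atomic_measure a b S w) A = emeasure (point_measure S (\<lambda>s. ennreal (w s))) (A \<inter> S)"
    unfolding atomic_measure_def using assms(3) by (subst emeasure_distr) (auto simp: space_point_measure)
  also have "\<dots> = (\<Sum>s\<in>S \<inter> A. ennreal (w s))"
    using assms(1) by (subst emeasure_point_measure_finite) (auto simp: Int_commute)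
  finally show ?thesis .
qed

lemma emeasure_atomic_measure_eq_0:
  assumes "finite S" "S \<subseteq> {a<..<b}" "A \<in> sets (restrict_space borel {a<..<b})"
    and "\<And>s. s \<in> S \<Longrightarrow> s \<in> A \<Longrightarrow> w s = 0"
  shows "emeasure (atomic_measure a b S w) A = 0"
  unfolding emeasure_atomic_measure[OF assms(1-3)]
  by (rule sum.neutral) (simp add: assms(4))

lemma measure_atomic_measure:
  assumes "finite S" "S \<subseteq> {a<..<b}" "A \<in> sets (restrict_space borel {a<..<b})" "\<And>s. w s \<ge> 0"
  shows "measure (atomic_measure a b S w) A = (\<Sum>s\<in>S \<inter> A. w s)"
  using assms by (simp add: measure_def emeasure_atomic_measure sum_ennreal sum_nonneg)

lemma interval_measure_atomic:
  assumes "finite S" "S \<subseteq> {a<..<b}"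
  shows "interval_measure a b (atomic_measure a b S w)"
proof (intro interval_measure.intro interval_measure_axioms.intro finite_measureI)
  have sp: "space (atomic_measure a b S w) = {a<..<b}"
    by (simp add: atomic_measure_def space_restrict_space)
  have "{a<..<b} \<in> sets (restrict_space borel {a<..<b})"
    by (auto simp: sets_restrict_space)
  then show "emeasure (atomic_measure a b S w) (space (atomic_measure a b S w)) \<noteq> \<infinity>"
    unfolding sp using assms by (subst emeasure_atomic_measure) auto
qed (simp add: atomic_measure_def)

lemma borel_Int_sets: "A \<in> sets borel \<Longrightarrow> A \<inter> {a<..<b} \<in> sets (restrict_space borel {a<..<b::real})"
  by (auto simp: sets_restrict_space)

lemma stp_measurable [measurable]: "stp c S J \<in> borel_measurable borel"
proof -
  have "(\<lambda>x. if s \<le> x then J s else 0) \<in> borel_measurable borel" for s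
    by measurable
  then show ?thesis unfolding stp_def[abs_def] by (intro borel_measurable_add borel_measurable_sum) auto
qed

lemma stp_bounded: "\<bar>stp c S J x\<bar> \<le> \<bar>c\<bar> + (\<Sum>s\<in>S. \<bar>J s\<bar>)"
proof -
  have "\<bar>\<Sum>s\<in>S. if s \<le> x then J s else 0\<bar> \<le> (\<Sum>s\<in>S. \<bar>J s\<bar>)"
    by (rule order_trans[OF sum_abs sum_mono]) auto
  then show ?thesis unfolding stp_def by linarith
qed

context
  fixes a b :: real and S :: "real set" and J :: "real \<Rightarrow> real"
  assumes ab: "a < b" and S: "finite S" "S \<subseteq> {a<..<b}"
begin

lemma jordan_pair_atomic:
  "jordan_pair a b (atomic_measure a b S (\<lambda>s. max 0 (J s))) (atomic_measure a b S (\<lambda>s. max 0 (- J s)))"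
proof (intro jordan_pair.intro jordan_pair_axioms.intro interval_measure_atomic S bexI conjI)
  let ?A = "{s\<in>S. J s > 0} \<inter> {a<..<b}"
  show A: "?A \<in> sets (restrict_space borel {a<..<b})"
    using S(1) by (intro borel_Int_sets) (auto intro!: borel_closed finite_imp_closed)
  show "emeasure (atomic_measure a b S (\<lambda>s. max 0 (- J s))) ?A = 0"
    using S A by (intro emeasure_atomic_measure_eq_0) auto
  have "{a<..<b} - ?A = (- {s\<in>S. J s > 0}) \<inter> {a<..<b}" by auto
  also have "\<dots> \<in> sets (restrict_space borel {a<..<b})"
    using S(1) by (intro borel_Int_sets) (auto intro!: borel_open open_Compl finite_imp_closed)
  finally show "emeasure (atomic_measure a b S (\<lambda>s. max 0 (J s))) ({a<..<b} - ?A) = 0"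
    using S by (intro emeasure_atomic_measure_eq_0) auto
qed

lemma stp_eq_pair_cdf:
  "stp c S J x = c + pair_cdf (atomic_measure a b S (\<lambda>s. max 0 (J s))) (atomic_measure a b S (\<lambda>s. max 0 (- J s))) x"
proof -
  interpret jordan_pair a b "atomic_measure a b S (\<lambda>s. max 0 (J s))" "atomic_measure a b S (\<lambda>s. max 0 (- J s))"
    by (rule jordan_pair_atomic)
  have cdf: "cdf (on_line (atomic_measure a b S w)) x = (\<Sum>s\<in>S. if s \<le> x then w s else 0)"
    if w: "\<And>s. w s \<ge> 0" for w
  proof -
    interpret W: interval_measure a b "atomic_measure a b S w" by (rule interval_measure_atomic[OF S])
    have "cdf (on_line (atomic_measure a b S w)) x = (\<Sum>s\<in>S \<inter> ({..x} \<inter> {a<..<b}). w s)"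
      unfolding cdf_def using S w
      by (simp add: W.measure_on_line measure_atomic_measure borel_Int_sets)
    also have "\<dots> = (\<Sum>s\<in>S. if s \<le> x then w s else 0)"
      using S by (intro sum.mono_neutral_cong_left) auto
    finally show ?thesis .
  qed
  show ?thesis
    unfolding pair_cdf_def stp_def
    by (subst (1 2) cdf) (auto simp: sum_subtractf[symmetric] intro!: sum.cong)
qed

lemma atom_atomic:
  "x \<in> {a<..<b} \<Longrightarrow> atom (atomic_measure a b S (\<lambda>s. max 0 (J s))) (atomic_measure a b S (\<lambda>s. max 0 (- J s))) x
    = (if x \<in> S then J x else 0)"
proof -
  assume x: "x \<in> {a<..<b}"
  then have "{x} \<in> sets (restrict_space borel {a<..<b})"
    using borel_Int_sets[of "{x}" a b] by simp
  with S show ?thesis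
    by (auto simp: atom_def measure_atomic_measure)
qed

lemma stp_measurable_lebesgue_on: "stp c S J \<in> borel_measurable (lebesgue_on {a<..<b})"
  by (intro measurable_restrict_space1 measurable_completion) simp

lemma stp_BV: "stp c S J \<in> BV a b"
proof -
  interpret jordan_pair a b "atomic_measure a b S (\<lambda>s. max 0 (J s))" "atomic_measure a b S (\<lambda>s. max 0 (- J s))"
    by (rule jordan_pair_atomic)
  have "distributional_derivative a b (stp c S J)
      (atomic_measure a b S (\<lambda>s. max 0 (J s)), atomic_measure a b S (\<lambda>s. max 0 (- J s)))"
    by (rule distributional_derivative_pair_cdf[where k = c, OF _ stp_measurable_lebesgue_on]) (simp add: stp_eq_pair_cdf)
  moreover have "integrable (lebesgue_on {a<..<b}) (stp c S J)"
  proof (rule Bochner_Integration.integrable_bound)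
    show "integrable (lebesgue_on {a<..<b}) (\<lambda>x. \<bar>c\<bar> + (\<Sum>s\<in>S. \<bar>J s\<bar>))"
      using ab by (intro finite_measure.integrable_const finite_measure_lebesgue_on) auto
    have "0 \<le> \<bar>c\<bar> + (\<Sum>s\<in>S. \<bar>J s\<bar>)" by (intro add_nonneg_nonneg sum_nonneg) auto
    then show "AE x in lebesgue_on {a<..<b}. norm (stp c S J x) \<le> norm (\<bar>c\<bar> + (\<Sum>s\<in>S. \<bar>J s\<bar>))"
      using stp_bounded[of c S J] by simp
  qed (rule stp_measurable_lebesgue_on)
  ultimately show ?thesis by (auto simp: BV_def)
qed

lemma jump_set_stp: "jump_set a b (stp c S J) = {s\<in>S. J s \<noteq> 0}"
proof -
  interpret jordan_pair a b "atomic_measure a b S (\<lambda>s. max 0 (J s))" "atomic_measure a b S (\<lambda>s. max 0 (- J s))"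
    by (rule jordan_pair_atomic)
  have "jump_set a b (stp c S J) = {x \<in> {a<..<b}. atom (atomic_measure a b S (\<lambda>s. max 0 (J s)))
      (atomic_measure a b S (\<lambda>s. max 0 (- J s))) x \<noteq> 0}"
    by (rule jump_set_eq[where k = c]) (simp add: stp_eq_pair_cdf)
  also have "\<dots> = {s\<in>S. J s \<noteq> 0}"
    using S by (auto simp: atom_atomic split: if_splits)
  finally show ?thesis .
qed

lemma TV_stp:
  assumes "K 0 = 0" "\<And>\<rho>. \<rho> \<ge> 0 \<Longrightarrow> K \<rho> \<ge> 0"
  shows "TV a b K (stp c S J) = ennreal (\<Sum>s\<in>S. K \<bar>J s\<bar>)"
proof -
  let ?P = "atomic_measure a b S (\<lambda>s. max 0 (J s))" and ?N = "atomic_measure a b S (\<lambda>s. max 0 (- J s))"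
  interpret jordan_pair a b ?P ?N
    by (rule jordan_pair_atomic)
  let ?D = "{s\<in>S. J s \<noteq> 0}"
  have D: "{x \<in> {a<..<b}. atom ?P ?N x \<noteq> 0} = ?D"
    using S by (auto simp: atom_atomic split: if_splits)
  have "{a<..<b} - ?D = (- ?D) \<inter> {a<..<b}" by auto
  also have "\<dots> \<in> sets (restrict_space borel {a<..<b})"
    using S(1) by (intro borel_Int_sets) (auto intro!: borel_open open_Compl finite_imp_closed)
  finally have m: "{a<..<b} - ?D \<in> sets (restrict_space borel {a<..<b})" .
  have "emeasure ?P ({a<..<b} - ?D) = 0" "emeasure ?N ({a<..<b} - ?D) = 0"
    using S m by (auto intro!: emeasure_atomic_measure_eq_0)
  moreover have "(\<Sum>\<^sub>\<infinity>x\<in>?D. ennreal (K \<bar>atom ?P ?N x\<bar>)) = ennreal (\<Sum>s\<in>S. K \<bar>J s\<bar>)"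
  proof -
    have "(\<Sum>\<^sub>\<infinity>x\<in>?D. ennreal (K \<bar>atom ?P ?N x\<bar>)) = (\<Sum>x\<in>?D. ennreal (K \<bar>atom ?P ?N x\<bar>))"
      using S by simp
    also have "\<dots> = (\<Sum>x\<in>?D. ennreal (K \<bar>J x\<bar>))"
      using S(2) by (intro sum.cong) (auto simp: atom_atomic subset_iff)
    also have "\<dots> = ennreal (\<Sum>x\<in>?D. K \<bar>J x\<bar>)"
      using assms(2) by (simp add: sum_ennreal)
    also have "(\<Sum>x\<in>?D. K \<bar>J x\<bar>) = (\<Sum>s\<in>S. K \<bar>J s\<bar>)"
      using S(1) assms(1) by (intro sum.mono_neutral_left) auto
    finally show ?thesis .
  qed
  moreover have "AE x in lebesgue_on {a<..<b}. stp c S J x = c + pair_cdf ?P ?N x"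
    by (simp add: stp_eq_pair_cdf)
  note TV_eq[OF this stp_measurable_lebesgue_on, of K, unfolded D]
  ultimately show ?thesis by simp
qed

end

section \<open>The jump density\<close>

locale jump_density =
  fixes K :: "real \<Rightarrow> real"
  assumes K_nonneg: "\<And>\<rho>. \<rho> \<ge> 0 \<Longrightarrow> K \<rho> \<ge> 0"
    and K1: "K1 K" and K2: "K2 K" and K3: "K3 K"
begin

lemma K_0: "K 0 = 0"
  using K1 by (simp add: K1_def)

lemma K_mono: "0 \<le> x \<Longrightarrow> x \<le> y \<Longrightarrow> K x \<le> K y"
  using K1 by (auto simp: K1_def mono_on_def)

lemma K_subadditive:
  assumes "x \<ge> 0" "y \<ge> 0"
  shows "K (x + y) \<le> K x + K y"
proof -
  \<comment> \<open>(K2) supplies a constant for positive bounds only; the summand 1 covers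
    \<open>x = y = 0\<close>.\<close>
  obtain C where C: "K2_const K (x + y + 1) C"
  proof -
    have "x + y + 1 > 0" using assms by simp
    with K2 that show ?thesis unfolding K2_def by blast
  qed
  have "K (x + y) + C * x * y \<le> K x + K y" "C > 0"
    using C assms by (auto simp: K2_const_def)
  moreover have "C * x * y \<ge> 0" using \<open>C > 0\<close> assms by simp
  ultimately show ?thesis by linarith
qed

lemma K_abs_add: "K \<bar>x + y\<bar> \<le> K \<bar>x\<bar> + K \<bar>y\<bar>"
  using K_mono[of "\<bar>x + y\<bar>" "\<bar>x\<bar> + \<bar>y\<bar>"] K_subadditive[of "\<bar>x\<bar>" "\<bar>y\<bar>"] abs_triangle_ineq[of x y]
  by simp

lemma K_abs_sum: "finite I \<Longrightarrow> K \<bar>\<Sum>i\<in>I. d i\<bar> \<le> (\<Sum>i\<in>I. K \<bar>d i\<bar>)"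
proof (induction I rule: finite_induct)
  case (insert i I)
  then show ?case using K_abs_add[of "d i" "\<Sum>i\<in>I. d i"] by simp
qed (simp add: K_0)

text \<open>Subadditivity gives \<open>K \<rho> \<le> n K (\<rho> / n)\<close>, and the right-hand side tends to \<open>\<rho>\<close> by (K3).\<close>
lemma K_le_self:
  assumes "\<rho> \<ge> 0"
  shows "K \<rho> \<le> \<rho>"
proof (cases "\<rho> = 0")
  case False
  with assms have \<rho>: "\<rho> > 0" by simp
  have multiple: "K (real n * x) \<le> real n * K x" if "x \<ge> 0" for n x
  proof (induction n)
    case (Suc n)
    then show ?case
      using K_subadditive[of x "real n * x"] that by (simp add: algebra_simps)
  qed (simp add: K_0)
  have "(\<lambda>n. \<rho> / real (Suc n)) \<longlonglongrightarrow> 0"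
    using tendsto_mult[OF tendsto_const[of \<rho>] LIMSEQ_inverse_real_of_nat] by (simp add: divide_inverse)
  moreover have "\<rho> / real (Suc n) > 0" for n using \<rho> by simp
  ultimately have "filterlim (\<lambda>n. \<rho> / real (Suc n)) (at_right 0) sequentially"
    by (intro tendsto_imp_filterlim_at_right always_eventually allI)
  then have "(\<lambda>n. K (\<rho> / real (Suc n)) / (\<rho> / real (Suc n))) \<longlonglongrightarrow> 1"
    using K3 unfolding K3_def by (rule filterlim_compose[rotated])
  then have lim: "(\<lambda>n. \<rho> * (K (\<rho> / real (Suc n)) / (\<rho> / real (Suc n)))) \<longlonglongrightarrow> \<rho> * 1"
    by (intro tendsto_mult tendsto_const)
  have le: "K \<rho> \<le> \<rho> * (K (\<rho> / real (Suc n)) / (\<rho> / real (Suc n)))" for n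
  proof -
    have "K \<rho> \<le> real (Suc n) * K (\<rho> / real (Suc n))"
      using multiple[of "\<rho> / real (Suc n)" "Suc n"] \<rho> by simp
    also have "\<dots> = \<rho> * (K (\<rho> / real (Suc n)) / (\<rho> / real (Suc n)))"
      using \<rho> by simp
    finally show ?thesis .
  qed
  have "K \<rho> \<le> \<rho> * 1"
    by (rule LIMSEQ_le_const[OF lim]) (use le in blast)
  then show ?thesis by simp
qed (simp add: K_0)

lemma K_eventually_greater:
  assumes "z \<longlonglongrightarrow> x" "\<And>n. z n \<ge> 0" "y < K x"
  shows "\<forall>\<^sub>F n in sequentially. y < K (z n)"
proof -
  have "x \<ge> 0"
    by (rule LIMSEQ_le_const[OF assms(1)]) (use assms(2) in blast)
  then have "\<forall>\<^sub>F v in at x within {0..}. y < K v"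
    using K1 assms(3) by (auto simp: K1_def)
  \<comment> \<open>The filter in (K1) leaves out the point \<open>x\<close> itself, where the claim
    is the assumption \<open>y < K x\<close>.\<close>
  then have "\<forall>\<^sub>F v in nhds x. v \<ge> 0 \<longrightarrow> y < K v"
    unfolding eventually_at_filter by (rule eventually_mono) (use assms(3) in auto)
  then have "\<forall>\<^sub>F n in sequentially. z n \<ge> 0 \<longrightarrow> y < K (z n)"
    using assms(1) by (rule eventually_compose_filterlim)
  then show ?thesis using assms(2) by simp
qed

end

section \<open>Essentially bounded functions\<close>

lemma L_infinity_const: "(\<lambda>x. c) \<in> L_infinity a b"
  by (auto simp: L_infinity_def intro!: exI[of _ "\<bar>c\<bar>"])

lemma L_infinity_add:
  assumes "f \<in> L_infinity a b" "h \<in> L_infinity a b"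
  shows "(\<lambda>x. f x + h x) \<in> L_infinity a b"
proof -
  obtain B C where "AE x in lebesgue_on {a<..<b}. \<bar>f x\<bar> \<le> B" "AE x in lebesgue_on {a<..<b}. \<bar>h x\<bar> \<le> C"
    using assms by (auto simp: L_infinity_def)
  then have "AE x in lebesgue_on {a<..<b}. \<bar>f x + h x\<bar> \<le> B + C"
    by eventually_elim linarith
  with assms show ?thesis unfolding L_infinity_def by auto
qed

lemma L_infinity_mult:
  assumes "f \<in> L_infinity a b" "h \<in> L_infinity a b"
  shows "(\<lambda>x. f x * h x) \<in> L_infinity a b"
proof -
  obtain B C where "AE x in lebesgue_on {a<..<b}. \<bar>f x\<bar> \<le> B" "AE x in lebesgue_on {a<..<b}. \<bar>h x\<bar> \<le> C"
    using assms by (auto simp: L_infinity_def)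
  then have "AE x in lebesgue_on {a<..<b}. \<bar>f x * h x\<bar> \<le> B * C"
    by eventually_elim (auto simp: abs_mult intro!: mult_mono)
  with assms show ?thesis unfolding L_infinity_def by auto
qed

lemma L_infinity_diff:
  assumes "f \<in> L_infinity a b" "h \<in> L_infinity a b"
  shows "(\<lambda>x. f x - h x) \<in> L_infinity a b"
  using L_infinity_add[OF assms(1) L_infinity_mult[OF L_infinity_const[of "-1"] assms(2)]] by simp

lemma L_infinity_integrable:
  assumes "f \<in> L_infinity a b"
  shows "integrable (lebesgue_on {a<..<b}) f"
proof -
  obtain B where B: "AE x in lebesgue_on {a<..<b}. \<bar>f x\<bar> \<le> B"
    using assms by (auto simp: L_infinity_def)
  show ?thesis
  proof (rule Bochner_Integration.integrable_bound)
    show "integrable (lebesgue_on {a<..<b}) (\<lambda>x. B)"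
      by (intro finite_measure.integrable_const finite_measure_lebesgue_on) auto
    show "f \<in> borel_measurable (lebesgue_on {a<..<b})" using assms by (simp add: L_infinity_def)
    show "AE x in lebesgue_on {a<..<b}. norm (f x) \<le> norm B"
      using B by eventually_elim auto
  qed
qed

lemma L_infinity_bounded_borel:
  assumes "f \<in> borel_measurable borel" "\<And>x. \<bar>f x\<bar> \<le> B"
  shows "f \<in> L_infinity a b"
proof -
  have "f \<in> borel_measurable (lebesgue_on {a<..<b})"
    using assms(1) by (intro measurable_restrict_space1 measurable_completion) simp
  with assms(2) show ?thesis by (auto simp: L_infinity_def)
qed

lemma L_infinity_stp: "stp c S J \<in> L_infinity a b"
  by (rule L_infinity_bounded_borel[OF stp_measurable stp_bounded])

lemma L_infinity_indicator: "A \<in> sets borel \<Longrightarrow> (indicator A :: real \<Rightarrow> real) \<in> L_infinity a b"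
  by (rule L_infinity_bounded_borel[where B = 1]) (auto simp: indicator_def)

section \<open>Clipping and representing step functions\<close>

definition clip :: "real \<Rightarrow> real \<Rightarrow> real \<Rightarrow> real" where
  "clip l r y = max l (min r y)"

lemma clip_in: "l \<le> r \<Longrightarrow> clip l r y \<in> {l..r}"
  by (auto simp: clip_def)

lemma clip_id: "y \<in> {l..r} \<Longrightarrow> clip l r y = y"
  by (auto simp: clip_def)

lemma abs_clip_diff_le: "\<bar>clip l r y - clip l r z\<bar> \<le> \<bar>y - z\<bar>"
  by (auto simp: clip_def min_def max_def)

lemma stp_insert_max:
  assumes "finite S" "\<And>s. s \<in> S \<Longrightarrow> s < t"
  shows "stp c (insert t S) J x = stp c S J x + (if t \<le> x then J t else 0)"
proof -
  have "t \<notin> S" using assms(2) by blast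
  then show ?thesis using assms(1) by (simp add: stp_def)
qed

lemma stp_cong: "(\<And>s. s \<in> S \<Longrightarrow> J s = J' s) \<Longrightarrow> stp c S J = stp c S J'"
  by (auto simp: stp_def fun_eq_iff intro!: sum.cong)

lemma stp_eq_if_no_jump:
  assumes "x \<le> y" "S \<inter> {x<..y} = {}"
  shows "stp c S J x = stp c S J y"
proof -
  have "s \<le> x \<longleftrightarrow> s \<le> y" if "s \<in> S" for s
  proof
    assume "s \<le> y"
    show "s \<le> x"
    proof (rule ccontr)
      assume "\<not> s \<le> x"
      with \<open>s \<le> y\<close> that have "s \<in> S \<inter> {x<..y}" by simp
      with assms(2) show False by simp
    qed
  qed (use assms(1) in simp)
  then show ?thesis by (simp add: stp_def)
qed

text \<open>Clipping keeps the positions, since each new height is a difference of clipped values,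
  and it does not raise heights, since \<open>clip\<close> is 1-Lipschitz. With the largest position
  split off, \<open>v\<close> is the value just before it.\<close>

lemma clip_stp:
  assumes "finite S"
  shows "\<exists>J'. (\<forall>x. stp (clip l r c) S J' x = clip l r (stp c S J x)) \<and> (\<forall>s\<in>S. \<bar>J' s\<bar> \<le> \<bar>J s\<bar>)"
  using assms
proof (induction S rule: finite_linorder_max_induct)
  case empty
  show ?case by (simp add: stp_def)
next
  case (insert t S)
  then obtain J' where J': "\<And>x. stp (clip l r c) S J' x = clip l r (stp c S J x)" "\<And>s. s \<in> S \<Longrightarrow> \<bar>J' s\<bar> \<le> \<bar>J s\<bar>"
    by blast
  define v where "v = stp c S J t"
  define J'' where "J'' = J'(t := clip l r (v + J t) - clip l r v)"
  have after: "stp c S J x = v" if "t \<le> x" for x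
    unfolding v_def by (rule stp_eq_if_no_jump[symmetric]) (use insert.hyps that in auto)
  have "stp (clip l r c) S J'' = stp (clip l r c) S J'"
    by (rule stp_cong) (use insert.hyps in \<open>auto simp: J''_def\<close>)
  then have "stp (clip l r c) (insert t S) J'' x = clip l r (stp c (insert t S) J x)" for x
    using insert.hyps after[of x] by (simp add: stp_insert_max J'(1)) (simp add: J''_def)
  moreover have "\<bar>J'' s\<bar> \<le> \<bar>J s\<bar>" if "s \<in> insert t S" for s
    using that J'(2)[of s] abs_clip_diff_le[of l r "v + J t" v] by (auto simp: J''_def)
  ultimately show ?case by blast
qed

text \<open>\<open>V\<close> is arbitrary on \<open>S\<close>, hence the equation only off
  \<open>S\<close>. In the induction \<open>V'\<close> extends the value just before the largest
  point \<open>t\<close> up to \<open>b\<close>, so that \<open>t\<close> is no longer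
  exceptional.\<close>

lemma locally_constant_eq_stp:
  assumes "finite S" "S \<subseteq> {a<..<b}"
    and "\<And>x y. a \<le> x \<Longrightarrow> x \<le> y \<Longrightarrow> y \<le> b \<Longrightarrow> {x..y} \<inter> S = {} \<Longrightarrow> V x = V y"
  shows "\<exists>J. \<forall>x\<in>{a..b} - S. V x = stp (V a) S J x"
  using assms
proof (induction S arbitrary: V rule: finite_linorder_max_induct)
  case empty
  then show ?case by (auto simp: stp_def)
next
  case (insert t S)
  have t: "a < t" "t < b" using insert.prems by auto
  \<comment> \<open>The last exceptional point before \<open>t\<close>, or \<open>a\<close> if there
    is none; the midpoint \<open>y0\<close> then lies in the piece that ends at
    \<open>t\<close>.\<close>
  define q where "q = Max (insert a S)"
  have q: "a \<le> q" "q < t" "\<And>s. s \<in> S \<Longrightarrow> s \<le> q"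
    using insert.hyps insert.prems t by (auto simp: q_def Max_less_iff)
  define y0 where "y0 = (q + t) / 2"
  have y0: "q < y0" "y0 < t" using q by (auto simp: y0_def)
  define V' where "V' x = (if x < t then V x else V y0)" for x
  have "V' x = V' y" if xy: "a \<le> x" "x \<le> y" "y \<le> b" "{x..y} \<inter> S = {}" for x y
  proof -
    consider "y < t" | "t \<le> x" | "x < t" "t \<le> y" by linarith
    then show ?thesis
    proof cases
      case 1
      then have "V x = V y" using xy t by (intro insert.prems(2)) auto
      with 1 xy show ?thesis by (simp add: V'_def)
    next
      case 2
      with xy show ?thesis by (simp add: V'_def)
    next
      case 3
      have before: "s < x" if "s \<in> S" for s
      proof (rule ccontr)
        assume "\<not> s < x"
        then have "s \<in> {x..y}" using insert.hyps(2) that 3 by force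
        with that xy(4) show False by blast
      qed
      then have "z \<notin> insert t S" if "z \<in> {min x y0..max x y0}" for z
      proof -
        have "z < t" using that y0(2) 3 by (auto simp: max_def split: if_splits)
        moreover have "z \<notin> S"
        proof
          assume "z \<in> S"
          then have "z < x" "z < y0" using before[of z] q(3)[of z] y0(1) by auto
          with that show False by auto
        qed
        ultimately show ?thesis by auto
      qed
      then have "{min x y0..max x y0} \<inter> insert t S = {}" by blast
      then have "V (min x y0) = V (max x y0)"
        using xy y0 q t 3 by (intro insert.prems(2)) auto
      then have "V x = V y0" by (auto simp: min_def max_def split: if_splits)
      with 3 show ?thesis by (simp add: V'_def)
    qed
  qed
  moreover have "S \<subseteq> {a<..<b}" using insert.prems by simp
  ultimately obtain J where J: "\<And>x. x \<in> {a..b} - S \<Longrightarrow> V' x = stp (V' a) S J x"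
    using insert.IH by blast
  define J' where "J' = J(t := V b - V y0)"
  have "V x = stp (V a) (insert t S) J' x" if x: "x \<in> {a..b} - insert t S" for x
  proof -
    have "stp (V a) S J' x = stp (V a) S J x"
      by (rule fun_cong, rule stp_cong) (use insert.hyps in \<open>auto simp: J'_def\<close>)
    then have "stp (V a) (insert t S) J' x = V' x + (if t \<le> x then V b - V y0 else 0)"
      using insert.hyps J[of x] x t by (simp add: stp_insert_max V'_def J'_def)
    also have "\<dots> = V x"
    proof (cases "t \<le> x")
      case True
      have "{x..b} \<inter> insert t S = {}"
        using True x insert.hyps(2) by force
      then have "V x = V b" using x by (intro insert.prems(2)) auto
      with True show ?thesis by (simp add: V'_def)
    qed (simp add: V'_def)
    finally show ?thesis by simp
  qed
  then show ?case by blast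
qed

text \<open>The gaps between consecutive points, one fewer than the points, fit into
  \<open>Max S - Min S\<close>.\<close>

lemma card_separated_le:
  fixes S :: "real set"
  assumes "finite S" "S \<subseteq> {a<..<b}" "a < b" "L > 0"
    and "\<And>s t. s \<in> S \<Longrightarrow> t \<in> S \<Longrightarrow> s < t \<Longrightarrow> L \<le> t - s"
  shows "(real (card S) - 1) * L \<le> b - a"
proof (cases "S = {}")
  case False
  have "(real (card S) - 1) * L \<le> Max S - Min S" if "S \<noteq> {}"
    using assms(1) that assms(5)
  proof (induction S rule: finite_linorder_max_induct)
    case (insert t S)
    show ?case
    proof (cases "S = {}")
      case False
      have "Max S \<in> S" using insert.hyps(1) False by simp
      then have "L \<le> t - Max S" using insert.hyps(2) by (intro insert.prems(2)) auto
      moreover have "(real (card S) - 1) * L \<le> Max S - Min S"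
        using False insert.prems(2) by (intro insert.IH) auto
      moreover have "Max (insert t S) = t" "Min (insert t S) = Min S"
      proof -
        have "Max S < t" "Min S < t" using insert.hyps(1,2) False by auto
        then have "max t (Max S) = t" "min t (Min S) = Min S"
          by (auto intro!: max_absorb1 min_absorb2 less_imp_le)
        then show "Max (insert t S) = t" "Min (insert t S) = Min S"
          using Max_insert[OF insert.hyps(1) False, of t] Min_insert[OF insert.hyps(1) False, of t] by argo+
      qed
      moreover have "card (insert t S) = Suc (card S)" using insert.hyps by (subst card_insert_disjoint) auto
      ultimately show ?thesis by (simp add: algebra_simps)
    qed simp
  qed simp
  moreover have "Max S \<in> S" "Min S \<in> S" using assms(1) False by auto
  then have "Max S < b" "Min S > a" using assms(2) by auto
  ultimately show ?thesis using False by linarith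
qed (use assms in auto)

lemma ex_left_gap:
  fixes S :: "real set"
  assumes "finite S" "r < s"
  shows "\<exists>y. r \<le> y \<and> y < s \<and> S \<inter> {y<..<s} = {}"
proof (intro exI conjI)
  let ?y = "Max (insert r (S \<inter> {..<s}))"
  show "r \<le> ?y" "?y < s" using assms by auto
  show "S \<inter> {?y<..<s} = {}"
  proof (rule equals0I)
    fix z assume z: "z \<in> S \<inter> {?y<..<s}"
    then have "z \<le> ?y" using assms(1) by (intro Max_ge) auto
    with z show False by simp
  qed
qed

lemma sum_remove_two:
  assumes "finite S" "s \<in> S" "t \<in> S" "s \<noteq> t"
  shows "sum f S = f s + f t + sum f (S - {s, t})"
proof -
  have "sum f S = f s + sum f (S - {s})" using assms by (simp add: sum.remove)
  also have "sum f (S - {s}) = f t + sum f (S - {s} - {t})" using assms by (intro sum.remove) auto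
  also have "S - {s} - {t} = S - {s, t}" by auto
  finally show ?thesis by (simp add: add.assoc)
qed

text \<open>Bookkeeping for a merge: position \<open>s\<close> is dropped and \<open>t\<close>
  receives the height \<open>v\<close>. The function \<open>f\<close> stands both for the jump cost
  and for the contribution to the value at a point.\<close>

lemma sum_remove_one:
  fixes f :: "real \<Rightarrow> real \<Rightarrow> real"
  assumes "finite S" "s \<in> S" "t \<in> S" "s \<noteq> t"
  shows "(\<Sum>r\<in>S - {s}. f r ((J(t := v)) r)) = f t v + (\<Sum>r\<in>S - {s, t}. f r (J r))"
proof -
  have "(\<Sum>r\<in>S - {s}. f r ((J(t := v)) r)) = f t v + (\<Sum>r\<in>S - {s} - {t}. f r ((J(t := v)) r))"
    using assms by (subst sum.remove[of _ t]) auto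
  also have "(\<Sum>r\<in>S - {s} - {t}. f r ((J(t := v)) r)) = (\<Sum>r\<in>S - {s, t}. f r (J r))"
    by (rule sum.cong) auto
  finally show ?thesis .
qed

section \<open>The energy of step functions\<close>

locale segmentation = jump_density K for K :: "real \<Rightarrow> real" +
  fixes a b lam :: real and g :: "real \<Rightarrow> real"
  assumes ab: "a < b" and lam: "lam > 0" and g: "g \<in> L_infinity a b"
begin

definition adm :: "real set \<Rightarrow> bool" where
  "adm S \<longleftrightarrow> finite S \<and> S \<subseteq> {a<..<b}"

definition fid :: "(real \<Rightarrow> real) \<Rightarrow> real" where
  "fid V = (LINT x|lebesgue_on {a<..<b}. (V x - g x)\<^sup>2)"

definition energy :: "real \<Rightarrow> real set \<Rightarrow> (real \<Rightarrow> real) \<Rightarrow> real" where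
  "energy c S J = (\<Sum>s\<in>S. K \<bar>J s\<bar>) + lam / 2 * fid (stp c S J)"

definition g_inf :: real where "g_inf = real_of_ereal (ess_inf_on a b g)"
definition g_sup :: real where "g_sup = real_of_ereal (ess_sup_on a b g)"

lemma fid_integrable:
  assumes "V \<in> L_infinity a b"
  shows "integrable (lebesgue_on {a<..<b}) (\<lambda>x. (V x - g x)\<^sup>2)"
  unfolding power2_eq_square
  by (intro L_infinity_integrable L_infinity_mult L_infinity_diff assms g)

lemma fid_nonneg: "fid V \<ge> 0"
  unfolding fid_def by simp

lemma energy_nonneg: "energy c S J \<ge> 0"
  unfolding energy_def using lam fid_nonneg K_nonneg by (auto intro!: add_nonneg_nonneg sum_nonneg)

lemma nn_integral_fid:
  assumes "V \<in> L_infinity a b"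
  shows "(\<integral>\<^sup>+x. ennreal (\<bar>V x - g x\<bar>\<^sup>2) \<partial>lebesgue_on {a<..<b}) = ennreal (fid V)"
  unfolding fid_def using nn_integral_eq_integral[OF fid_integrable[OF assms]] by simp

lemma TVg_eq:
  assumes "V \<in> L_infinity a b"
  shows "TVg a b lam K g V = TV a b K V + ennreal (lam / 2 * fid V)"
  unfolding TVg_def nn_integral_fid[OF assms]
  using lam by (subst ennreal_mult[of "lam / 2"]) (auto intro: fid_nonneg)

lemma TVg_stp:
  assumes "adm S"
  shows "TVg a b lam K g (stp c S J) = ennreal (energy c S J)"
proof -
  have "(\<Sum>s\<in>S. K \<bar>J s\<bar>) \<ge> 0" by (intro sum_nonneg K_nonneg) simp
  then show ?thesis
    using assms lam fid_nonneg TV_stp[OF ab, of S K c J] K_0 K_nonneg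
    by (simp add: TVg_eq[OF L_infinity_stp] adm_def energy_def ennreal_plus)
qed

lemma ess_bounds:
  shows ess_sup_eq: "ess_sup_on a b g = ereal g_sup"
    and ess_inf_eq: "ess_inf_on a b g = ereal g_inf"
    and AE_g: "AE x in lebesgue_on {a<..<b}. g_inf \<le> g x \<and> g x \<le> g_sup"
    and g_inf_le_g_sup: "g_inf \<le> g_sup"
proof -
  obtain B where B: "AE x in lebesgue_on {a<..<b}. \<bar>g x\<bar> \<le> B" and [measurable]: "g \<in> borel_measurable (lebesgue_on {a<..<b})"
    using g by (auto simp: L_infinity_def)
  have m: "(\<lambda>x. ereal (g x)) \<in> borel_measurable (lebesgue_on {a<..<b})"
    "(\<lambda>x. - ereal (g x)) \<in> borel_measurable (lebesgue_on {a<..<b})" by measurable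
  define s where "s = ess_sup_on a b g"
  define i where "i = ess_inf_on a b g"
  have s: "AE x in lebesgue_on {a<..<b}. ereal (g x) \<le> s"
    unfolding s_def ess_sup_on_def by (rule esssup_AE)
  have i: "AE x in lebesgue_on {a<..<b}. i \<le> ereal (g x)"
    using esssup_AE[where M = "lebesgue_on {a<..<b}" and f = "\<lambda>x. - ereal (g x)"]
    unfolding i_def ess_inf_on_def by eventually_elim (metis ereal_minus_le_minus ereal_uminus_uminus)
  have sB: "s \<le> ereal B" unfolding s_def ess_sup_on_def
    by (rule esssup_I[OF m(1)]) (use B in \<open>auto elim!: eventually_mono\<close>)
  have "esssup (lebesgue_on {a<..<b}) (\<lambda>x. - ereal (g x)) \<le> ereal B"
    by (rule esssup_I[OF m(2)]) (use B in \<open>auto elim!: eventually_mono\<close>)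
  then have iB: "ereal (- B) \<le> i" unfolding i_def ess_inf_on_def
    using ereal_minus_le_minus by fastforce
  \<comment> \<open>One good point bounds \<open>s\<close> from below and \<open>i\<close> from
    above; together with \<open>B\<close> this makes both essential bounds finite.\<close>
  obtain x where x: "ereal (g x) \<le> s" "i \<le> ereal (g x)" "\<bar>g x\<bar> \<le> B"
  proof -
    have "AE x in lebesgue_on {a<..<b}. ereal (g x) \<le> s \<and> i \<le> ereal (g x) \<and> \<bar>g x\<bar> \<le> B"
      using s i B by eventually_elim simp
    then have "\<exists>\<^sub>F x in at_right a. ereal (g x) \<le> s \<and> i \<le> ereal (g x) \<and> \<bar>g x\<bar> \<le> B"
      by (rule AE_frequently_at_right) (use ab in auto)
    then show thesis using that frequently_ex by blast
  qed
  have "s \<noteq> \<infinity>" "s \<noteq> -\<infinity>" "i \<noteq> \<infinity>" "i \<noteq> -\<infinity>"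
    using sB iB x by auto
  then have e: "s = ereal g_sup" "i = ereal g_inf"
    by (auto simp: g_sup_def g_inf_def s_def[symmetric] i_def[symmetric] ereal_real)
  then show "ess_sup_on a b g = ereal g_sup" "ess_inf_on a b g = ereal g_inf"
    by (simp_all add: s_def i_def)
  show "AE x in lebesgue_on {a<..<b}. g_inf \<le> g x \<and> g x \<le> g_sup"
    using s i by eventually_elim (simp add: e)
  show "g_inf \<le> g_sup"
    using x(1,2) unfolding e by (meson ereal_less_eq(3) order_trans)
qed

lemma fid_AE_cong:
  assumes "AE x in lebesgue_on {a<..<b}. V x = W x" "V \<in> L_infinity a b" "W \<in> L_infinity a b"
  shows "fid V = fid W"
  unfolding fid_def
proof (rule integral_cong_AE)
  show "AE x in lebesgue_on {a<..<b}. (V x - g x)\<^sup>2 = (W x - g x)\<^sup>2"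
    using assms(1) by eventually_elim simp
qed (use fid_integrable assms in auto)

text \<open>Jump costs fall because \<open>K\<close> is monotone; the fidelity integrand falls
  almost everywhere, strictly where the value leaves the range of \<open>g\<close>. The last
  conclusion records this strictness. As the positions \<open>S\<close> are kept, it can be used
  within a class of bounded jump number.\<close>

lemma energy_clip:
  assumes "adm S"
  obtains c' J' where "\<And>x. stp c' S J' x = clip g_inf g_sup (stp c S J x)"
    "c' = clip g_inf g_sup c" "\<And>s. s \<in> S \<Longrightarrow> \<bar>J' s\<bar> \<le> g_sup - g_inf"
    "energy c' S J' \<le> energy c S J"
    "\<And>x. energy c' S J' = energy c S J \<Longrightarrow> x \<in> {a..b} \<Longrightarrow> stp c S J x \<in> {g_inf..g_sup}"
proof -
  define c' where "c' = clip g_inf g_sup c"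
  have fin: "finite S" using assms by (simp add: adm_def)
  obtain J' where J': "\<And>x. stp c' S J' x = clip g_inf g_sup (stp c S J x)" "\<And>s. s \<in> S \<Longrightarrow> \<bar>J' s\<bar> \<le> \<bar>J s\<bar>"
    using clip_stp[OF fin, of g_inf g_sup c J] unfolding c'_def by blast
  have sums: "(\<Sum>s\<in>S. K \<bar>J' s\<bar>) \<le> (\<Sum>s\<in>S. K \<bar>J s\<bar>)"
    using J'(2) by (intro sum_mono K_mono) auto
  let ?d = "\<lambda>x. (stp c S J x - g x)\<^sup>2 - (stp c' S J' x - g x)\<^sup>2"
  have int: "integrable (lebesgue_on {a<..<b}) ?d"
    by (intro Bochner_Integration.integrable_diff fid_integrable L_infinity_stp)
  have clip_sq: "(clip g_inf g_sup y - z)\<^sup>2 \<le> (y - z)\<^sup>2 \<and>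
      ((clip g_inf g_sup y - z)\<^sup>2 = (y - z)\<^sup>2 \<longrightarrow> y \<in> {g_inf..g_sup})"
    if z: "g_inf \<le> z \<and> z \<le> g_sup" for y z
  proof -
    consider "y < g_inf" | "y > g_sup" | "y \<in> {g_inf..g_sup}" by force
    then show ?thesis
    proof cases
      case 1
      then have "clip g_inf g_sup y = g_inf" using g_inf_le_g_sup by (auto simp: clip_def)
      moreover have "(z - g_inf)\<^sup>2 < (z - y)\<^sup>2" using 1 z by (intro power_strict_mono) auto
      ultimately show ?thesis by (simp add: power2_commute)
    next
      case 2
      then have "clip g_inf g_sup y = g_sup" using g_inf_le_g_sup by (auto simp: clip_def)
      moreover have "(g_sup - z)\<^sup>2 < (y - z)\<^sup>2" using 2 z by (intro power_strict_mono) auto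
      ultimately show ?thesis by simp
    next
      case 3
      then show ?thesis by (simp add: clip_id)
    qed
  qed
  have nn: "AE x in lebesgue_on {a<..<b}. ?d x \<ge> 0"
    using AE_g
  proof eventually_elim
    case (elim x)
    from clip_sq[OF this, of "stp c S J x"] show ?case by (simp add: J'(1))
  qed
  have diff: "fid (stp c S J) - fid (stp c' S J') = (LINT x|lebesgue_on {a<..<b}. ?d x)"
    unfolding fid_def
    by (rule Bochner_Integration.integral_diff[symmetric]) (intro fid_integrable L_infinity_stp)+
  have "fid (stp c S J) - fid (stp c' S J') \<ge> 0"
    unfolding diff by (rule integral_nonneg_AE[OF nn])
  then have fid: "lam / 2 * fid (stp c' S J') \<le> lam / 2 * fid (stp c S J)" using lam by simp
  have le: "energy c' S J' \<le> energy c S J"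
    unfolding energy_def using sums fid by linarith
  have range: "stp c S J x \<in> {g_inf..g_sup}" if eq: "energy c' S J' = energy c S J" and x: "x \<in> {a..b}" for x
  proof -
    have "lam / 2 * fid (stp c' S J') = lam / 2 * fid (stp c S J)"
      using eq sums fid unfolding energy_def by linarith
    then have "fid (stp c' S J') = fid (stp c S J)" using lam by simp
    then have "AE x in lebesgue_on {a<..<b}. ?d x = 0"
      using integral_nonneg_eq_0_iff_AE[OF int nn] diff by simp
    then have ae: "AE x in lebesgue_on {a<..<b}. stp c S J x \<in> {g_inf..g_sup}"
      using AE_g
    proof eventually_elim
      case (elim x)
      from clip_sq[OF elim(2), of "stp c S J x"] elim(1) show ?case by (simp add: J'(1))
    qed
    \<comment> \<open>So far the range is known almost everywhere. It passes to each point because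
      the step function is constant on a short interval to the right, or, at the end point
      \<open>b\<close>, to the left, no position being at \<open>b\<close>.\<close>
    show ?thesis
    proof (cases "x < b")
      case True
      have "\<exists>\<^sub>F y in at_right x. stp c S J y \<in> {g_inf..g_sup}"
        using x True by (intro AE_frequently_at_right[OF ae]) auto
      moreover have "\<forall>\<^sub>F y in at_right x. stp c S J x = stp c S J y"
      proof -
        have "finite (S \<inter> {x<..})" using fin by simp
        have "\<forall>\<^sub>F y in at_right x. {x..y} \<subseteq> - (S \<inter> {x<..})"
        proof -
          obtain d where d: "d > 0" "\<And>s. s \<in> S \<inter> {x<..} \<Longrightarrow> s \<noteq> x \<Longrightarrow> d \<le> dist x s"
            using finite_set_avoid[OF \<open>finite (S \<inter> {x<..})\<close>, of x] by blast
          show ?thesis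
            unfolding eventually_at_right_field
          proof (intro exI[of _ "x + d"] conjI allI impI subsetI ComplI)
            fix y z assume "x < y" "y < x + d" "z \<in> {x..y}" "z \<in> S \<inter> {x<..}"
            with d(2)[of z] show False by (auto simp: dist_real_def)
          qed (use d(1) in simp)
        qed
        moreover have "\<forall>\<^sub>F y in at_right x. x < y" by (simp add: eventually_at_right_less)
        ultimately show ?thesis
        proof eventually_elim
          case (elim y)
          have "S \<inter> {x<..y} = {}"
          proof (rule equals0I)
            fix z assume "z \<in> S \<inter> {x<..y}"
            then have "z \<in> {x..y}" "z \<in> S \<inter> {x<..}" by auto
            with elim(1) show False by blast
          qed
          then show ?case using elim(2) by (intro stp_eq_if_no_jump) auto
        qed
      qed
      ultimately have "\<exists>\<^sub>F y in at_right x. stp c S J x = stp c S J y \<and> stp c S J y \<in> {g_inf..g_sup}"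
        by (rule frequently_eventually_conj)
      then show ?thesis using frequently_ex by fastforce
    next
      case False
      then have xb: "x = b" using x by simp
      obtain q where q: "a \<le> q" "q < b" "\<And>s. s \<in> S \<Longrightarrow> s \<le> q"
      proof
        show "a \<le> Max (insert a S)" "Max (insert a S) < b" "\<And>s. s \<in> S \<Longrightarrow> s \<le> Max (insert a S)"
          using assms ab by (auto simp: adm_def Max_less_iff)
      qed
      have "\<exists>\<^sub>F y in at_left b. stp c S J y \<in> {g_inf..g_sup}"
        using ab by (intro AE_frequently_at_left[OF ae]) auto
      moreover have "\<forall>\<^sub>F y in at_left b. stp c S J b = stp c S J y"
        unfolding eventually_at_left_field
      proof (intro exI[of _ q] conjI allI impI)
        fix y assume "q < y" "y < b"
        then show "stp c S J b = stp c S J y"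
          using q(3) by (intro stp_eq_if_no_jump[symmetric]) force+
      qed (rule q(2))
      ultimately have "\<exists>\<^sub>F y in at_left b. stp c S J b = stp c S J y \<and> stp c S J y \<in> {g_inf..g_sup}"
        by (rule frequently_eventually_conj)
      then show ?thesis unfolding xb using frequently_ex by fastforce
    qed
  qed
  \<comment> \<open>\<open>J' s\<close> is the difference between the clipped values at
    \<open>s\<close> and at a point \<open>y\<close> of the facet before it, so it is bounded by the
    oscillation of \<open>g\<close>, whatever \<open>J s\<close> is.\<close>
  have "\<bar>J' s\<bar> \<le> g_sup - g_inf" if "s \<in> S" for s
  proof -
    obtain y where y: "y < s" "S \<inter> {y<..<s} = {}"
      using ex_left_gap[OF fin, of "s - 1" s] by auto
    have "stp c' S J' s - stp c' S J' y = (\<Sum>r\<in>S. if y < r \<and> r \<le> s then J' r else 0)"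
      unfolding stp_def using y(1) by (auto simp: sum_subtractf[symmetric] intro!: sum.cong)
    also have "\<dots> = (\<Sum>r\<in>S. if r = s then J' s else 0)"
    proof (rule sum.cong[OF refl])
      fix r assume "r \<in> S"
      then have "y < r \<and> r \<le> s \<longleftrightarrow> r = s" using y by force
      then show "(if y < r \<and> r \<le> s then J' r else 0) = (if r = s then J' s else 0)" by auto
    qed
    also have "\<dots> = J' s" using fin that by simp
    finally have "J' s = stp c' S J' s - stp c' S J' y" by simp
    moreover have "clip g_inf g_sup v \<in> {g_inf..g_sup}" for v
      using g_inf_le_g_sup by (rule clip_in)
    ultimately show ?thesis unfolding J'(1) by (metis (no_types) abs_diff_le_iff atLeastAtMost_iff diff_mono abs_le_iff minus_diff_eq)
  qed
  then show thesis using that[OF J'(1) c'_def _ le range] by blast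
qed

end

context segmentation
begin

section \<open>Merging adjacent jumps\<close>

lemma integral_indicator_Ico:
  assumes "a < s" "s < t" "t < b"
  shows "(LINT x|lebesgue_on {a<..<b}. indicat_real {s..<t} x) = t - s"
proof -
  have "(LINT x|lebesgue_on {a<..<b}. indicat_real {s..<t} x) = (LINT x|lborel. indicat_real {a<..<b} x * indicat_real {s..<t} x)"
    using integral_lebesgue_on_borel[of "indicat_real {s..<t}" "{a<..<b}"] by simp
  also have "\<dots> = (LINT x|lborel. indicat_real {s..<t} x)"
    using assms by (intro Bochner_Integration.integral_cong) (auto simp: indicator_def)
  finally show ?thesis using assms by simp
qed

text \<open>The fidelity is quadratic, so shifting one facet by \<open>d\<close> changes it by an
  exact polynomial of degree two in \<open>d\<close>. Its linear term is the one that the average of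
  two merges cancels.\<close>

lemma fid_shift:
  assumes "a < s" "s < t" "t < b" "V \<in> L_infinity a b"
  shows "fid (\<lambda>x. V x + d * indicator {s..<t} x) =
    fid V + d\<^sup>2 * (t - s) + 2 * d * (LINT x|lebesgue_on {a<..<b}. indicator {s..<t} x * (V x - g x))"
proof -
  let ?i = "indicator {s..<t} :: real \<Rightarrow> real"
  have i: "?i \<in> L_infinity a b" by (rule L_infinity_indicator) simp
  have i2: "(\<lambda>x. ?i x * (V x - g x)) \<in> L_infinity a b"
    by (intro L_infinity_mult L_infinity_diff i assms g)
  have "(V x + d * ?i x - g x)\<^sup>2 = (V x - g x)\<^sup>2 + (d\<^sup>2 * ?i x + 2 * d * (?i x * (V x - g x)))" for x
    by (cases "x \<in> {s..<t}") (auto simp: power2_eq_square algebra_simps)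
  then have "fid (\<lambda>x. V x + d * ?i x) = (LINT x|lebesgue_on {a<..<b}. (V x - g x)\<^sup>2 + (d\<^sup>2 * ?i x + 2 * d * (?i x * (V x - g x))))"
    by (simp add: fid_def)
  also have "\<dots> = fid V + (d\<^sup>2 * (LINT x|lebesgue_on {a<..<b}. ?i x) + 2 * d * (LINT x|lebesgue_on {a<..<b}. ?i x * (V x - g x)))"
    using fid_integrable[OF assms(4)] L_infinity_integrable[OF i] L_infinity_integrable[OF i2]
    by (simp add: fid_def)
  finally show ?thesis using integral_indicator_Ico[OF assms(1-3)] by simp
qed

lemma abs_integral_const_minus_g_le:
  assumes st: "a < s" "s < t" "t < b" and v: "v \<in> {g_inf..g_sup}" and M: "g_sup - g_inf \<le> M"
  shows "\<bar>LINT x|lebesgue_on {a<..<b}. indicator {s..<t} x * (v - g x)\<bar> \<le> M * (t - s)"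
proof -
  let ?i = "indicator {s..<t} :: real \<Rightarrow> real"
  have i: "?i \<in> L_infinity a b" by (rule L_infinity_indicator) simp
  have iv: "(\<lambda>x. ?i x * (v - g x)) \<in> L_infinity a b"
    by (intro L_infinity_mult L_infinity_diff L_infinity_const i g)
  have "\<bar>LINT x|lebesgue_on {a<..<b}. ?i x * (v - g x)\<bar> \<le> (LINT x|lebesgue_on {a<..<b}. \<bar>?i x * (v - g x)\<bar>)"
    by (rule integral_abs_bound)
  also have "\<dots> \<le> (LINT x|lebesgue_on {a<..<b}. M * ?i x)"
  proof (rule integral_mono_AE)
    show "AE x in lebesgue_on {a<..<b}. \<bar>?i x * (v - g x)\<bar> \<le> M * ?i x"
      using AE_g
    proof eventually_elim
      case (elim x)
      then have "\<bar>v - g x\<bar> \<le> M" using v M by auto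
      then show ?case by (auto simp: indicator_def)
    qed
  qed (use L_infinity_integrable[OF i] L_infinity_integrable[OF iv] in auto)
  also have "\<dots> = M * (t - s)"
    using integral_indicator_Ico[OF st] by simp
  finally show ?thesis .
qed

context
  fixes S :: "real set" and s t :: real
  assumes S: "adm S" and s: "s \<in> S" and t: "t \<in> S" and st: "s < t"
begin

text \<open>Moving the jump at \<open>s\<close> onto \<open>t\<close> gives the facet the value of
  its left neighbour; the companion lemma moves \<open>t\<close> onto \<open>s\<close> and gives it
  the value of the right neighbour. Outside the facet nothing changes.\<close>

lemma stp_merge_right:
  "stp c (S - {s}) (J(t := J s + J t)) x = stp c S J x + (- J s) * indicator {s..<t} x"
proof -
  have f: "finite S" using S by (simp add: adm_def)
  show ?thesis
    unfolding stp_def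
    using sum_remove_two[OF f s t, of "\<lambda>r. if r \<le> x then J r else 0"] st
      sum_remove_one[OF f s t, of "\<lambda>r v. if r \<le> x then v else 0" J "J s + J t"]
    by (auto simp: indicator_def)
qed

lemma stp_merge_left:
  "stp c (S - {t}) (J(s := J s + J t)) x = stp c S J x + J t * indicator {s..<t} x"
proof -
  have f: "finite S" using S by (simp add: adm_def)
  show ?thesis
    unfolding stp_def
    using sum_remove_two[OF f s t, of "\<lambda>r. if r \<le> x then J r else 0"] st
      sum_remove_one[OF f t s, of "\<lambda>r v. if r \<le> x then v else 0" J "J s + J t"]
    by (auto simp: indicator_def insert_commute)
qed

lemma energy_merge:
  defines "G c J \<equiv> LINT x|lebesgue_on {a<..<b}. indicator {s..<t} x * (stp c S J x - g x)"
  shows "energy c (S - {s}) (J(t := J s + J t)) = energy c S J - (K \<bar>J s\<bar> + K \<bar>J t\<bar> - K \<bar>J s + J t\<bar>)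
      + lam / 2 * ((J s)\<^sup>2 * (t - s) - 2 * J s * G c J)"
    and "energy c (S - {t}) (J(s := J s + J t)) = energy c S J - (K \<bar>J s\<bar> + K \<bar>J t\<bar> - K \<bar>J s + J t\<bar>)
      + lam / 2 * ((J t)\<^sup>2 * (t - s) + 2 * J t * G c J)"
proof -
  have f: "finite S" and ab: "a < s" "t < b" using S s t by (auto simp: adm_def)
  have K: "(\<Sum>r\<in>S. K \<bar>J r\<bar>) = K \<bar>J s\<bar> + K \<bar>J t\<bar> + (\<Sum>r\<in>S - {s, t}. K \<bar>J r\<bar>)"
    using sum_remove_two[OF f s t] st by simp
  have Ks: "(\<Sum>r\<in>S - {s}. K \<bar>(J(t := J s + J t)) r\<bar>) = K \<bar>J s + J t\<bar> + (\<Sum>r\<in>S - {s, t}. K \<bar>J r\<bar>)"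
    using sum_remove_one[OF f s t, of "\<lambda>r v. K \<bar>v\<bar>"] st by simp
  have Kt: "(\<Sum>r\<in>S - {t}. K \<bar>(J(s := J s + J t)) r\<bar>) = K \<bar>J s + J t\<bar> + (\<Sum>r\<in>S - {s, t}. K \<bar>J r\<bar>)"
    using sum_remove_one[OF f t s, of "\<lambda>r v. K \<bar>v\<bar>"] st by (simp add: insert_commute)
  have F: "fid (stp c (S - {s}) (J(t := J s + J t))) = fid (stp c S J) + (- J s)\<^sup>2 * (t - s) + 2 * (- J s) * G c J"
    unfolding G_def fid_shift[OF ab(1) st ab(2) L_infinity_stp, symmetric]
    by (simp only: stp_merge_right[abs_def])
  have F': "fid (stp c (S - {t}) (J(s := J s + J t))) = fid (stp c S J) + (J t)\<^sup>2 * (t - s) + 2 * J t * G c J"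
    unfolding G_def fid_shift[OF ab(1) st ab(2) L_infinity_stp, symmetric]
    by (simp only: stp_merge_left[abs_def])
  show "energy c (S - {s}) (J(t := J s + J t)) = energy c S J - (K \<bar>J s\<bar> + K \<bar>J t\<bar> - K \<bar>J s + J t\<bar>)
      + lam / 2 * ((J s)\<^sup>2 * (t - s) - 2 * J s * G c J)"
    unfolding energy_def Ks F K by (simp add: algebra_simps)
  show "energy c (S - {t}) (J(s := J s + J t)) = energy c S J - (K \<bar>J s\<bar> + K \<bar>J t\<bar> - K \<bar>J s + J t\<bar>)
      + lam / 2 * ((J t)\<^sup>2 * (t - s) + 2 * J t * G c J)"
    unfolding energy_def Kt F' K by (simp add: algebra_simps)
qed

end

text \<open>
  On the facet between two adjacent jumps \<open>p\<close> and \<open>q\<close> the step function may be replaced by its left or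
  by its right neighbouring value. If \<open>p\<close> and \<open>q\<close> have the same sign, the average of the two
  replacements with weights \<open>|q|\<close> and \<open>|p|\<close> changes the fidelity only by the second-order term
  \<open>p q l\<close>; otherwise the facet is a local extremum, and it is moved to the nearer neighbour.
\<close>
lemma facet_length_ge:
  assumes pq: "p \<noteq> 0" "q \<noteq> 0" and l: "l > 0" and M: "M > 0"
    and C: "K2_const K M C" and cM: "K3w_const K M cM"
    and bounds: "\<bar>p\<bar> \<le> M" "\<bar>q\<bar> \<le> M" "\<bar>p + q\<bar> \<le> M"
    and G: "\<bar>G\<bar> \<le> M * l" "\<bar>G - p * l\<bar> \<le> M * l" "\<bar>G + q * l\<bar> \<le> M * l"
    and opt: "K \<bar>p\<bar> + K \<bar>q\<bar> - K \<bar>p + q\<bar> \<le> lam / 2 * (p\<^sup>2 * l - 2 * p * G)"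
      "K \<bar>p\<bar> + K \<bar>q\<bar> - K \<bar>p + q\<bar> \<le> lam / 2 * (q\<^sup>2 * l + 2 * q * G)"
  shows "min (cM / M) C \<le> lam * l"
proof (cases "p * q > 0")
  case True
  define k where "k = K \<bar>p\<bar> + K \<bar>q\<bar> - K \<bar>p + q\<bar>"
  have pq': "\<bar>p + q\<bar> = \<bar>p\<bar> + \<bar>q\<bar>" using True by (auto simp: zero_less_mult_iff)
  have "C * \<bar>p\<bar> * \<bar>q\<bar> \<le> k"
    using C[unfolded K2_const_def, THEN conjunct2, rule_format, of "\<bar>p\<bar>" "\<bar>q\<bar>"] bounds(3)
    by (simp add: k_def pq')
  then have "C * \<bar>p\<bar> * \<bar>q\<bar> * (\<bar>p\<bar> + \<bar>q\<bar>) \<le> k * (\<bar>p\<bar> + \<bar>q\<bar>)"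
    by (intro mult_right_mono) auto
  also have "\<dots> = \<bar>q\<bar> * k + \<bar>p\<bar> * k" by (simp add: algebra_simps)
  also have "\<dots> \<le> \<bar>q\<bar> * (lam / 2 * (p\<^sup>2 * l - 2 * p * G)) + \<bar>p\<bar> * (lam / 2 * (q\<^sup>2 * l + 2 * q * G))"
    unfolding k_def by (intro add_mono mult_left_mono opt) auto
  also have "\<dots> = lam / 2 * l * (\<bar>p\<bar> * \<bar>q\<bar> * (\<bar>p\<bar> + \<bar>q\<bar>))"
    using True by (auto simp: zero_less_mult_iff power2_eq_square algebra_simps)
  finally have "C * (\<bar>p\<bar> * \<bar>q\<bar> * (\<bar>p\<bar> + \<bar>q\<bar>)) \<le> lam / 2 * l * (\<bar>p\<bar> * \<bar>q\<bar> * (\<bar>p\<bar> + \<bar>q\<bar>))"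
    by (simp add: mult.assoc)
  then have "C \<le> lam / 2 * l"
    by (rule mult_right_le_imp_le) (use pq in \<open>auto intro!: mult_pos_pos add_pos_pos\<close>)
  also have "\<dots> \<le> lam * l" using lam l by simp
  finally show ?thesis by linarith
next
  case False
  then have neg: "p * q < 0" using pq by (auto simp: less_le not_less)
  \<comment> \<open>\<open>r\<close> is the shift of the facet and \<open>H\<close> the facet
    integral of the step function minus \<open>g\<close>, up to a common sign. Written as the sum of
    \<open>H\<close> and \<open>H + r * l\<close>, the factor \<open>2 * H + r * l\<close> is at
    most \<open>2 * (M * l)\<close>; separate bounds for \<open>H\<close> and \<open>r * l\<close>
    would give \<open>3 * (M * l)\<close>.\<close>
  have main: "cM / M \<le> lam * l"
    if r: "r \<noteq> 0" "\<bar>r\<bar> \<le> M" and H: "\<bar>H\<bar> \<le> M * l" "\<bar>H + r * l\<bar> \<le> M * l"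
      and gain: "K \<bar>r\<bar> \<le> lam / 2 * (r\<^sup>2 * l + 2 * r * H)" for r H
  proof -
    have "cM * \<bar>r\<bar> \<le> K \<bar>r\<bar>" using cM r(2) by (simp add: K3w_const_def)
    also have "\<dots> \<le> lam / 2 * (r * (H + (H + r * l)))"
      using gain by (simp add: power2_eq_square algebra_simps)
    also have "\<dots> \<le> lam / 2 * (\<bar>r\<bar> * (2 * (M * l)))"
    proof (rule mult_left_mono)
      have "r * (H + (H + r * l)) \<le> \<bar>r\<bar> * \<bar>H + (H + r * l)\<bar>"
        using abs_ge_self[of "r * (H + (H + r * l))"] by (simp add: abs_mult)
      also have "\<dots> \<le> \<bar>r\<bar> * (2 * (M * l))"
        using H by (intro mult_left_mono) linarith+
      finally show "r * (H + (H + r * l)) \<le> \<bar>r\<bar> * (2 * (M * l))" .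
    qed (use lam in simp)
    finally have "cM * \<bar>r\<bar> \<le> lam * l * M * \<bar>r\<bar>" by (simp add: algebra_simps)
    then have "cM \<le> lam * l * M" using r(1) by simp
    then show ?thesis using M by (simp add: divide_le_eq)
  qed
  have "cM / M \<le> lam * l"
  proof (cases "\<bar>q\<bar> \<le> \<bar>p\<bar>")
    case True
    then have "\<bar>p + q\<bar> \<le> \<bar>p\<bar>" using neg by (auto simp: mult_less_0_iff)
    then have "K \<bar>p + q\<bar> \<le> K \<bar>p\<bar>" by (intro K_mono) auto
    then show ?thesis
      using opt(2) by (intro main[OF pq(2) bounds(2) G(1,3)]) linarith
  next
    case False
    then have "\<bar>p + q\<bar> \<le> \<bar>q\<bar>" using neg by (auto simp: mult_less_0_iff)
    then have "K \<bar>p + q\<bar> \<le> K \<bar>q\<bar>" by (intro K_mono) auto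
    then have "K \<bar>- p\<bar> \<le> lam / 2 * ((- p)\<^sup>2 * l + 2 * (- p) * G)"
      using opt(1) by simp
    then show ?thesis
      using pq(1) bounds(1) G(1,2) by (intro main[of "- p" G]) auto
  qed
  then show ?thesis by linarith
qed

text \<open>Both merges remove a position, so minimality against configurations with fewer positions
  suffices. The facet value and its two neighbours lie in the range of \<open>g\<close>, so the
  facet integrals of these constants minus \<open>g\<close> are at most \<open>M\<close> times the
  length.\<close>

lemma jump_gap:
  assumes S: "adm S" and s: "s \<in> S" and t: "t \<in> S" and st: "s < t" "S \<inter> {s<..<t} = {}"
    and J: "J s \<noteq> 0" "J t \<noteq> 0"
    and opt: "\<And>S' J'. adm S' \<Longrightarrow> card S' < card S \<Longrightarrow> energy c S J \<le> energy c S' J'"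
    and range: "\<And>x. x \<in> {a..b} \<Longrightarrow> stp c S J x \<in> {g_inf..g_sup}"
    and M: "M > 0" "g_sup - g_inf \<le> M" and C: "K2_const K M C" and cM: "K3w_const K M cM"
  shows "min (cM / M) C \<le> lam * (t - s)"
proof -
  have f: "finite S" and ab: "a < s" "s < b" "a < t" "t < b" using S s t by (auto simp: adm_def)
  let ?V = "stp c S J"
  define h where "h = ?V s"
  define G where "G v = (LINT x|lebesgue_on {a<..<b}. indicator {s..<t} x * (v - g x))" for v
  have const: "?V x = h" if "x \<in> {s..<t}" for x
    unfolding h_def by (rule stp_eq_if_no_jump[symmetric]) (use that st(2) in force)+
  \<comment> \<open>The merged function does not jump at \<open>t\<close>; equality of its values at
    \<open>s\<close> and \<open>t\<close>, rewritten in terms of the original, gives the value after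
    the jump.\<close>
  have right: "?V t = h + J t"
  proof -
    let ?W = "stp c (S - {t}) (J(s := J s + J t))"
    have "?W s = ?W t" using st by (intro stp_eq_if_no_jump) (auto simp: set_eq_iff order_le_less)
    then show ?thesis using st(1) by (simp add: stp_merge_left[OF S s t st(1)] h_def)
  qed
  obtain y where y: "a \<le> y" "y < s" "S \<inter> {y<..<s} = {}"
    using ex_left_gap[OF f ab(1)] by blast
  have left: "?V y = h - J s"
  proof -
    let ?W = "stp c (S - {s}) (J(t := J s + J t))"
    have "?W y = ?W s" using y by (intro stp_eq_if_no_jump) (auto simp: set_eq_iff order_le_less)
    then show ?thesis using st(1) y(2) by (simp add: stp_merge_right[OF S s t st(1)] h_def)
  qed
  have in_range: "h \<in> {g_inf..g_sup}" "h + J t \<in> {g_inf..g_sup}" "h - J s \<in> {g_inf..g_sup}"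
    using range[of s] range[of t] range[of y] ab y by (auto simp: h_def[symmetric] left right)
  have G_shift: "G v = G h + (v - h) * (t - s)" for v
  proof -
    let ?i = "indicator {s..<t} :: real \<Rightarrow> real"
    have i: "?i \<in> L_infinity a b" by (rule L_infinity_indicator) simp
    have ih: "(\<lambda>x. ?i x * (h - g x)) \<in> L_infinity a b"
      by (intro L_infinity_mult L_infinity_diff L_infinity_const i g)
    have "G v = (LINT x|lebesgue_on {a<..<b}. ?i x * (h - g x) + (v - h) * ?i x)"
      unfolding G_def by (rule Bochner_Integration.integral_cong) (auto simp: algebra_simps)
    also have "\<dots> = G h + (v - h) * (t - s)"
      using L_infinity_integrable[OF i] L_infinity_integrable[OF ih] integral_indicator_Ico[OF ab(1) st(1) ab(4)]
      by (simp add: G_def)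
    finally show ?thesis .
  qed
  have G_le: "\<bar>G v\<bar> \<le> M * (t - s)" if "v \<in> {g_inf..g_sup}" for v
    unfolding G_def by (rule abs_integral_const_minus_g_le[OF ab(1) st(1) ab(4) that M(2)])
  have G_eq: "(LINT x|lebesgue_on {a<..<b}. indicator {s..<t} x * (?V x - g x)) = G h"
    unfolding G_def by (rule Bochner_Integration.integral_cong) (auto simp: indicator_def const)
  have adm': "adm (S - {r})" for r using S by (auto simp: adm_def)
  have card': "card (S - {r}) < card S" if "r \<in> S" for r
    using f that by (rule card_Diff1_less)
  show ?thesis
  proof (rule facet_length_ge[of "J s" "J t" "t - s" M C cM "G h"])
    show "K \<bar>J s\<bar> + K \<bar>J t\<bar> - K \<bar>J s + J t\<bar> \<le> lam / 2 * ((J s)\<^sup>2 * (t - s) - 2 * J s * G h)"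
      using opt[OF adm' card'[OF s], of "J(t := J s + J t)"]
      unfolding energy_merge(1)[OF S s t st(1)] G_eq by linarith
    show "K \<bar>J s\<bar> + K \<bar>J t\<bar> - K \<bar>J s + J t\<bar> \<le> lam / 2 * ((J t)\<^sup>2 * (t - s) + 2 * J t * G h)"
      using opt[OF adm' card'[OF t], of "J(s := J s + J t)"]
      unfolding energy_merge(2)[OF S s t st(1)] G_eq by linarith
    show "\<bar>G h - J s * (t - s)\<bar> \<le> M * (t - s)"
      using G_le[OF in_range(3)] G_shift[of "h - J s"] by simp
    show "\<bar>G h + J t * (t - s)\<bar> \<le> M * (t - s)"
      using G_le[OF in_range(2)] G_shift[of "h + J t"] by simp
  qed (use J st M C cM in_range G_le[OF in_range(1)] in auto)
qed

lemma card_jumps_le: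
  assumes S: "adm S" and J: "\<And>s. s \<in> S \<Longrightarrow> J s \<noteq> 0"
    and opt: "\<And>S' J'. adm S' \<Longrightarrow> card S' < card S \<Longrightarrow> energy c S J \<le> energy c S' J'"
    and range: "\<And>x. x \<in> {a..b} \<Longrightarrow> stp c S J x \<in> {g_inf..g_sup}"
    and M: "M > 0" "g_sup - g_inf \<le> M" and C: "K2_const K M C" and cM: "K3w_const K M cM"
  shows "int (card S) \<le> \<lfloor>(b - a) * lam / min (cM / M) C\<rfloor> + 1"
proof -
  define A where "A = min (cM / M) C"
  have A: "A > 0" using M C cM by (auto simp: A_def K2_const_def K3w_const_def)
  have f: "finite S" "S \<subseteq> {a<..<b}" using S by (auto simp: adm_def)
  have "(real (card S) - 1) * (A / lam) \<le> b - a"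
  proof (rule card_separated_le[OF f ab])
    fix s t assume st: "s \<in> S" "t \<in> S" "s < t"
    \<comment> \<open>\<open>jump_gap\<close> is about adjacent positions: \<open>t'\<close> is the
      successor of \<open>s\<close>, and \<open>t\<close> is at least as far away.\<close>
    define t' where "t' = Min (S \<inter> {s<..})"
    have fin: "finite (S \<inter> {s<..})" "S \<inter> {s<..} \<noteq> {}" using f st by auto
    have t': "t' \<in> S" "s < t'" using Min_in[OF fin] by (auto simp: t'_def)
    have le: "t' \<le> r" if "r \<in> S" "s < r" for r
      using Min_le[OF fin(1)] that by (auto simp: t'_def)
    have "A \<le> lam * (t' - s)"
      unfolding A_def
      by (rule jump_gap[OF S st(1) t'(1,2) _ J[OF st(1)] J[OF t'(1)] opt range M C cM]) (use le in force)+
    also have "\<dots> \<le> lam * (t - s)" using le[OF st(2,3)] lam by simp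
    finally show "A / lam \<le> t - s" using lam by (simp add: divide_le_eq mult.commute)
  qed (use A lam in simp)
  then have "real (card S) - 1 \<le> (b - a) * lam / A"
    using A lam by (simp add: field_simps)
  then have "int (card S) - 1 \<le> \<lfloor>(b - a) * lam / A\<rfloor>"
    by (intro le_floor_iff[THEN iffD2]) simp
  then show ?thesis by (simp add: A_def)
qed

end

section \<open>Minimizers with a bounded number of jumps\<close>

lemma AE_not_in_countable:
  assumes "countable A"
  shows "AE x in lebesgue_on {a<..<b::real}. x \<notin> A"
proof -
  have "AE x in lborel. x \<notin> A"
    by (rule AE_not_in[OF countable_imp_null_set_lborel[OF assms]])
  then have "AE x in lebesgue. x \<notin> A" by (rule AE_completion)
  then show ?thesis by (subst AE_restrict_space_iff) (auto elim: eventually_mono)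
qed

lemma convergent_subsequence_finitely_many:
  fixes X :: "nat \<Rightarrow> nat \<Rightarrow> 'a::heine_borel"
  assumes "\<And>i. bounded (range (\<lambda>k. X k i))"
  shows "\<exists>l r. strict_mono (r :: nat \<Rightarrow> nat) \<and> (\<forall>i<m. (\<lambda>k. X (r k) i) \<longlonglongrightarrow> l i)"
proof (induction m)
  case 0
  show ?case by (intro exI[of _ "\<lambda>x. undefined"] exI[of _ id]) (auto simp: strict_mono_def)
next
  case (Suc m)
  then obtain l r where lr: "strict_mono (r :: nat \<Rightarrow> nat)" "\<And>i. i < m \<Longrightarrow> (\<lambda>k. X (r k) i) \<longlonglongrightarrow> l i"
    by blast
  have "bounded (range (\<lambda>k. X (r k) m))"
    by (rule bounded_subset[OF assms[of m]]) auto
  then obtain l' r' where lr': "strict_mono (r' :: nat \<Rightarrow> nat)" "((\<lambda>k. X (r k) m) \<circ> r') \<longlonglongrightarrow> l'"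
    using bounded_imp_convergent_subsequence by blast
  have "(\<lambda>k. X ((r \<circ> r') k) i) \<longlonglongrightarrow> (l(m := l')) i" if "i < Suc m" for i
  proof (cases "i = m")
    case True
    with lr'(2) show ?thesis by (simp add: o_def)
  next
    case False
    with that have "i < m" by simp
    from LIMSEQ_subseq_LIMSEQ[OF lr(2)[OF this] lr'(1)] False show ?thesis by (simp add: o_def)
  qed
  moreover have "strict_mono (r \<circ> r')" using lr(1) lr'(1) by (rule strict_mono_o)
  ultimately show ?case by blast
qed

text \<open>Positions are indexed and may coincide or sit at \<open>a\<close> or \<open>b\<close>.
  In this form bounded parameters are closed under limits, unlike sets of at most \<open>n\<close>
  points of the open interval.\<close>

definition indexed_step :: "nat \<Rightarrow> real \<Rightarrow> (nat \<Rightarrow> real) \<Rightarrow> (nat \<Rightarrow> real) \<Rightarrow> real \<Rightarrow> real" where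
  "indexed_step n c p d x = c + (\<Sum>i<n. if p i \<le> x then d i else 0)"

lemma indexed_step_bounded:
  assumes "\<bar>c\<bar> \<le> B" "\<And>i. \<bar>d i\<bar> \<le> B"
  shows "\<bar>indexed_step n c p d x\<bar> \<le> B + real n * B"
proof -
  have B: "B \<ge> 0" using assms(1) by linarith
  have "\<bar>\<Sum>i<n. if p i \<le> x then d i else 0\<bar> \<le> (\<Sum>i<n. B)"
    by (rule order_trans[OF sum_abs sum_mono]) (use assms(2) B in auto)
  with assms(1) show ?thesis unfolding indexed_step_def by simp
qed

lemma L_infinity_indexed_step: "indexed_step n c p d \<in> L_infinity a b"
proof (rule L_infinity_bounded_borel)
  have "(\<lambda>x. if p i \<le> x then d i else 0) \<in> borel_measurable borel" for i
    by measurable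
  then show "indexed_step n c p d \<in> borel_measurable borel"
    unfolding indexed_step_def[abs_def] by (intro borel_measurable_add borel_measurable_sum) auto
  have "\<bar>\<Sum>i<n. if p i \<le> x then d i else 0\<bar> \<le> (\<Sum>i<n. \<bar>d i\<bar>)" for x
    by (rule order_trans[OF sum_abs sum_mono]) auto
  then show "\<bar>indexed_step n c p d x\<bar> \<le> \<bar>c\<bar> + (\<Sum>i<n. \<bar>d i\<bar>)" for x
    unfolding indexed_step_def using abs_triangle_ineq by (metis (no_types, lifting) add_left_mono order_trans)
qed

text \<open>Away from the limit positions every comparison of \<open>p k i\<close> with
  \<open>x\<close> is eventually constant in \<open>k\<close>.\<close>

lemma indexed_step_tendsto:
  assumes "c \<longlonglongrightarrow> c'" "\<And>i. i < n \<Longrightarrow> (\<lambda>k. p k i) \<longlonglongrightarrow> p' i" "\<And>i. i < n \<Longrightarrow> (\<lambda>k. d k i) \<longlonglongrightarrow> d' i"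
    and x: "x \<notin> p' ` {..<n}"
  shows "(\<lambda>k. indexed_step n (c k) (p k) (d k) x) \<longlonglongrightarrow> indexed_step n c' p' d' x"
  unfolding indexed_step_def
proof (intro tendsto_add tendsto_sum assms(1))
  fix i assume "i \<in> {..<n}"
  then have i: "i < n" by simp
  with x have "p' i \<noteq> x" by auto
  then consider "p' i < x" | "p' i > x" by linarith
  then show "(\<lambda>k. if p k i \<le> x then d k i else 0) \<longlonglongrightarrow> (if p' i \<le> x then d' i else 0)"
  proof cases
    case 1
    then have "\<forall>\<^sub>F k in sequentially. p k i < x" using assms(2)[OF i] by (intro order_tendstoD)
    then have "\<forall>\<^sub>F k in sequentially. d k i = (if p k i \<le> x then d k i else 0)"
      by eventually_elim simp
    from Lim_transform_eventually[OF assms(3)[OF i] this] 1 show ?thesis by simp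
  next
    case 2
    then have "\<forall>\<^sub>F k in sequentially. x < p k i" using assms(2)[OF i] by (intro order_tendstoD)
    then have "\<forall>\<^sub>F k in sequentially. 0 = (if p k i \<le> x then d k i else 0)"
      by eventually_elim simp
    from Lim_transform_eventually[OF tendsto_const this] 2 show ?thesis by simp
  qed
qed

context segmentation
begin

text \<open>Missing jumps are padded with height 0 at \<open>a\<close>, which is free since
  \<open>K 0 = 0\<close>.\<close>

lemma stp_eq_indexed_step:
  assumes S: "adm S" "card S \<le> n" and D: "\<And>s. s \<in> S \<Longrightarrow> \<bar>J s\<bar> \<le> D" "D \<ge> 0"
  shows "\<exists>p d. (\<forall>i. p i \<in> {a..b}) \<and> (\<forall>i. \<bar>d i\<bar> \<le> D) \<and> indexed_step n c p d = stp c S J \<and>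
    (\<Sum>i<n. K \<bar>d i\<bar>) = (\<Sum>s\<in>S. K \<bar>J s\<bar>)"
proof -
  have f: "finite S" "S \<subseteq> {a<..<b}" using S by (auto simp: adm_def)
  obtain h where h: "bij_betw h {..<card S} S"
    using ex_bij_betw_nat_finite[OF f(1)] by (auto simp: lessThan_atLeast0)
  have hS: "h i \<in> S" if "i < card S" for i
    using bij_betwE[OF h] that by simp
  define p where "p i = (if i < card S then h i else a)" for i
  define d where "d i = (if i < card S then J (h i) else 0)" for i
  have reindex: "(\<Sum>i<n. F (p i) (d i)) = (\<Sum>s\<in>S. F s (J s))" if "F a 0 = 0" for F :: "real \<Rightarrow> real \<Rightarrow> real"
  proof -
    have "(\<Sum>i<n. F (p i) (d i)) = (\<Sum>i<card S. F (p i) (d i))"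
      using S(2) that by (intro sum.mono_neutral_right) (auto simp: p_def d_def)
    also have "\<dots> = (\<Sum>i<card S. F (h i) (J (h i)))"
      by (rule sum.cong) (auto simp: p_def d_def)
    also have "\<dots> = (\<Sum>s\<in>S. F s (J s))"
      by (rule sum.reindex_bij_betw[OF h])
    finally show ?thesis .
  qed
  have "p i \<in> {a..b}" for i
    using hS f(2) ab by (auto simp: p_def less_imp_le subset_iff)
  moreover have "\<bar>d i\<bar> \<le> D" for i using hS D by (auto simp: d_def)
  moreover have "indexed_step n c p d = stp c S J"
    using reindex[of "\<lambda>s v. if s \<le> _ then v else 0"] by (simp add: fun_eq_iff indexed_step_def stp_def)
  moreover have "(\<Sum>i<n. K \<bar>d i\<bar>) = (\<Sum>s\<in>S. K \<bar>J s\<bar>)"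
    using reindex[of "\<lambda>s v. K \<bar>v\<bar>"] by (simp add: K_0)
  ultimately show ?thesis by blast
qed

text \<open>Heights at coinciding positions are added, which by subadditivity does not raise the
  cost. A jump at \<open>a\<close> is absorbed by the starting value, and one at \<open>b\<close> is
  invisible on \<open>(a,b)\<close>.\<close>

lemma indexed_step_eq_stp:
  assumes p: "\<And>i. i < n \<Longrightarrow> p i \<in> {a..b}"
  shows "\<exists>c' S J. adm S \<and> card S \<le> n \<and> (\<forall>x\<in>{a<..<b}. stp c' S J x = indexed_step n c p d x) \<and>
    (\<Sum>s\<in>S. K \<bar>J s\<bar>) \<le> (\<Sum>i<n. K \<bar>d i\<bar>)"
proof -
  define I where "I = {i. i < n \<and> p i \<in> {a<..<b}}"
  define S where "S = p ` I"
  define J where "J s = (\<Sum>i\<in>{i\<in>I. p i = s}. d i)" for s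
  define c' where "c' = c + (\<Sum>i\<in>{i. i < n \<and> p i = a}. d i)"
  have fI: "finite I" by (simp add: I_def)
  have S: "adm S" using fI by (auto simp: adm_def S_def I_def)
  have "card S \<le> card I" unfolding S_def by (rule card_image_le[OF fI])
  also have "\<dots> \<le> card {..<n}" by (rule card_mono) (auto simp: I_def)
  finally have card: "card S \<le> n" by simp
  have "stp c' S J x = indexed_step n c p d x" if x: "x \<in> {a<..<b}" for x
  proof -
    have "(\<Sum>s\<in>S. if s \<le> x then J s else 0) = (\<Sum>s\<in>S. \<Sum>i\<in>{i\<in>I. p i = s}. if p i \<le> x then d i else 0)"
      by (rule sum.cong[OF refl]) (auto simp: J_def intro!: sum.cong)
    also have "\<dots> = (\<Sum>i\<in>I. if p i \<le> x then d i else 0)"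
      using fI by (intro sum.group) (auto simp: S_def)
    finally have interior: "(\<Sum>s\<in>S. if s \<le> x then J s else 0) = (\<Sum>i\<in>I. if p i \<le> x then d i else 0)" .
    have "(\<Sum>i\<in>{i. i < n \<and> p i = a}. d i) = (\<Sum>i\<in>{i. i < n \<and> p i = a}. if p i \<le> x then d i else 0)"
      using x by (intro sum.cong) auto
    then have "(\<Sum>i\<in>{i. i < n \<and> p i = a}. d i) + (\<Sum>s\<in>S. if s \<le> x then J s else 0) =
        (\<Sum>i\<in>{i. i < n \<and> p i = a} \<union> I. if p i \<le> x then d i else 0)"
      unfolding interior using fI by (subst sum.union_disjoint) (auto simp: I_def)
    also have "\<dots> = (\<Sum>i<n. if p i \<le> x then d i else 0)"
    proof (rule sum.mono_neutral_left)
      show "\<forall>i\<in>{..<n} - ({i. i < n \<and> p i = a} \<union> I). (if p i \<le> x then d i else 0) = 0"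
      proof
        fix i assume "i \<in> {..<n} - ({i. i < n \<and> p i = a} \<union> I)"
        then have "i < n" "p i \<noteq> a" "\<not> p i < b \<or> \<not> a < p i" by (auto simp: I_def)
        with p[of i] have "p i = b" by auto
        with x show "(if p i \<le> x then d i else 0) = 0" by simp
      qed
    qed (auto simp: I_def)
    finally show ?thesis by (simp add: stp_def indexed_step_def c'_def)
  qed
  moreover have "(\<Sum>s\<in>S. K \<bar>J s\<bar>) \<le> (\<Sum>i<n. K \<bar>d i\<bar>)"
  proof -
    have "(\<Sum>s\<in>S. K \<bar>J s\<bar>) \<le> (\<Sum>s\<in>S. \<Sum>i\<in>{i\<in>I. p i = s}. K \<bar>d i\<bar>)"
      unfolding J_def using fI by (intro sum_mono K_abs_sum) auto
    also have "\<dots> = (\<Sum>i\<in>I. K \<bar>d i\<bar>)"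
      using fI by (intro sum.group) (auto simp: S_def)
    also have "\<dots> \<le> (\<Sum>i<n. K \<bar>d i\<bar>)"
      by (rule sum_mono2) (auto simp: I_def K_nonneg)
    finally show ?thesis .
  qed
  ultimately show ?thesis using S card by blast
qed

lemma fid_tendsto:
  assumes "\<And>k. V k \<in> L_infinity a b" "W \<in> L_infinity a b"
    and "\<And>k x. x \<in> {a<..<b} \<Longrightarrow> \<bar>V k x\<bar> \<le> B"
    and lim: "AE x in lebesgue_on {a<..<b}. (\<lambda>k. V k x) \<longlonglongrightarrow> W x"
  shows "(\<lambda>k. fid (V k)) \<longlonglongrightarrow> fid W"
proof -
  obtain C where C: "AE x in lebesgue_on {a<..<b}. \<bar>g x\<bar> \<le> C"
    using g by (auto simp: L_infinity_def)
  show ?thesis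
    unfolding fid_def
  proof (rule integral_dominated_convergence[where w = "\<lambda>x. (B + C)\<^sup>2"])
    show "AE x in lebesgue_on {a<..<b}. (\<lambda>k. (V k x - g x)\<^sup>2) \<longlonglongrightarrow> (W x - g x)\<^sup>2"
      using lim by eventually_elim (intro tendsto_power tendsto_diff tendsto_const)
    show "AE x in lebesgue_on {a<..<b}. norm ((V k x - g x)\<^sup>2) \<le> (B + C)\<^sup>2" for k
      using C AE_space
    proof eventually_elim
      case (elim x)
      then have "\<bar>V k x\<bar> \<le> B" using assms(3)[of x k] by simp
      then have "\<bar>V k x - g x\<bar> \<le> B + C" using elim(1) by linarith
      then have "\<bar>V k x - g x\<bar>\<^sup>2 \<le> (B + C)\<^sup>2" by (rule power_mono) simp
      then show ?case by simp
    qed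
    show "integrable (lebesgue_on {a<..<b}) (\<lambda>x. (B + C)\<^sup>2)"
      by (rule L_infinity_integrable[OF L_infinity_const])
  qed (use fid_integrable assms in auto)
qed

text \<open>The direct method in the parameters: clipping bounds a minimizing sequence, the fidelity
  converges along a subsequence by dominated convergence, and the jump cost is lower semicontinuous
  by (K1).\<close>

lemma ex_minimizer_card_le:
  "\<exists>c S J. adm S \<and> card S \<le> n \<and> (\<forall>c' S' J'. adm S' \<and> card S' \<le> n \<longrightarrow> energy c S J \<le> energy c' S' J')"
proof -
  define Ev where "Ev = {e. \<exists>c S J. adm S \<and> card S \<le> n \<and> e = energy c S J}"
  define I where "I = Inf Ev"
  have bdd: "bdd_below Ev" unfolding Ev_def using energy_nonneg by (auto intro!: bdd_belowI[of _ 0])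
  have "energy 0 {} (\<lambda>x. 0) \<in> Ev"
    unfolding Ev_def by (intro CollectI exI conjI) (auto simp: adm_def)
  then have ne: "Ev \<noteq> {}" by blast
  have I_le: "I \<le> energy c S J" if "adm S" "card S \<le> n" for c S J
    unfolding I_def by (rule cInf_lower[OF _ bdd]) (use that in \<open>auto simp: Ev_def\<close>)
  define F where "F c p d = (\<Sum>i<n. K \<bar>d i\<bar>) + lam / 2 * fid (indexed_step n c p d)" for c p d
  \<comment> \<open>One bound for all parameters: clipped start values and heights are controlled by
    the range of \<open>g\<close>, positions by the end points.\<close>
  define B where "B = max (\<bar>g_inf\<bar> + \<bar>g_sup\<bar>) (\<bar>a\<bar> + \<bar>b\<bar>)"
  have "\<exists>c p d. \<bar>c\<bar> \<le> B \<and> (\<forall>i. p i \<in> {a..b}) \<and> (\<forall>i. \<bar>d i\<bar> \<le> B) \<and> F c p d < I + inverse (Suc k)" for k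
  proof -
    have "I < I + inverse (Suc k)" by simp
    then obtain e where "e \<in> Ev" "e < I + inverse (Suc k)"
      unfolding I_def using cInf_lessD[OF ne] by blast
    then obtain c S J where S: "adm S" "card S \<le> n" "energy c S J < I + inverse (Suc k)"
      by (auto simp: Ev_def)
    obtain c' J' where cJ: "c' = clip g_inf g_sup c" "\<And>s. s \<in> S \<Longrightarrow> \<bar>J' s\<bar> \<le> g_sup - g_inf"
        "energy c' S J' \<le> energy c S J"
      using energy_clip[OF S(1), of c J] by metis
    have "\<bar>c'\<bar> \<le> B"
      using clip_in[OF g_inf_le_g_sup, of c] unfolding cJ(1) B_def by auto
    moreover have "\<bar>J' s\<bar> \<le> B" if "s \<in> S" for s
      using cJ(2)[OF that] by (auto simp: B_def)
    moreover have "B \<ge> 0" by (auto simp: B_def)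
    ultimately obtain p d where "\<forall>i. p i \<in> {a..b}" "\<forall>i. \<bar>d i\<bar> \<le> B" "indexed_step n c' p d = stp c' S J'"
      "(\<Sum>i<n. K \<bar>d i\<bar>) = (\<Sum>s\<in>S. K \<bar>J' s\<bar>)"
      using stp_eq_indexed_step[OF S(1,2), of J' B c'] by metis
    moreover from this have "F c' p d = energy c' S J'" by (simp add: F_def energy_def)
    ultimately show ?thesis using \<open>\<bar>c'\<bar> \<le> B\<close> cJ(3) S(3) by (metis le_less_trans)
  qed
  then obtain c p d where cpd: "\<And>k. \<bar>c k\<bar> \<le> B" "\<And>k i. p k i \<in> {a..b}" "\<And>k i. \<bar>d k i\<bar> \<le> B"
    "\<And>k. F (c k) (p k) (d k) < I + inverse (Suc k)"
    by metis
  have pB: "\<bar>p k i\<bar> \<le> B" for k i using cpd(2)[of k i] by (auto simp: B_def)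
  have bounded: "bounded (range (\<lambda>k. (p k i, d k i, c k)))" for i
    by (rule bounded_subset[of "cball 0 B \<times> cball 0 B \<times> cball 0 B"])
      (auto intro!: bounded_Times bounded_cball simp: cpd(1,3) pB)
  \<comment> \<open>The start value travels along in every coordinate; the extra index
    \<open>n\<close> provides its limit even if \<open>n = 0\<close>.\<close>
  obtain l r where r: "strict_mono (r :: nat \<Rightarrow> nat)"
    and l: "\<And>i. i < Suc n \<Longrightarrow> (\<lambda>k. (p (r k) i, d (r k) i, c (r k))) \<longlonglongrightarrow> l i"
    using convergent_subsequence_finitely_many[of "\<lambda>k i. (p k i, d k i, c k)" "Suc n", OF bounded] by blast
  define p' where "p' i = fst (l i)" for i
  define d' where "d' i = fst (snd (l i))" for i
  define c' where "c' = snd (snd (l n))"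
  have lim: "(\<lambda>k. p (r k) i) \<longlonglongrightarrow> p' i" "(\<lambda>k. d (r k) i) \<longlonglongrightarrow> d' i" if "i < n" for i
    using tendsto_fst[OF l[of i]] tendsto_fst[OF tendsto_snd[OF l[of i]]] that by (simp_all add: p'_def d'_def)
  have limc: "(\<lambda>k. c (r k)) \<longlonglongrightarrow> c'"
    using tendsto_snd[OF tendsto_snd[OF l[of n]]] by (simp add: c'_def)
  have p': "p' i \<in> {a..b}" if "i < n" for i
    using closed_sequentially[OF closed_atLeastAtMost _ lim(1)[OF that]] cpd(2) by blast
  have fid_lim: "(\<lambda>k. fid (indexed_step n (c (r k)) (p (r k)) (d (r k)))) \<longlonglongrightarrow> fid (indexed_step n c' p' d')"
  proof (rule fid_tendsto[where B = "B + real n * B"])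
    show "\<bar>indexed_step n (c (r k)) (p (r k)) (d (r k)) x\<bar> \<le> B + real n * B" for k x
      by (rule indexed_step_bounded) (rule cpd)+
    have "AE x in lebesgue_on {a<..<b}. x \<notin> p' ` {..<n}"
      by (rule AE_not_in_countable) (simp add: countable_finite)
    then show "AE x in lebesgue_on {a<..<b}.
        (\<lambda>k. indexed_step n (c (r k)) (p (r k)) (d (r k)) x) \<longlonglongrightarrow> indexed_step n c' p' d' x"
      by eventually_elim (rule indexed_step_tendsto[OF limc lim])
  qed (rule L_infinity_indexed_step)+
  have F_le: "F c' p' d' \<le> I"
  proof (rule field_le_epsilon)
    fix e :: real assume e: "e > 0"
    \<comment> \<open>One share for each of the \<open>n\<close> jump costs, one for the fidelity
      and one for the distance to the infimum.\<close>
    define \<delta> where "\<delta> = e / (real n + 2)"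
    have "(real n + 2) * \<delta> = e" unfolding \<delta>_def by simp
    then have \<delta>: "real n * \<delta> + \<delta> + \<delta> = e" by (simp add: algebra_simps)
    have \<delta>_pos: "\<delta> > 0"
      using e by (simp add: \<delta>_def)
    have "\<forall>\<^sub>F k in sequentially. \<forall>i\<in>{..<n}. K \<bar>d' i\<bar> - \<delta> < K \<bar>d (r k) i\<bar>"
    proof (rule eventually_ball_finite)
      show "\<forall>i\<in>{..<n}. \<forall>\<^sub>F k in sequentially. K \<bar>d' i\<bar> - \<delta> < K \<bar>d (r k) i\<bar>"
      proof
        fix i assume "i \<in> {..<n}"
        then have "(\<lambda>k. \<bar>d (r k) i\<bar>) \<longlonglongrightarrow> \<bar>d' i\<bar>" by (intro tendsto_rabs lim) simp
        then show "\<forall>\<^sub>F k in sequentially. K \<bar>d' i\<bar> - \<delta> < K \<bar>d (r k) i\<bar>"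
          by (rule K_eventually_greater) (use \<delta>_pos in simp_all)
      qed
    qed simp
    moreover have "(\<lambda>k. lam / 2 * fid (indexed_step n (c (r k)) (p (r k)) (d (r k)))) \<longlonglongrightarrow>
        lam / 2 * fid (indexed_step n c' p' d')"
      by (intro tendsto_mult tendsto_const fid_lim)
    then have "\<forall>\<^sub>F k in sequentially. lam / 2 * fid (indexed_step n c' p' d') - \<delta> <
        lam / 2 * fid (indexed_step n (c (r k)) (p (r k)) (d (r k)))"
      by (rule order_tendstoD(1)) (use \<delta>_pos in simp)
    moreover have "(\<lambda>k. inverse (real (Suc (r k)))) \<longlonglongrightarrow> 0"
      using LIMSEQ_subseq_LIMSEQ[OF LIMSEQ_inverse_real_of_nat r] by (simp add: o_def)
    then have "\<forall>\<^sub>F k in sequentially. inverse (real (Suc (r k))) < \<delta>"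
      using \<delta>_pos by (rule order_tendstoD(2))
    ultimately have "\<forall>\<^sub>F k in sequentially. F c' p' d' \<le> I + e"
    proof eventually_elim
      case (elim k)
      have "(\<Sum>i<n. K \<bar>d' i\<bar> - \<delta>) \<le> (\<Sum>i<n. K \<bar>d (r k) i\<bar>)"
        using elim(1) by (intro sum_mono) (auto intro: less_imp_le)
      then have "(\<Sum>i<n. K \<bar>d' i\<bar>) - real n * \<delta> \<le> (\<Sum>i<n. K \<bar>d (r k) i\<bar>)"
        by (simp add: sum_subtractf)
      with elim(2,3) cpd(4)[of "r k"] \<delta> show ?case
        unfolding F_def by linarith
    qed
    then show "F c' p' d' \<le> I + e" by simp
  qed
  obtain c'' S J where S: "adm S" "card S \<le> n" "\<forall>x\<in>{a<..<b}. stp c'' S J x = indexed_step n c' p' d' x"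
    "(\<Sum>s\<in>S. K \<bar>J s\<bar>) \<le> (\<Sum>i<n. K \<bar>d' i\<bar>)"
    using indexed_step_eq_stp[where n = n and p = p' and c = c' and d = d'] p' by metis
  have fid_eq: "fid (stp c'' S J) = fid (indexed_step n c' p' d')"
    by (rule fid_AE_cong) (use S(3) in \<open>auto intro!: AE_I2 L_infinity_stp L_infinity_indexed_step\<close>)
  then have "energy c'' S J \<le> I"
    using F_le S(4) unfolding F_def energy_def fid_eq by linarith
  with I_le S(1,2) show ?thesis by (metis order_trans)
qed

end

section \<open>Approximation of functions of bounded variation by step functions\<close>

text \<open>The default \<open>a\<close> makes the first increment start from \<open>W a\<close>,
  which is the starting value of the sampled step function.\<close>

definition pred_in :: "real \<Rightarrow> real set \<Rightarrow> real \<Rightarrow> real" where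
  "pred_in a T t = Max (insert a {s\<in>T. s < t})"

definition floor_in :: "real \<Rightarrow> real set \<Rightarrow> real \<Rightarrow> real" where
  "floor_in a T x = Max (insert a {s\<in>T. s \<le> x})"

lemma pred_in:
  assumes "finite T" "a < t"
  shows "pred_in a T t < t" "a \<le> pred_in a T t" "\<And>s. s \<in> T \<Longrightarrow> s < t \<Longrightarrow> s \<le> pred_in a T t"
  using assms by (auto simp: pred_in_def intro: Max_ge)

lemma floor_in:
  assumes "finite T" "a \<le> x"
  shows "floor_in a T x \<le> x" "a \<le> floor_in a T x" "\<And>s. s \<in> T \<Longrightarrow> s \<le> x \<Longrightarrow> s \<le> floor_in a T x"
  using assms by (auto simp: floor_in_def intro: Max_ge)

text \<open>The increments telescope up to the last grid point not exceeding
  \<open>x\<close>.\<close>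

lemma stp_floor_in:
  assumes "finite T" "\<And>t. t \<in> T \<Longrightarrow> a < t" "a \<le> x"
  shows "stp (W a) T (\<lambda>t. W t - W (pred_in a T t)) x = W (floor_in a T x)"
  using assms(1,2)
proof (induction T rule: finite_linorder_max_induct)
  case empty
  show ?case by (simp add: stp_def floor_in_def)
next
  case (insert t T)
  have eq: "pred_in a (insert t T) s = pred_in a T s" if "s \<in> T" for s
  proof -
    have "{r \<in> insert t T. r < s} = {r\<in>T. r < s}" using insert.hyps(2) that by force
    then show ?thesis by (simp add: pred_in_def)
  qed
  have "stp (W a) T (\<lambda>s. W s - W (pred_in a (insert t T) s)) = stp (W a) T (\<lambda>s. W s - W (pred_in a T s))"
    by (rule stp_cong) (simp add: eq)
  then have *: "stp (W a) (insert t T) (\<lambda>s. W s - W (pred_in a (insert t T) s)) x =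
      W (floor_in a T x) + (if t \<le> x then W t - W (pred_in a (insert t T) t) else 0)"
    using insert by (simp add: stp_insert_max)
  show ?case
  proof (cases "t \<le> x")
    case True
    have "{s \<in> insert t T. s < t} = {s \<in> T. s \<le> x}" using insert.hyps(2) True by force
    then have "pred_in a (insert t T) t = floor_in a T x" by (simp add: pred_in_def floor_in_def)
    moreover have "floor_in a (insert t T) x = t"
      unfolding floor_in_def using insert.hyps insert.prems True by (intro Max_eqI) (auto simp: less_imp_le)
    ultimately show ?thesis using True * by simp
  next
    case False
    then have "{s \<in> insert t T. s \<le> x} = {s \<in> T. s \<le> x}" by auto
    then show ?thesis using False * by (simp add: floor_in_def)
  qed
qed

lemma floor_in_tendsto:
  assumes fin: "\<And>n. finite (T n)" and "incseq T" and "a < x"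
    and dense: "\<And>r. r < x \<Longrightarrow> \<exists>n. \<exists>t\<in>T n. r < t \<and> t \<le> x"
  shows "(\<lambda>n. floor_in a (T n) x) \<longlonglongrightarrow> x"
proof (rule order_tendstoI)
  fix y assume "y < x"
  then obtain n t where t: "t \<in> T n" "y < t" "t \<le> x" using dense by blast
  show "\<forall>\<^sub>F m in sequentially. y < floor_in a (T m) x"
  proof (rule eventually_sequentiallyI)
    fix m assume "n \<le> m"
    then have "t \<in> T m" using \<open>incseq T\<close> t(1) by (auto simp: incseq_def)
    then show "y < floor_in a (T m) x" using floor_in(3)[OF fin, of a x t m] t \<open>a < x\<close> by simp
  qed
next
  fix y assume "x < y"
  then show "\<forall>\<^sub>F m in sequentially. floor_in a (T m) x < y"
    by (intro always_eventually allI le_less_trans[OF floor_in(1)[OF fin]]) (use \<open>a < x\<close> in auto)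
qed

text \<open>The open gaps in front of different grid points are disjoint, so no mass is counted
  twice.\<close>

lemma (in finite_borel_measure) sum_measure_gaps_le:
  assumes T: "finite T" "T \<subseteq> {a<..<b}" and "A \<in> sets borel"
    and A: "\<And>t. t \<in> T \<Longrightarrow> {pred_in a T t<..<t} \<subseteq> A"
  shows "(\<Sum>t\<in>T. measure M {pred_in a T t<..<t}) \<le> measure M A"
proof -
  have disj: "{pred_in a T s<..<s} \<inter> {pred_in a T t<..<t} = {}" if "s \<in> T" "t \<in> T" "s < t" for s t
  proof -
    have "s \<le> pred_in a T t" using pred_in(3)[OF T(1), of a t s] that T(2) by auto
    then show ?thesis by auto
  qed
  have "disjoint_family_on (\<lambda>t. {pred_in a T t<..<t}) T"
    unfolding disjoint_family_on_def
  proof (intro ballI impI)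
    fix s t assume "s \<in> T" "t \<in> T" "s \<noteq> t"
    then show "{pred_in a T s<..<s} \<inter> {pred_in a T t<..<t} = {}"
      using disj[of s t] disj[of t s] by (cases "s < t") (auto simp: Int_commute)
  qed
  then have "(\<Sum>t\<in>T. measure M {pred_in a T t<..<t}) = measure M (\<Union>t\<in>T. {pred_in a T t<..<t})"
    using T(1) by (intro finite_measure_finite_Union[symmetric]) auto
  also have "\<dots> \<le> measure M A"
    using A assms(3) by (intro finite_measure_mono) auto
  finally show ?thesis .
qed

definition shifted_cdf :: "real \<Rightarrow> real measure \<Rightarrow> real measure \<Rightarrow> real \<Rightarrow> real" where
  "shifted_cdf k P N x = k + pair_cdf P N x"

context segmentation
begin

context
  fixes P N :: "real measure" and k :: real
  assumes PN: "jordan_pair a b P N"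
begin

interpretation jordan_pair a b P N by (rule PN)
interpretation LP: finite_borel_measure "on_line P" by (rule P.finite_borel_measure_on_line)
interpretation LN: finite_borel_measure "on_line N" by (rule N.finite_borel_measure_on_line)

abbreviation W :: "real \<Rightarrow> real" where "W \<equiv> shifted_cdf k P N"

lemma W_L_infinity: "W \<in> L_infinity a b"
proof (rule L_infinity_bounded_borel)
  show "W \<in> borel_measurable borel" unfolding shifted_cdf_def[abs_def] by measurable
  show "\<bar>W x\<bar> \<le> \<bar>k\<bar> + (measure (on_line P) UNIV + measure (on_line N) UNIV)" for x
    unfolding shifted_cdf_def using pair_cdf_bounded[of x] by linarith
qed

lemma W_increment:
  assumes "p < t" "t \<in> {a<..<b}"
  shows "W t - W p = atom P N t + (measure (on_line P) {p<..<t} - measure (on_line N) {p<..<t})"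
proof -
  have split: "measure M {p<..t} = measure M {p<..<t} + measure M {t}" if "finite_borel_measure M" for M
  proof -
    interpret finite_borel_measure M by fact
    have "measure M ({p<..<t} \<union> {t}) = measure M {p<..<t} + measure M {t}"
      by (rule finite_measure_Union) auto
    also have "{p<..<t} \<union> {t} = {p<..t}" using assms(1) by auto
    finally show ?thesis .
  qed
  have "W t - W p = measure (on_line P) {p<..t} - measure (on_line N) {p<..t}"
    using LP.cdf_diff_eq[OF assms(1)] LN.cdf_diff_eq[OF assms(1)] by (simp add: shifted_cdf_def pair_cdf_def)
  then show ?thesis
    using split[OF LP.finite_borel_measure_axioms] split[OF LN.finite_borel_measure_axioms] assms(2)
    by (simp add: atom_def P.measure_on_line N.measure_on_line)
qed

text \<open>Each increment consists of the atom at \<open>t\<close> and the mass of the open gap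
  before it. Subadditivity separates the two: the atom keeps the price \<open>K\<close>, and the
  gap, which contains no grid point, is charged at most its total variation by
  \<open>K_le_self\<close>.\<close>

lemma sum_K_jumps_le:
  assumes T: "adm T"
  shows "(\<Sum>t\<in>T. K \<bar>W t - W (pred_in a T t)\<bar>) \<le>
    (\<Sum>t\<in>T. K \<bar>atom P N t\<bar>) + measure (on_line P) ({a<..<b} - T) + measure (on_line N) ({a<..<b} - T)"
proof -
  have f: "finite T" "T \<subseteq> {a<..<b}" using T by (auto simp: adm_def)
  let ?I = "\<lambda>t. {pred_in a T t<..<t}"
  have jump_le: "K \<bar>W t - W (pred_in a T t)\<bar> \<le> K \<bar>atom P N t\<bar> + (measure (on_line P) (?I t) + measure (on_line N) (?I t))"
    if "t \<in> T" for t
  proof -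
    have t: "t \<in> {a<..<b}" using that f by auto
    then have "pred_in a T t < t" by (intro pred_in f) auto
    from W_increment[OF this t]
    have "K \<bar>W t - W (pred_in a T t)\<bar> \<le> K \<bar>atom P N t\<bar> + K \<bar>measure (on_line P) (?I t) - measure (on_line N) (?I t)\<bar>"
      using K_abs_add by simp
    also have "K \<bar>measure (on_line P) (?I t) - measure (on_line N) (?I t)\<bar> \<le> \<bar>measure (on_line P) (?I t) - measure (on_line N) (?I t)\<bar>"
      by (rule K_le_self) simp
    also have "\<dots> \<le> measure (on_line P) (?I t) + measure (on_line N) (?I t)"
      using measure_nonneg[of "on_line P" "?I t"] measure_nonneg[of "on_line N" "?I t"] by linarith
    finally show ?thesis by simp
  qed
  have sub: "?I t \<subseteq> {a<..<b} - T" if "t \<in> T" for t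
  proof
    have t: "a < t" "t < b" using that f by auto
    fix x assume x: "x \<in> ?I t"
    then have "x \<notin> T" using pred_in(3)[OF f(1) t(1), of x] by auto
    with x t pred_in(2)[OF f(1) t(1)] show "x \<in> {a<..<b} - T" by auto
  qed
  have "{a<..<b} - T \<in> sets borel"
    using borel_closed[OF finite_imp_closed[OF f(1)]] by auto
  then have "(\<Sum>t\<in>T. measure (on_line P) (?I t)) \<le> measure (on_line P) ({a<..<b} - T)"
    "(\<Sum>t\<in>T. measure (on_line N) (?I t)) \<le> measure (on_line N) ({a<..<b} - T)"
    using LP.sum_measure_gaps_le[OF f _ sub] LN.sum_measure_gaps_le[OF f _ sub] by simp_all
  moreover have "(\<Sum>t\<in>T. K \<bar>W t - W (pred_in a T t)\<bar>) \<le>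
      (\<Sum>t\<in>T. K \<bar>atom P N t\<bar> + (measure (on_line P) (?I t) + measure (on_line N) (?I t)))"
    by (rule sum_mono[OF jump_le])
  ultimately show ?thesis by (simp add: sum.distrib)
qed

text \<open>Sampling on \<open>T n\<close> costs at most the energy of \<open>W\<close>, up to the
  error in the fidelity and the total variation of the jumps not yet in \<open>T n\<close>. The
  latter tends to 0 by continuity from above.\<close>

lemma energy_le_W:
  assumes E: "\<And>c S J. adm S \<Longrightarrow> E \<le> energy c S J"
    and u: "AE x in lebesgue_on {a<..<b}. u x = W x" "u \<in> borel_measurable (lebesgue_on {a<..<b})"
  shows "ennreal E \<le> TVg a b lam K g u"
proof -
  define D where "D = {x \<in> {a<..<b}. atom P N x \<noteq> 0}"
  define D' where "D' = {x. measure (on_line P) {x} > 0} \<union> {x. measure (on_line N) {x} > 0}"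
  have D': "countable D'" unfolding D'_def using LP.countable_atoms LN.countable_atoms by simp
  have "D \<subseteq> D'"
  proof
    fix x assume x: "x \<in> D"
    then have "measure (on_line P) {x} \<noteq> measure (on_line N) {x}"
      by (auto simp: D_def atom_def P.measure_on_line N.measure_on_line)
    then have "measure (on_line P) {x} > 0 \<or> measure (on_line N) {x} > 0"
      by (smt (verit) measure_nonneg)
    then show "x \<in> D'" by (simp add: D'_def)
  qed
  then have D: "countable D" using D' countable_subset by blast
  have Dm: "D \<in> sets borel" by (rule sets.countable[OF _ D]) simp
  \<comment> \<open>The jump points are included so that each of them is finally priced with
    \<open>K\<close>; the rationals make the grid dense, and nonempty when there is no jump.\<close>
  define Q where "Q = D \<union> (\<rat> \<inter> {a<..<b})"
  have Q: "countable Q" "Q \<subseteq> {a<..<b}"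
    using D countable_rat by (auto simp: Q_def D_def)
  obtain q0 where q0: "q0 \<in> \<rat>" "a < q0" "q0 < b" using Rats_dense_in_real[OF ab] by blast
  then have Qne: "Q \<noteq> {}" by (auto simp: Q_def)
  define T where "T n = from_nat_into Q ` {..n}" for n
  have T_sub: "T n \<subseteq> Q" for n unfolding T_def using from_nat_into[OF Qne] by auto
  have T: "adm (T n)" "finite (T n)" for n
  proof -
    show "finite (T n)" by (simp add: T_def)
    with subset_trans[OF T_sub Q(2)] show "adm (T n)" by (simp add: adm_def)
  qed
  have Tm: "T n \<in> sets borel" for n
    by (rule borel_closed[OF finite_imp_closed[OF T(2)]])
  have inc: "incseq T" by (auto simp: incseq_def T_def)
  have exhaust: "\<exists>n. x \<in> T n" if "x \<in> Q" for x
    using from_nat_into_surj[OF Q(1) that] by (auto simp: T_def)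
  define J where "J n t = W t - W (pred_in a (T n) t)" for n t
  define V where "V n = stp (W a) (T n) (J n)" for n
  have V: "V n x = W (floor_in a (T n) x)" if "x \<in> {a<..<b}" for n x
    unfolding V_def J_def by (rule stp_floor_in) (use T[of n] that in \<open>auto simp: adm_def\<close>)
  have fid_lim: "(\<lambda>n. fid (V n)) \<longlonglongrightarrow> fid W"
  proof (rule fid_tendsto[where B = "\<bar>k\<bar> + (measure (on_line P) UNIV + measure (on_line N) UNIV)"])
    show "V n \<in> L_infinity a b" for n unfolding V_def by (rule L_infinity_stp)
    show "\<bar>V n x\<bar> \<le> \<bar>k\<bar> + (measure (on_line P) UNIV + measure (on_line N) UNIV)" if "x \<in> {a<..<b}" for n x
      unfolding V[OF that] shifted_cdf_def using pair_cdf_bounded[of "floor_in a (T n) x"] by linarith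
    \<comment> \<open>Off the countably many atoms of both measures \<open>W\<close> is continuous,
      and the last grid points before \<open>x\<close> converge to \<open>x\<close>.\<close>
    show "AE x in lebesgue_on {a<..<b}. (\<lambda>n. V n x) \<longlonglongrightarrow> W x"
      using AE_not_in_countable[OF D'] AE_space
    proof eventually_elim
      case (elim x)
      then have x: "x \<in> {a<..<b}" "measure (on_line P) {x} = 0" "measure (on_line N) {x} = 0"
        using measure_nonneg[of "on_line P" "{x}"] measure_nonneg[of "on_line N" "{x}"] by (auto simp: D'_def)
      then have "isCont W x"
        unfolding shifted_cdf_def[abs_def] pair_cdf_def[abs_def]
        by (intro continuous_intros LP.isCont_cdf[THEN iffD2] LN.isCont_cdf[THEN iffD2])
      moreover have "(\<lambda>n. floor_in a (T n) x) \<longlonglongrightarrow> x"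
      proof (rule floor_in_tendsto[OF T(2) inc])
        show "a < x" using x by simp
        fix r assume "r < x"
        then have "max r a < x" using x by simp
        then obtain q where "q \<in> \<rat>" "max r a < q" "q < x" using Rats_dense_in_real by blast
        then have "q \<in> Q" "r < q" "q \<le> x" using x by (auto simp: Q_def)
        then show "\<exists>n. \<exists>t\<in>T n. r < t \<and> t \<le> x" using exhaust by blast
      qed
      ultimately have "(\<lambda>n. W (floor_in a (T n) x)) \<longlonglongrightarrow> W x"
        by (rule isCont_tendsto_compose)
      then show ?case using V x(1) by simp
    qed
  qed (rule W_L_infinity)
  have rest: "(\<lambda>n. measure M (D - T n)) \<longlonglongrightarrow> 0" if "finite_borel_measure M" for M
  proof -
    interpret M: finite_borel_measure M by fact
    have sets: "D - T n \<in> sets M" for n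
      using Dm Tm[of n] by (intro M.sets_M sets.Diff)
    have "decseq (\<lambda>n. D - T n)"
      unfolding decseq_def using inc by (intro allI impI Diff_mono) (auto simp: incseq_def)
    then have "(\<lambda>n. measure M (D - T n)) \<longlonglongrightarrow> measure M (\<Inter>n. D - T n)"
      using sets by (intro M.finite_Lim_measure_decseq) auto
    also have "(\<Inter>n. D - T n) = {}"
    proof (rule equals0I)
      fix x assume x: "x \<in> (\<Inter>n. D - T n)"
      then have "x \<in> Q" by (auto simp: Q_def)
      then obtain n where "x \<in> T n" using exhaust by blast
      with x show False by blast
    qed
    finally show ?thesis by simp
  qed
  have W_meas: "W \<in> borel_measurable (lebesgue_on {a<..<b})"
    using W_L_infinity by (simp add: L_infinity_def)
  have OD: "{a<..<b} - D \<in> sets borel" using Dm by auto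
  have on_line_eq: "emeasure P ({a<..<b} - D) = ennreal (measure (on_line P) ({a<..<b} - D))"
    "emeasure N ({a<..<b} - D) = ennreal (measure (on_line N) ({a<..<b} - D))"
  proof -
    have "({a<..<b} - D) \<inter> {a<..<b} = {a<..<b} - D" by auto
    then show "emeasure P ({a<..<b} - D) = ennreal (measure (on_line P) ({a<..<b} - D))"
      "emeasure N ({a<..<b} - D) = ennreal (measure (on_line N) ({a<..<b} - D))"
      using P.emeasure_on_line[OF OD] N.emeasure_on_line[OF OD]
      by (simp_all add: LP.emeasure_eq_measure LN.emeasure_eq_measure)
  qed
  have TV: "TV a b K W = ennreal (measure (on_line P) ({a<..<b} - D)) + ennreal (measure (on_line N) ({a<..<b} - D)) +
      (\<Sum>\<^sub>\<infinity>x\<in>D. ennreal (K \<bar>atom P N x\<bar>))"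
  proof -
    have "AE x in lebesgue_on {a<..<b}. W x = k + pair_cdf P N x" by (simp add: shifted_cdf_def)
    from TV_eq[OF this W_meas, of K, folded D_def] show ?thesis by (simp only: on_line_eq)
  qed
  define \<epsilon> where "\<epsilon> n = measure (on_line P) (D - T n) + measure (on_line N) (D - T n)" for n
  \<comment> \<open>The estimate and its limit are taken in \<open>ennreal\<close>, so finiteness of
    the jump sum need not be known beforehand.\<close>
  have bound: "ennreal E \<le> TV a b K W + ennreal (\<epsilon> n) + ennreal (lam / 2 * fid (V n))" for n
  proof -
    have sub: "measure M ({a<..<b} - T n) \<le> measure M ({a<..<b} - D) + measure M (D - T n)"
      if "finite_borel_measure M" for M
    proof -
      interpret M: finite_borel_measure M by fact
      have s: "{a<..<b} - D \<in> sets M" "D - T n \<in> sets M"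
        using Dm Tm[of n] by (auto intro!: M.sets_M)
      have "measure M ({a<..<b} - T n) \<le> measure M (({a<..<b} - D) \<union> (D - T n))"
        using s by (intro M.finite_measure_mono) auto
      also have "\<dots> \<le> measure M ({a<..<b} - D) + measure M (D - T n)"
        by (rule measure_Un_le[OF s])
      finally show ?thesis .
    qed
    define \<kappa> where "\<kappa> = (\<Sum>t\<in>T n. K \<bar>atom P N t\<bar>)"
    have \<kappa>0: "\<kappa> \<ge> 0" unfolding \<kappa>_def by (intro sum_nonneg K_nonneg) simp
    have "E \<le> energy (W a) (T n) (J n)" by (rule E[OF T(1)])
    also have "\<dots> \<le> \<kappa> + measure (on_line P) ({a<..<b} - D) + measure (on_line N) ({a<..<b} - D) + \<epsilon> n + lam / 2 * fid (V n)"
      using sum_K_jumps_le[OF T(1)[of n]] sub[OF LP.finite_borel_measure_axioms] sub[OF LN.finite_borel_measure_axioms]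
      unfolding energy_def V_def J_def \<kappa>_def \<epsilon>_def by linarith
    finally have "ennreal E \<le> ennreal (\<kappa> + measure (on_line P) ({a<..<b} - D) + measure (on_line N) ({a<..<b} - D) + \<epsilon> n + lam / 2 * fid (V n))"
      by (rule ennreal_leI)
    also have "\<dots> = ennreal \<kappa> + ennreal (measure (on_line P) ({a<..<b} - D)) + ennreal (measure (on_line N) ({a<..<b} - D)) +
        ennreal (\<epsilon> n) + ennreal (lam / 2 * fid (V n))"
      using \<kappa>0 lam fid_nonneg by (simp add: ennreal_plus \<epsilon>_def)
    \<comment> \<open>Grid points outside \<open>D\<close> have atom 0. What remains is one of the
      finite sums whose supremum is the infinite sum.\<close>
    also have "ennreal \<kappa> \<le> (\<Sum>\<^sub>\<infinity>x\<in>D. ennreal (K \<bar>atom P N x\<bar>))"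
    proof -
      have "\<kappa> = (\<Sum>t\<in>T n \<inter> D. K \<bar>atom P N t\<bar>)"
        unfolding \<kappa>_def using T[of n] K_0 by (intro sum.mono_neutral_right) (auto simp: D_def adm_def)
      then have "ennreal \<kappa> = (\<Sum>t\<in>T n \<inter> D. ennreal (K \<bar>atom P N t\<bar>))"
        by (simp add: sum_ennreal K_nonneg)
      also have "\<dots> \<le> (\<Sum>\<^sub>\<infinity>x\<in>D. ennreal (K \<bar>atom P N x\<bar>))"
        using T(2)[of n] by (subst nonneg_infsum_complete) (auto intro!: SUP_upper)
      finally show ?thesis .
    qed
    finally show ?thesis by (simp add: TV ac_simps add_mono)
  qed
  have "(\<lambda>n. TV a b K W + ennreal (\<epsilon> n) + ennreal (lam / 2 * fid (V n))) \<longlonglongrightarrow>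
      TV a b K W + ennreal (0 + 0) + ennreal (lam / 2 * fid W)"
    unfolding \<epsilon>_def
    by (intro tendsto_add tendsto_const tendsto_ennrealI tendsto_mult fid_lim
        rest LP.finite_borel_measure_axioms LN.finite_borel_measure_axioms)
  then have "ennreal E \<le> TV a b K W + ennreal (0 + 0) + ennreal (lam / 2 * fid W)"
    by (rule LIMSEQ_le_const) (use bound in blast)
  also have "\<dots> = TVg a b lam K g W"
    by (simp add: TVg_eq[OF W_L_infinity])
  also have "\<dots> = TVg a b lam K g u"
    by (rule TVg_cong[OF u(1) u(2) W_meas, symmetric])
  finally show ?thesis .
qed

end

end

section \<open>The minimization problem\<close>

lemma stp_remove_zeros: "finite S \<Longrightarrow> stp c {s\<in>S. J s \<noteq> 0} J = stp c S J"
  by (auto simp: stp_def fun_eq_iff intro!: sum.mono_neutral_left split: if_splits)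

lemma (in jump_density) ex_K3w_const:
  assumes "M > 0"
  shows "\<exists>c. K3w_const K M c"
proof -
  have "\<forall>\<^sub>F \<rho> in at_right 0. 1 / 2 < K \<rho> / \<rho>"
    using K3 unfolding K3_def by (rule order_tendstoD(1)) simp
  then obtain \<delta> where \<delta>: "\<delta> > 0" "\<And>\<rho>. 0 < \<rho> \<Longrightarrow> \<rho> < \<delta> \<Longrightarrow> 1 / 2 < K \<rho> / \<rho>"
    unfolding eventually_at_right_field by blast
  \<comment> \<open>Below \<open>\<delta>\<close> the slope 1/2 is enough. From
    \<open>\<delta>\<close> on, monotonicity gives
    \<open>K \<rho> \<ge> K (\<delta> / 2) > \<delta> / 4\<close>, and the second entry keeps
    \<open>c * \<rho>\<close> at or below \<open>\<delta> / 4\<close> up to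
    \<open>M\<close>.\<close>
  define c where "c = min (1 / 2) (\<delta> / (4 * M))"
  have c: "c > 0" "c \<le> 1 / 2" "c * M \<le> \<delta> / 4"
    using \<delta>(1) assms by (auto simp: c_def min_def field_simps)
  have "c * \<rho> \<le> K \<rho>" if \<rho>: "\<rho> \<in> {0..M}" for \<rho>
  proof -
    consider "\<rho> = 0" | "0 < \<rho>" "\<rho> < \<delta>" | "\<delta> \<le> \<rho>" using \<rho> by force
    then show ?thesis
    proof cases
      case 1
      then show ?thesis by (simp add: K_0)
    next
      case 2
      then have "1 / 2 * \<rho> < K \<rho>" using \<delta>(2)[of \<rho>] by (simp add: field_simps)
      moreover have "c * \<rho> \<le> 1 / 2 * \<rho>" using c(2) 2 by (intro mult_right_mono) auto
      ultimately show ?thesis by linarith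
    next
      case 3
      have "c * \<rho> \<le> c * M" using c(1) \<rho> by simp
      also have "\<dots> \<le> \<delta> / 4" by (rule c(3))
      also have "\<dots> < K (\<delta> / 2)" using \<delta>(2)[of "\<delta> / 2"] \<delta>(1) by (simp add: field_simps)
      also have "\<dots> \<le> K \<rho>" using 3 \<delta>(1) by (intro K_mono) auto
      finally show ?thesis by simp
    qed
  qed
  with c(1) show ?thesis by (auto simp: K3w_const_def)
qed

context segmentation
begin

lemma energy_remove_zeros:
  assumes "finite S"
  shows "energy c {s\<in>S. J s \<noteq> 0} J = energy c S J"
proof -
  have "(\<Sum>s\<in>{s\<in>S. J s \<noteq> 0}. K \<bar>J s\<bar>) = (\<Sum>s\<in>S. K \<bar>J s\<bar>)"
    using assms K_0 by (intro sum.mono_neutral_left) auto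
  then show ?thesis by (simp add: energy_def stp_remove_zeros[OF assms])
qed

lemma minimal_range:
  assumes S: "adm S"
    and opt: "\<And>c' S' J'. adm S' \<Longrightarrow> card S' \<le> card S \<Longrightarrow> energy c S J \<le> energy c' S' J'"
    and x: "x \<in> {a..b}"
  shows "stp c S J x \<in> {g_inf..g_sup}"
proof (rule energy_clip[OF S, of c J])
  fix c' J' assume le: "energy c' S J' \<le> energy c S J"
    and imp: "\<And>x. energy c' S J' = energy c S J \<Longrightarrow> x \<in> {a..b} \<Longrightarrow> stp c S J x \<in> {g_inf..g_sup}"
  have "energy c' S J' = energy c S J"
    using le opt[OF S order_refl, of c' J'] by linarith
  from imp[OF this x] show ?thesis .
qed

lemma ex_minimal_energy:
  "\<exists>c S J. adm S \<and> (\<forall>c' S' J'. adm S' \<longrightarrow> energy c S J \<le> energy c' S' J')"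
proof -
  \<comment> \<open>The summand 1 keeps \<open>M\<close> positive when \<open>g\<close> is
    essentially constant.\<close>
  define M where "M = g_sup - g_inf + 1"
  have M: "M > 0" "g_sup - g_inf \<le> M" using g_inf_le_g_sup by (auto simp: M_def)
  obtain C where C: "K2_const K M C" using K2 M(1) by (auto simp: K2_def)
  obtain cM where cM: "K3w_const K M cM" using ex_K3w_const[OF M(1)] by blast
  define n where "n = nat (\<lfloor>(b - a) * lam / min (cM / M) C\<rfloor> + 1)"
  obtain c S J where S: "adm S" "card S \<le> n"
    "\<And>c' S' J'. adm S' \<Longrightarrow> card S' \<le> n \<Longrightarrow> energy c S J \<le> energy c' S' J'"
    using ex_minimizer_card_le[of n] by blast
  have "energy c S J \<le> energy c' S' J'" if S': "adm S'" for c' S' J'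
  proof -
    obtain c2 S2 J2 where S2: "adm S2" "card S2 \<le> card S'"
      "\<And>c3 S3 J3. adm S3 \<Longrightarrow> card S3 \<le> card S' \<Longrightarrow> energy c2 S2 J2 \<le> energy c3 S3 J3"
      using ex_minimizer_card_le[of "card S'"] by blast
    have fin: "finite S2" using S2(1) by (simp add: adm_def)
    \<comment> \<open>The jump bound counts nonzero heights only. Dropping the zeros keeps the
      energy, and minimality persists against all counts up to \<open>card S4\<close>, which does
      not exceed \<open>card S'\<close>.\<close>
    define S4 where "S4 = {s\<in>S2. J2 s \<noteq> 0}"
    have S4: "adm S4" "card S4 \<le> card S2"
      using S2(1) card_mono[OF fin, of S4] by (auto simp: adm_def S4_def)
    have eq: "energy c2 S4 J2 = energy c2 S2 J2"
      unfolding S4_def by (rule energy_remove_zeros[OF fin])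
    have opt: "energy c2 S4 J2 \<le> energy c3 S3 J3" if "adm S3" "card S3 \<le> card S4" for c3 S3 J3
      unfolding eq using that S2(2) S4(2) by (intro S2(3)) auto
    have "int (card S4) \<le> \<lfloor>(b - a) * lam / min (cM / M) C\<rfloor> + 1"
    proof (rule card_jumps_le[OF S4(1) _ _ _ M C cM])
      show "J2 s \<noteq> 0" if "s \<in> S4" for s using that by (simp add: S4_def)
      show "energy c2 S4 J2 \<le> energy c2 S3 J3" if "adm S3" "card S3 < card S4" for S3 J3
        using that by (intro opt) auto
      show "stp c2 S4 J2 x \<in> {g_inf..g_sup}" if "x \<in> {a..b}" for x
        by (rule minimal_range[OF S4(1) opt that])
    qed
    then have "card S4 \<le> n" by (simp add: n_def le_nat_iff)
    then have "energy c S J \<le> energy c2 S4 J2" by (rule S(3)[OF S4(1)])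
    also have "\<dots> \<le> energy c' S' J'" unfolding eq by (rule S2(3)[OF S' order_refl])
    finally show ?thesis .
  qed
  with S(1) show ?thesis by blast
qed

lemma step_representative_stp:
  assumes "adm S" "AE x in lebesgue_on {a<..<b}. stp c S J x = u x"
  shows "step_representative a b u (stp c S J)"
  unfolding step_representative_def
proof (intro conjI exI[of _ S] allI impI)
  show "finite S" "S \<subseteq> {a<..<b}" using assms(1) by (auto simp: adm_def)
  fix x y assume "a \<le> x \<and> x \<le> y \<and> y \<le> b \<and> {x..y} \<inter> S = {}"
  moreover have "{x<..y} \<subseteq> {x..y}" by auto
  ultimately have "x \<le> y" "S \<inter> {x<..y} = {}" by (simp, blast)
  then show "stp c S J x = stp c S J y" by (rule stp_eq_if_no_jump)
qed (rule assms(2))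

lemma ex_piecewise_constant_minimizer:
  "\<exists>U. piecewise_constant a b U \<and> TVg_minimizer a b lam K g U"
proof -
  obtain c S J where S: "adm S" and opt: "\<And>c' S' J'. adm S' \<Longrightarrow> energy c S J \<le> energy c' S' J'"
    using ex_minimal_energy by blast
  have "step_representative a b (stp c S J) (stp c S J)"
    by (rule step_representative_stp[OF S]) simp
  then have "piecewise_constant a b (stp c S J)"
    unfolding piecewise_constant_def by (rule exI[of _ "stp c S J"])
  moreover have "TVg a b lam K g (stp c S J) \<le> TVg a b lam K g v" if "v \<in> BV a b" for v
  proof -
    obtain P N where v: "integrable (lebesgue_on {a<..<b}) v" "distributional_derivative a b v (P, N)"
    proof -
      obtain PN where "distributional_derivative a b v PN" using \<open>v \<in> BV a b\<close> by (auto simp: BV_def)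
      moreover have "integrable (lebesgue_on {a<..<b}) v" using \<open>v \<in> BV a b\<close> by (simp add: BV_def)
      ultimately show thesis by (intro that[of "fst PN" "snd PN"]) simp_all
    qed
    then have PN: "jordan_pair a b P N" by (simp add: distributional_derivative_iff)
    obtain k where k: "AE x in lebesgue_on {a<..<b}. v x = k + pair_cdf P N x"
      using BV_representation[OF ab v] by blast
    have "ennreal (energy c S J) \<le> TVg a b lam K g v"
    proof (rule energy_le_W[OF PN, where k = k])
      show "energy c S J \<le> energy c' S' J'" if "adm S'" for c' S' J' by (rule opt[OF that])
      show "AE x in lebesgue_on {a<..<b}. v x = shifted_cdf k P N x"
        using k by (simp add: shifted_cdf_def)
      show "v \<in> borel_measurable (lebesgue_on {a<..<b})" using v(1) by simp
    qed
    then show ?thesis by (simp add: TVg_stp[OF S])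
  qed
  moreover have "stp c S J \<in> BV a b" using S by (intro stp_BV[OF ab]) (auto simp: adm_def)
  ultimately show ?thesis unfolding TVg_minimizer_def by (intro exI[of _ "stp c S J"]) simp
qed

text \<open>A given representative may take any value at its exceptional points, so the range is
  claimed for its step form \<open>stp (V a) S J\<close>. Minimality in \<open>BV\<close> makes this
  form minimal among all step functions, and then clipping and merging apply to it.\<close>

lemma minimizer_properties:
  assumes M: "M > 0" "ereal M \<ge> ess_sup_on a b g - ess_inf_on a b g"
    and C: "K2_const K M C" and cM: "K3w_const K M cM"
    and U: "piecewise_constant a b U" "TVg_minimizer a b lam K g U"
  shows "(\<exists>V. step_representative a b U V \<and>
      (\<forall>x\<in>{a..b}. ess_inf_on a b g \<le> ereal (V x) \<and> ereal (V x) \<le> ess_sup_on a b g)) \<and>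
    finite (jump_set a b U) \<and>
    int (card (jump_set a b U)) \<le> \<lfloor>(b - a) * lam / min (cM / M) C\<rfloor> + 1"
proof -
  obtain V where V: "step_representative a b U V"
    using U(1) by (auto simp: piecewise_constant_def)
  then have "\<exists>S. finite S \<and> S \<subseteq> {a<..<b} \<and>
      (\<forall>x y. a \<le> x \<and> x \<le> y \<and> y \<le> b \<and> {x..y} \<inter> S = {} \<longrightarrow> V x = V y)"
    unfolding step_representative_def by (rule conjunct2)
  then obtain S0 where S0_const: "finite S0 \<and> S0 \<subseteq> {a<..<b} \<and>
      (\<forall>x y. a \<le> x \<and> x \<le> y \<and> y \<le> b \<and> {x..y} \<inter> S0 = {} \<longrightarrow> V x = V y)" ..
  note S0 = S0_const[THEN conjunct1] S0_const[THEN conjunct2, THEN conjunct1]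
  have const: "V x = V y" if "a \<le> x" "x \<le> y" "y \<le> b" "{x..y} \<inter> S0 = {}" for x y
    using S0_const[THEN conjunct2, THEN conjunct2, rule_format, of x y] that by blast
  have V_eq: "AE x in lebesgue_on {a<..<b}. V x = U x"
    using V by (simp add: step_representative_def)
  have "\<exists>J. \<forall>x\<in>{a..b} - S0. V x = stp (V a) S0 J x"
    by (rule locally_constant_eq_stp[OF S0 const])
  then obtain J where J: "\<forall>x\<in>{a..b} - S0. V x = stp (V a) S0 J x" ..
  \<comment> \<open>With the zero heights removed, \<open>S\<close> is exactly the jump set of
    \<open>U\<close>.\<close>
  define S where "S = {s\<in>S0. J s \<noteq> 0}"
  have S: "adm S" using S0 by (auto simp: adm_def S_def)
  have stp_eq: "stp (V a) S J = stp (V a) S0 J" unfolding S_def by (rule stp_remove_zeros[OF S0(1)])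
  have ae: "AE x in lebesgue_on {a<..<b}. stp (V a) S J x = U x"
    using V_eq AE_not_in_countable[OF countable_finite[OF S0(1)]] AE_space
  proof eventually_elim
    case (elim x)
    then have "x \<in> {a..b} - S0" by auto
    with J elim(1) show ?case by (simp add: stp_eq)
  qed
  have U_meas: "U \<in> borel_measurable (lebesgue_on {a<..<b})"
    using U(2) by (auto simp: TVg_minimizer_def BV_def)
  have stp_meas: "stp c S' J' \<in> borel_measurable (lebesgue_on {a<..<b})" for c S' J'
    using L_infinity_stp[of c S' J' a b] by (simp add: L_infinity_def)
  have opt: "energy (V a) S J \<le> energy c' S' J'" if "adm S'" for c' S' J'
  proof -
    have "ennreal (energy (V a) S J) = TVg a b lam K g U"
      using TVg_cong[OF ae stp_meas U_meas, of lam K g] by (simp add: TVg_stp[OF S])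
    also have "\<dots> \<le> TVg a b lam K g (stp c' S' J')"
    proof -
      have "stp c' S' J' \<in> BV a b" using that by (intro stp_BV[OF ab]) (auto simp: adm_def)
      then show ?thesis using U(2) by (simp add: TVg_minimizer_def)
    qed
    also have "\<dots> = ennreal (energy c' S' J')" by (rule TVg_stp[OF that])
    finally show ?thesis using energy_nonneg by (simp add: ennreal_le_iff)
  qed
  have range: "stp (V a) S J x \<in> {g_inf..g_sup}" if "x \<in> {a..b}" for x
    by (rule minimal_range[OF S opt that])
  have M': "g_sup - g_inf \<le> M" using M(2) by (simp add: ess_sup_eq ess_inf_eq)
  have "jump_set a b U = jump_set a b (stp (V a) S J)" by (rule jump_set_cong[OF ae, symmetric])
  also have "\<dots> = S" using S by (subst jump_set_stp[OF ab]) (auto simp: adm_def S_def)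
  finally have jumps: "jump_set a b U = S" .
  have "int (card S) \<le> \<lfloor>(b - a) * lam / min (cM / M) C\<rfloor> + 1"
    by (rule card_jumps_le[OF S _ opt range M(1) M' C cM]) (auto simp: S_def)
  moreover have "\<forall>x\<in>{a..b}. ess_inf_on a b g \<le> ereal (stp (V a) S J x) \<and> ereal (stp (V a) S J x) \<le> ess_sup_on a b g"
    using range by (auto simp: ess_sup_eq ess_inf_eq)
  ultimately show ?thesis
    using step_representative_stp[OF S ae] S by (auto simp: jumps adm_def)
qed

end

theorem corollary1p5:
  fixes a b lam :: real and K g :: "real \<Rightarrow> real"
  assumes "a < b" and "lam > 0"
    and "\<forall>\<rho>\<ge>0. K \<rho> \<ge> 0" and "K1 K" and "K2 K" and "K3 K"
    and "g \<in> L_infinity a b"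
  shows "(\<exists>U. piecewise_constant a b U \<and> TVg_minimizer a b lam K g U) \<and>
    (\<forall>M C\<^sub>M c\<^sub>M U.
       M > 0 \<and> ereal M \<ge> ess_sup_on a b g - ess_inf_on a b g \<and>
       K2_const K M C\<^sub>M \<and> K3w_const K M c\<^sub>M \<and>
       piecewise_constant a b U \<and> TVg_minimizer a b lam K g U \<longrightarrow>
         (\<exists>V. step_representative a b U V \<and>
              (\<forall>x\<in>{a..b}. ess_inf_on a b g \<le> ereal (V x) \<and> ereal (V x) \<le> ess_sup_on a b g)) \<and>
         finite (jump_set a b U) \<and>
         int (card (jump_set a b U)) \<le> \<lfloor>(b - a) * lam / min (c\<^sub>M / M) C\<^sub>M\<rfloor> + 1)"
proof -
  interpret segmentation K a b lam g
    using assms by unfold_locales auto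
  show ?thesis
  proof (intro conjI[OF ex_piecewise_constant_minimizer] allI impI)
    fix M C\<^sub>M c\<^sub>M U
    assume "M > 0 \<and> ereal M \<ge> ess_sup_on a b g - ess_inf_on a b g \<and>
       K2_const K M C\<^sub>M \<and> K3w_const K M c\<^sub>M \<and>
       piecewise_constant a b U \<and> TVg_minimizer a b lam K g U"
    then show "(\<exists>V. step_representative a b U V \<and>
              (\<forall>x\<in>{a..b}. ess_inf_on a b g \<le> ereal (V x) \<and> ereal (V x) \<le> ess_sup_on a b g)) \<and>
         finite (jump_set a b U) \<and>
         int (card (jump_set a b U)) \<le> \<lfloor>(b - a) * lam / min (c\<^sub>M / M) C\<^sub>M\<rfloor> + 1"
      by (elim conjE) (rule minimizer_properties)
  qed
qed

end
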